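(* Let $\Omega$ be a domain, and let $u:\Omega\to\mathbb{D}$ and $v:\Omega\to\mathbb{D}$ be non-constant holomorphic functions such that $u(\mathsf{w}_1)=0=v(\mathsf{w}_2)$ for some $\mathbf{w}=(\mathsf{w}_1,\mathsf{w}_2)\in\Omega^2$. Consider the kernel $K=K_u\otimes K_v$ on $\Omega\times\Omega$. Let $\varphi:\Omega\times\Omega\to\mathbb{D}$ be a non-constant function in $\mathcal{M}_1(\mathcal{H}(K))$ with $\varphi(\mathbf{w})=0$. Then the de Branges-Rovnyak space $\mathcal{H}(K^\varphi)$ is a CNP space if and only if there is $\lambda\in\mathbb{T}$ such that either $\varphi(x,y)=\lambda u(x)$ for all $(x,y)\in\Omega\times\Omega$, or $\varphi(x,y)=\lambda v(y)$ for all $(x,y)\in\Omega\times\Omega$.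
   Context: A domain is a non-empty connected open subset of $\mathbb{C}^d$ for some $d\ge1$. $\mathbb{D}$ is the open unit disc in $\mathbb{C}$ and $\mathbb{T}=\{z\in\mathbb{C}:|z|=1\}$. For $u:\Omega\to\mathbb{D}$, $K_u(x,y)=\frac{1}{1-u(x)\overline{u(y)}}$. The tensor product of kernels $K_1,K_2$ on $\Omega$ is the kernel on $\Omega\times\Omega$ given by $(K_1\otimes K_2)((x_1,x_2),(y_1,y_2))=K_1(x_1,y_1)K_2(x_2,y_2)$. For a kernel (positive semi-definite function) $K$ on a set $X$, $\mathcal{H}(K)$ is the associated reproducing kernel Hilbert space. A multiplier of $\mathcal{H}(K)$ is a function $\varphi:X\to\mathbb{C}$ with $\varphi f\in\mathcal{H}(K)$ for all $f\in\mathcal{H}(K)$; it is contractive if the multiplication operator $M_\varphi f=\varphi f$ satisfies $\|M_\varphi\|\le1$, equivalently if $(1-\varphi(x)\overline{\varphi(y)})K(x,y)$ is a kernel. $\mathcal{M}_1(\mathcal{H}(K))$ is the set of contractive multipliers. For $\varphi\in\mathcal{M}_1(\mathcal{H}(K))$, $K^\varphi(x,y)=(1-\varphi(x)\overline{\varphi(y)})K(x,y)$, and $\mathcal{H}(K^\varphi)$ is the de Branges-Rovnyak space associated to $\varphi$. A kernel $K$ on $X$ is a complete Nevanlinna-Pick (CNP) kernel, and $\mathcal{H}(K)$ a CNP space, if for all $m,n\in\mathbb{N}$, every finite set of distinct points $x_1,\dots,x_k\in X$ and all complex $m\times n$ matrices $W_1,\dots,W_k$ for which the block matrix $[(I-W_iW_j^*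 )K(x_i,x_j)]_{i,j=1}^k$ is positive semi-definite, there is a function $\Phi$ from $X$ to the $m\times n$ matrices, multiplying $\mathcal{H}(K)\otimes\mathbb{C}^n$ into $\mathcal{H}(K)\otimes\mathbb{C}^m$, with $\Phi(x_i)=W_i$ for all $i$ and $\|M_\Phi\|\le1$. *)

theory Defs
  imports "HOL-Analysis.Analysis"
begin

section \<open>Holomorphic functions of several variables\<close>

text \<open>Complex Frechet differentiability: the real derivative is required to be complex linear.\<close>

definition holomorphic_vec_on :: "(complex ^ 'd \<Rightarrow> complex) \<Rightarrow> (complex ^ 'd) set \<Rightarrow> bool" where
  "holomorphic_vec_on f \<Omega> \<longleftrightarrow>
     (\<forall>z\<in>\<Omega>. \<exists>L. (f has_derivative L) (at z within \<Omega>) \<and> (\<forall>c v. L (c *s v) = c * L v))"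

section \<open>Kernels\<close>

definition pos_semidef :: "'i set \<Rightarrow> ('i \<Rightarrow> 'i \<Rightarrow> complex) \<Rightarrow> bool" where
  "pos_semidef I A \<longleftrightarrow> (\<forall>a. (\<Sum>i\<in>I. \<Sum>j\<in>I. cnj (a i) * A i j * a j) \<in> \<real>\<^sub>\<ge>\<^sub>0)"

definition kernel_on :: "'x set \<Rightarrow> ('x \<Rightarrow> 'x \<Rightarrow> complex) \<Rightarrow> bool" where
  "kernel_on X K \<longleftrightarrow> (\<forall>F. finite F \<and> F \<subseteq> X \<longrightarrow> pos_semidef F K)"

definition disc_kernel :: "('x \<Rightarrow> complex) \<Rightarrow> 'x \<Rightarrow> 'x \<Rightarrow> complex" where
  "disc_kernel u x y = 1 / (1 - u x * cnj (u y))"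

definition kernel_tensor ::
  "('x \<Rightarrow> 'x \<Rightarrow> complex) \<Rightarrow> ('y \<Rightarrow> 'y \<Rightarrow> complex) \<Rightarrow> 'x \<times> 'y \<Rightarrow> 'x \<times> 'y \<Rightarrow> complex" where
  "kernel_tensor K1 K2 x y = K1 (fst x) (fst y) * K2 (snd x) (snd y)"

definition dBR_kernel :: "('x \<Rightarrow> complex) \<Rightarrow> ('x \<Rightarrow> 'x \<Rightarrow> complex) \<Rightarrow> 'x \<Rightarrow> 'x \<Rightarrow> complex" where
  "dBR_kernel \<phi> K x y = (1 - \<phi> x * cnj (\<phi> y)) * K x y"

section \<open>Reproducing kernel Hilbert spaces\<close>

text \<open>
  A function on \<open>X\<close> is represented by a total function that vanishes outside \<open>X\<close>. The values
  of \<open>ip\<close> outside \<open>H \<times> H\<close> are irrelevant. Inner products are linear in the first argument.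
\<close>

locale hilbert_function_space =
  fixes X :: "'x set"
    and H :: "('x \<Rightarrow> complex) set"
    and ip :: "('x \<Rightarrow> complex) \<Rightarrow> ('x \<Rightarrow> complex) \<Rightarrow> complex"
  assumes vanish: "\<lbrakk>f \<in> H; x \<notin> X\<rbrakk> \<Longrightarrow> f x = 0"
    and zero_mem: "(\<lambda>x. 0) \<in> H"
    and add_mem: "\<lbrakk>f \<in> H; g \<in> H\<rbrakk> \<Longrightarrow> (\<lambda>x. f x + g x) \<in> H"
    and scale_mem: "f \<in> H \<Longrightarrow> (\<lambda>x. c * f x) \<in> H"
    and ip_add: "\<lbrakk>f \<in> H; g \<in> H; h \<in> H\<rbrakk> \<Longrightarrow> ip (\<lambda>x. f x + g x) h = ip f h + ip g h"
    and ip_scale: "\<lbrakk>f \<in> H; g \<in> H\<rbrakk> \<Longrightarrow> ip (\<lambda>x. c * f x) g = c * ip f g"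
    and ip_cnj: "\<lbrakk>f \<in> H; g \<in> H\<rbrakk> \<Longrightarrow> ip g f = cnj (ip f g)"
    and ip_nonneg: "f \<in> H \<Longrightarrow> ip f f \<in> \<real>\<^sub>\<ge>\<^sub>0"
    and ip_definite: "\<lbrakk>f \<in> H; ip f f = 0\<rbrakk> \<Longrightarrow> f = (\<lambda>x. 0)"
    and complete: "\<lbrakk>\<And>n. s n \<in> H;
        \<And>e. e > 0 \<Longrightarrow> \<exists>N. \<forall>m\<ge>N. \<forall>n\<ge>N.
          sqrt (Re (ip (\<lambda>x. s m x - s n x) (\<lambda>x. s m x - s n x))) < e\<rbrakk>
      \<Longrightarrow> \<exists>f\<in>H. (\<lambda>n. sqrt (Re (ip (\<lambda>x. s n x - f x) (\<lambda>x. s n x - f x)))) \<longlonglongrightarrow> 0"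

definition kernel_section :: "'x set \<Rightarrow> ('x \<Rightarrow> 'x \<Rightarrow> complex) \<Rightarrow> 'x \<Rightarrow> 'x \<Rightarrow> complex" where
  "kernel_section X K y = (\<lambda>x. if x \<in> X then K x y else 0)"

locale reproducing_kernel_space = hilbert_function_space +
  fixes K :: "'a \<Rightarrow> 'a \<Rightarrow> complex"
  assumes section_mem: "y \<in> X \<Longrightarrow> kernel_section X K y \<in> H"
    and reproducing: "\<lbrakk>f \<in> H; y \<in> X\<rbrakk> \<Longrightarrow> f y = ip f (kernel_section X K y)"

text \<open>
  By the Moore-Aronszajn theorem, for a kernel \<open>K\<close> on \<open>X\<close> such a space exists, and both the set
  of functions and the inner product on it are unique; so the choice below is immaterial.
\<close>

definition rkhs :: "'x set \<Rightarrow> ('x \<Rightarrow> 'x \<Rightarrow> complex) \<Rightarrow>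
    ('x \<Rightarrow> complex) set \<times> (('x \<Rightarrow> complex) \<Rightarrow> ('x \<Rightarrow> complex) \<Rightarrow> complex)" where
  "rkhs X K = (SOME S. reproducing_kernel_space X (fst S) (snd S) K)"

definition rkhs_space :: "'x set \<Rightarrow> ('x \<Rightarrow> 'x \<Rightarrow> complex) \<Rightarrow> ('x \<Rightarrow> complex) set" where
  "rkhs_space X K = fst (rkhs X K)"

definition rkhs_norm :: "'x set \<Rightarrow> ('x \<Rightarrow> 'x \<Rightarrow> complex) \<Rightarrow> ('x \<Rightarrow> complex) \<Rightarrow> real" where
  "rkhs_norm X K f = sqrt (Re (snd (rkhs X K) f f))"

section \<open>Multipliers and the complete Nevanlinna-Pick property\<close>

definition contractive_multipliers ::
  "'x set \<Rightarrow> ('x \<Rightarrow> 'x \<Rightarrow> complex) \<Rightarrow> ('x \<Rightarrow> complex) set" where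
  "contractive_multipliers X K =
     {\<phi>. \<forall>f\<in>rkhs_space X K. (\<lambda>x. \<phi> x * f x) \<in> rkhs_space X K \<and>
           rkhs_norm X K (\<lambda>x. \<phi> x * f x) \<le> rkhs_norm X K f}"

text \<open>
  An \<open>m \<times> n\<close> matrix is a function of two indices, of which only the values at \<open>i < m\<close>,
  \<open>j < n\<close> matter. An element of \<open>H(K) \<otimes> \<complex>\<^sup>n\<close> is an \<open>n\<close>-tuple of functions in \<open>H(K)\<close>; its
  squared norm is the sum of the squared norms of the components.
\<close>

definition contractive_matrix_multipliers ::
  "nat \<Rightarrow> nat \<Rightarrow> 'x set \<Rightarrow> ('x \<Rightarrow> 'x \<Rightarrow> complex) \<Rightarrow> ('x \<Rightarrow> nat \<Rightarrow> nat \<Rightarrow> complex) set" where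
  "contractive_matrix_multipliers m n X K =
     {\<Phi>. \<forall>f. (\<forall>j<n. f j \<in> rkhs_space X K) \<longrightarrow>
           (\<forall>i<m. (\<lambda>x. \<Sum>j<n. \<Phi> x i j * f j x) \<in> rkhs_space X K) \<and>
           sqrt (\<Sum>i<m. (rkhs_norm X K (\<lambda>x. \<Sum>j<n. \<Phi> x i j * f j x))\<^sup>2)
             \<le> sqrt (\<Sum>j<n. (rkhs_norm X K (f j))\<^sup>2)}"

text \<open>
  The distinct nodes form the finite set \<open>F\<close>, and the targets \<open>W\<close> are indexed by the nodes. The
  block matrix with \<open>m \<times> m\<close> blocks is indexed by pairs of a node and a row index.
\<close>

definition cnp_kernel :: "'x set \<Rightarrow> ('x \<Rightarrow> 'x \<Rightarrow> complex) \<Rightarrow> bool" where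
  "cnp_kernel X K \<longleftrightarrow> kernel_on X K \<and>
     (\<forall>m n F W. finite F \<and> F \<subseteq> X \<and>
        pos_semidef (F \<times> {..<m})
          (\<lambda>(x, p) (y, q). ((if p = q then 1 else 0) - (\<Sum>r<n. W x p r * cnj (W y q r))) * K x y)
        \<longrightarrow> (\<exists>\<Phi>\<in>contractive_matrix_multipliers m n X K.
              \<forall>x\<in>F. \<forall>p<m. \<forall>q<n. \<Phi> x p q = W x p q))"

end

theory Submission
  imports Defs
begin

text \<open>
  Write \<open>K\<^sup>\<phi>\<close> for the de Branges-Rovnyak kernel; it is normalised at \<open>w\<close>. If it is a complete
  Nevanlinna-Pick kernel, then \<open>R = 1 - 1 / K\<^sup>\<phi>\<close> is positive semidefinite (McCullough-Quiggin).
  Since \<open>K\<close> dominates \<open>1 + u u\<^sup>* + v v\<^sup>*\<close> and \<open>\<phi>\<close> has norm at most one in \<open>H(K)\<close>, near \<open>w\<close>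
  it is \<open>a u + b v\<close> up to second order, where \<open>|a|\<^sup>2 + |b|\<^sup>2 \<le> 1\<close> and equality forces
  \<open>\<phi> = a u + b v\<close> everywhere. Connectedness provides points with \<open>|u| = |v| = \<rho>\<close> for
  all small \<open>\<rho>\<close>. Applying \<open>R\<close> to the mixed second difference through them, which reads off the
  coefficient of \<open>u v\<close>, gives \<open>|a|\<^sup>2 + |b|\<^sup>2 - 4 |a b|\<^sup>2 \<ge> 1\<close> as \<open>\<rho> \<longlongrightarrow> 0\<close>. Hence equality holds
  and \<open>a b = 0\<close>.

  Conversely, for \<open>\<phi> = c u\<close> the kernel \<open>K\<^sup>\<phi>\<close> is the Szego kernel composed with \<open>v\<close>, for which
  matrix-valued interpolation is solved by the lurking isometry argument.
\<close>

section \<open>Spaces of functions with an inner product\<close>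

text \<open>The second difference vanishes on functions of one variable, so u and v drop out and the
  test takes place at order \<open>\<rho> ^ 4\<close>. From R (1 - \<phi> cnj \<phi>) = N, where N =
  u cnj u + v cnj v - u v cnj (u v) - \<phi> cnj \<phi>, one substitution gives R = N + \<phi> N cnj
  \<phi> up to order \<open>\<rho> ^ 6\<close>. At order \<open>\<rho> ^ 4\<close> the function u v
  contributes -1, \<phi> u and \<phi> v contribute |b|^2 and |a|^2, and \<phi>^2 contributes -4 |a
  b|^2, because its coefficient of u v is 2 a b. The obstacle is that \<phi> is controlled to first
  order only: its own second difference has size \<rho>^2, with an unknown coefficient. The spaces
  are given by an arbitrary choice in \<open>rkhs\<close>, so existence has to be proved before
  multipliers can be discussed. Membership of concrete functions and bounds on their norms are then
  obtained by testing against finite combinations of kernel sections.\<close>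

definition ip_norm :: "(('x \<Rightarrow> complex) \<Rightarrow> ('x \<Rightarrow> complex) \<Rightarrow> complex) \<Rightarrow> ('x \<Rightarrow> complex) \<Rightarrow> real" where
  "ip_norm ip f = sqrt (Re (ip f f))"

text \<open>Only semidefiniteness is asked of the form, and no completeness, so that the span of the
  kernel sections, its completion and the final Hilbert space can all be instances.\<close>

locale pre_hilbert_function_space =
  fixes H :: "('x \<Rightarrow> complex) set"
    and ip :: "('x \<Rightarrow> complex) \<Rightarrow> ('x \<Rightarrow> complex) \<Rightarrow> complex"
  assumes zero_mem: "(\<lambda>x. 0) \<in> H"
    and add_mem: "\<lbrakk>f \<in> H; g \<in> H\<rbrakk> \<Longrightarrow> (\<lambda>x. f x + g x) \<in> H"
    and scale_mem: "f \<in> H \<Longrightarrow> (\<lambda>x. c * f x) \<in> H"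
    and ip_add: "\<lbrakk>f \<in> H; g \<in> H; h \<in> H\<rbrakk> \<Longrightarrow> ip (\<lambda>x. f x + g x) h = ip f h + ip g h"
    and ip_scale: "\<lbrakk>f \<in> H; g \<in> H\<rbrakk> \<Longrightarrow> ip (\<lambda>x. c * f x) g = c * ip f g"
    and ip_cnj: "\<lbrakk>f \<in> H; g \<in> H\<rbrakk> \<Longrightarrow> ip g f = cnj (ip f g)"
    and ip_nonneg: "f \<in> H \<Longrightarrow> ip f f \<in> \<real>\<^sub>\<ge>\<^sub>0"
begin

abbreviation nrm :: "('x \<Rightarrow> complex) \<Rightarrow> real" where "nrm \<equiv> ip_norm ip"

lemma diff_mem: "\<lbrakk>f \<in> H; g \<in> H\<rbrakk> \<Longrightarrow> (\<lambda>x. f x - g x) \<in> H"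
  using add_mem[of f "\<lambda>x. (-1) * g x"] scale_mem[of g "-1"] by simp

lemma ip_diff: "\<lbrakk>f \<in> H; g \<in> H; h \<in> H\<rbrakk> \<Longrightarrow> ip (\<lambda>x. f x - g x) h = ip f h - ip g h"
  using ip_add[of f "\<lambda>x. (-1) * g x" h] scale_mem[of g "-1"] ip_scale[of g h "-1"] by simp

lemma ip_add_right: "\<lbrakk>f \<in> H; g \<in> H; h \<in> H\<rbrakk> \<Longrightarrow> ip h (\<lambda>x. f x + g x) = ip h f + ip h g"
  by (subst (1 2 3) ip_cnj) (simp_all add: add_mem ip_add)

lemma ip_diff_right: "\<lbrakk>f \<in> H; g \<in> H; h \<in> H\<rbrakk> \<Longrightarrow> ip h (\<lambda>x. f x - g x) = ip h f - ip h g"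
  by (subst (1 2 3) ip_cnj) (simp_all add: diff_mem ip_diff)

lemma ip_scale_right: "\<lbrakk>f \<in> H; g \<in> H\<rbrakk> \<Longrightarrow> ip g (\<lambda>x. c * f x) = cnj c * ip g f"
  by (subst (1 2) ip_cnj) (simp_all add: scale_mem ip_scale)

lemma ip_zero: "f \<in> H \<Longrightarrow> ip (\<lambda>x. 0) f = 0"
  using ip_scale[of "\<lambda>x. 0" f 0] zero_mem by simp

lemma sum_mem:
  assumes "finite I" "\<And>i. i \<in> I \<Longrightarrow> f i \<in> H"
  shows "(\<lambda>x. \<Sum>i\<in>I. c i * f i x) \<in> H"
  using assms
proof (induction I rule: finite_induct)
  case (insert i I)
  then show ?case using add_mem[OF scale_mem[of "f i" "c i"], of "\<lambda>x. \<Sum>i\<in>I. c i * f i x"] by simp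
qed (simp add: zero_mem)

lemma ip_sum:
  assumes "finite I" "\<And>i. i \<in> I \<Longrightarrow> f i \<in> H" "g \<in> H"
  shows "ip (\<lambda>x. \<Sum>i\<in>I. c i * f i x) g = (\<Sum>i\<in>I. c i * ip (f i) g)"
  using assms
proof (induction I rule: finite_induct)
  case (insert i I)
  then have "(\<lambda>x. \<Sum>i\<in>I. c i * f i x) \<in> H" by (intro sum_mem) auto
  with insert show ?case by (simp add: ip_add scale_mem ip_scale)
qed (simp add: ip_zero)

lemma ip_sum_right:
  assumes "finite I" "\<And>i. i \<in> I \<Longrightarrow> f i \<in> H" "g \<in> H"
  shows "ip g (\<lambda>x. \<Sum>i\<in>I. c i * f i x) = (\<Sum>i\<in>I. cnj (c i) * ip g (f i))"
proof -
  have "ip g (\<lambda>x. \<Sum>i\<in>I. c i * f i x) = cnj (\<Sum>i\<in>I. c i * ip (f i) g)"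
    using ip_cnj[OF sum_mem[OF assms(1,2), where c=c] assms(3)] ip_sum[OF assms, where c=c] by simp
  also have "\<dots> = (\<Sum>i\<in>I. cnj (c i) * ip g (f i))"
    unfolding cnj_sum by (rule sum.cong) (auto simp: ip_cnj[OF assms(2) assms(3)])
  finally show ?thesis .
qed

lemma nrm_nonneg: "f \<in> H \<Longrightarrow> 0 \<le> nrm f"
  using ip_nonneg[of f] by (simp add: ip_norm_def complex_nonneg_Reals_iff)

lemma ip_self: "f \<in> H \<Longrightarrow> ip f f = of_real ((nrm f)\<^sup>2)"
  using ip_nonneg[of f] by (simp add: ip_norm_def complex_nonneg_Reals_iff complex_eq_iff)

lemma nrm_power2: "f \<in> H \<Longrightarrow> (nrm f)\<^sup>2 = Re (ip f f)"
  by (simp add: ip_self)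

lemma nrm_zero: "nrm (\<lambda>x. 0) = 0"
  using ip_zero[OF zero_mem] by (simp add: ip_norm_def)

lemma nrm_add_power2:
  assumes "f \<in> H" "g \<in> H"
  shows "(nrm (\<lambda>x. f x + g x))\<^sup>2 = (nrm f)\<^sup>2 + 2 * Re (ip f g) + (nrm g)\<^sup>2"
  using assms ip_cnj[of f g]
  by (simp add: nrm_power2 add_mem ip_add ip_add_right)

lemma nrm_scale: "f \<in> H \<Longrightarrow> nrm (\<lambda>x. c * f x) = norm c * nrm f"
proof -
  assume f: "f \<in> H"
  have "ip (\<lambda>x. c * f x) (\<lambda>x. c * f x) = (c * cnj c) * ip f f"
    using f by (simp add: ip_scale ip_scale_right scale_mem)
  also have "\<dots> = of_real ((norm c)\<^sup>2 * (nrm f)\<^sup>2)"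
    using ip_self[OF f] by (simp only: complex_norm_square[symmetric] of_real_mult)
  finally have "nrm (\<lambda>x. c * f x) = sqrt ((norm c * nrm f)\<^sup>2)"
    unfolding ip_norm_def[of ip "\<lambda>x. c * f x"] by (simp add: power_mult_distrib)
  with nrm_nonneg[OF f] show ?thesis by simp
qed

lemma nrm_diff_power2:
  assumes "f \<in> H" "g \<in> H"
  shows "(nrm (\<lambda>x. f x - g x))\<^sup>2 = (nrm f)\<^sup>2 - 2 * Re (ip f g) + (nrm g)\<^sup>2"
  using assms ip_cnj[of f g]
  by (simp add: nrm_power2 diff_mem ip_diff ip_diff_right)

lemma Cauchy_Schwarz:
  assumes f: "f \<in> H" and g: "g \<in> H"
  shows "norm (ip f g) \<le> nrm f * nrm g"
proof -
  define w where "w = ip f g"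
  \<comment> \<open>This is the squared norm of \<open>f - t w g\<close> for real t. Putting w into
    the multiplier makes the cross term real, so a quadratic in one real variable remains.\<close>
  have *: "0 \<le> (nrm f)\<^sup>2 - 2 * t * (norm w)\<^sup>2 + t\<^sup>2 * (norm w)\<^sup>2 * (nrm g)\<^sup>2" for t :: real
  proof -
    have "0 \<le> (nrm (\<lambda>x. f x - (of_real t * w) * g x))\<^sup>2" by simp
    also have "\<dots> = (nrm f)\<^sup>2 - 2 * Re (cnj (of_real t * w) * w) + (norm (of_real t * w) * nrm g)\<^sup>2"
      using f g by (simp only: nrm_diff_power2 scale_mem ip_scale_right nrm_scale w_def)
    also have "Re (cnj (of_real t * w) * w) = t * (norm w)\<^sup>2"
      unfolding cmod_power2 by (simp add: algebra_simps power2_eq_square)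
    finally show ?thesis by (simp add: power_mult_distrib norm_mult algebra_simps)
  qed
  have "(norm w)\<^sup>2 \<le> (nrm f * nrm g)\<^sup>2"
  proof (cases "nrm g = 0")
    case False
    then have "nrm g > 0" using nrm_nonneg[OF g] by simp
    then show ?thesis using *[of "1 / (nrm g)\<^sup>2"]
      by (simp add: field_simps power2_eq_square)
  next
    case True
    have "norm w = 0"
    proof (rule ccontr)
      assume "norm w \<noteq> 0"
      \<comment> \<open>In a semidefinite form g may have norm zero without being zero. The
        polynomial is then affine in t, and at this t it equals -1.\<close>
      then show False
        using *[of "((nrm f)\<^sup>2 + 1) / (2 * (norm w)\<^sup>2)"] True by (simp add: field_simps)
    qed
    then show ?thesis by simp
  qed
  then show ?thesis
    using nrm_nonneg f g by (simp add: w_def power2_le_iff_abs_le)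
qed

lemma nrm_triangle:
  assumes f: "f \<in> H" and g: "g \<in> H"
  shows "nrm (\<lambda>x. f x + g x) \<le> nrm f + nrm g"
proof -
  have "Re (ip f g) \<le> nrm f * nrm g"
    using Cauchy_Schwarz[OF f g] complex_Re_le_cmod order_trans by blast
  then have "(nrm (\<lambda>x. f x + g x))\<^sup>2 \<le> (nrm f + nrm g)\<^sup>2"
    using nrm_add_power2[OF f g] by (simp add: power2_sum)
  then show ?thesis using nrm_nonneg f g by (meson add_nonneg_nonneg power2_le_imp_le)
qed

lemma nrm_minus: "\<lbrakk>f \<in> H; g \<in> H\<rbrakk> \<Longrightarrow> nrm (\<lambda>x. f x - g x) = nrm (\<lambda>x. g x - f x)"
  using nrm_scale[OF diff_mem, of f g "-1"] by simp

lemma nrm_triangle_diff: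
  assumes "f \<in> H" "g \<in> H" "h \<in> H"
  shows "nrm (\<lambda>x. f x - h x) \<le> nrm (\<lambda>x. f x - g x) + nrm (\<lambda>x. g x - h x)"
  using nrm_triangle[OF diff_mem diff_mem, of f g g h] assms by simp

lemma nrm_le_diff:
  assumes "f \<in> H" "g \<in> H"
  shows "nrm f \<le> nrm (\<lambda>x. f x - g x) + nrm g"
  using nrm_triangle[OF diff_mem, of f g g] assms by simp

definition nrm_Cauchy :: "(nat \<Rightarrow> 'x \<Rightarrow> complex) \<Rightarrow> bool" where
  "nrm_Cauchy s \<longleftrightarrow> (\<forall>n. s n \<in> H) \<and>
     (\<forall>e>0. \<exists>N. \<forall>m\<ge>N. \<forall>n\<ge>N. nrm (\<lambda>x. s m x - s n x) < e)"

lemma nrm_Cauchy_mem: "nrm_Cauchy s \<Longrightarrow> s n \<in> H"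
  by (simp add: nrm_Cauchy_def)

lemma nrm_CauchyD:
  "\<lbrakk>nrm_Cauchy s; e > 0\<rbrakk> \<Longrightarrow> \<exists>N. \<forall>m\<ge>N. \<forall>n\<ge>N. nrm (\<lambda>x. s m x - s n x) < e"
  by (simp add: nrm_Cauchy_def)

lemma nrm_Cauchy_const: "f \<in> H \<Longrightarrow> nrm_Cauchy (\<lambda>n. f)"
  by (simp add: nrm_Cauchy_def nrm_zero)

lemma nrm_Cauchy_add:
  assumes s: "nrm_Cauchy s" and t: "nrm_Cauchy t"
  shows "nrm_Cauchy (\<lambda>n x. s n x + t n x)"
  unfolding nrm_Cauchy_def
proof safe
  fix e :: real assume "e > 0"
  obtain M where M: "\<And>m n. m \<ge> M \<Longrightarrow> n \<ge> M \<Longrightarrow> nrm (\<lambda>x. s m x - s n x) < e/2"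
    using nrm_CauchyD[OF s, of "e/2"] \<open>e > 0\<close> by auto
  obtain N where N: "\<And>m n. m \<ge> N \<Longrightarrow> n \<ge> N \<Longrightarrow> nrm (\<lambda>x. t m x - t n x) < e/2"
    using nrm_CauchyD[OF t, of "e/2"] \<open>e > 0\<close> by auto
  have "nrm (\<lambda>x. s m x + t m x - (s n x + t n x)) < e" if "m \<ge> max M N" "n \<ge> max M N" for m n
  proof -
    have "(\<lambda>x. s m x + t m x - (s n x + t n x)) = (\<lambda>x. (s m x - s n x) + (t m x - t n x))"
      by (auto simp: algebra_simps)
    moreover have "nrm (\<lambda>x. (s m x - s n x) + (t m x - t n x))
        \<le> nrm (\<lambda>x. s m x - s n x) + nrm (\<lambda>x. t m x - t n x)"
      by (intro nrm_triangle diff_mem nrm_Cauchy_mem[OF s] nrm_Cauchy_mem[OF t])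
    ultimately show ?thesis using M[of m n] N[of m n] that by simp
  qed
  then show "\<exists>N. \<forall>m\<ge>N. \<forall>n\<ge>N. nrm (\<lambda>x. s m x + t m x - (s n x + t n x)) < e" by blast
qed (use s t in \<open>auto simp: nrm_Cauchy_def intro: add_mem\<close>)

lemma nrm_Cauchy_scale:
  assumes s: "nrm_Cauchy s"
  shows "nrm_Cauchy (\<lambda>n x. c * s n x)"
  unfolding nrm_Cauchy_def
proof safe
  fix e :: real assume "e > 0"
  have pos: "norm c + 1 > 0" by (simp add: add_nonneg_pos)
  obtain M where M: "\<And>m n. m \<ge> M \<Longrightarrow> n \<ge> M \<Longrightarrow> nrm (\<lambda>x. s m x - s n x) < e / (norm c + 1)"
    using nrm_CauchyD[OF s divide_pos_pos[OF \<open>e > 0\<close> pos]] by blast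
  have "nrm (\<lambda>x. c * s m x - c * s n x) < e" if "m \<ge> M" "n \<ge> M" for m n
  proof -
    have d: "(\<lambda>x. s m x - s n x) \<in> H" using s by (auto simp: nrm_Cauchy_def intro: diff_mem)
    have "nrm (\<lambda>x. c * s m x - c * s n x) = norm c * nrm (\<lambda>x. s m x - s n x)"
      using nrm_scale[OF d, of c] by (simp add: algebra_simps)
    also have "\<dots> \<le> (norm c + 1) * nrm (\<lambda>x. s m x - s n x)"
      using nrm_nonneg[OF d] by (simp add: mult_right_mono)
    also have "\<dots> < e" using M[OF that] pos by (simp add: pos_less_divide_eq mult.commute)
    finally show ?thesis .
  qed
  then show "\<exists>N. \<forall>m\<ge>N. \<forall>n\<ge>N. nrm (\<lambda>x. c * s m x - c * s n x) < e" by blast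
qed (use s in \<open>auto simp: nrm_Cauchy_def intro: scale_mem\<close>)

lemma nrm_Cauchy_diff:
  "\<lbrakk>nrm_Cauchy s; nrm_Cauchy t\<rbrakk> \<Longrightarrow> nrm_Cauchy (\<lambda>n x. s n x - t n x)"
  using nrm_Cauchy_add[of s "\<lambda>n x. (-1) * t n x"] nrm_Cauchy_scale[of t "-1"] by simp

lemma nrm_Cauchy_bounded:
  assumes s: "nrm_Cauchy s"
  obtains B where "B > 0" "\<And>n. nrm (s n) \<le> B"
proof -
  obtain N where N: "\<And>m n. m \<ge> N \<Longrightarrow> n \<ge> N \<Longrightarrow> nrm (\<lambda>x. s m x - s n x) < 1"
    using nrm_CauchyD[OF s zero_less_one] by metis
  define B where "B = 1 + nrm (s N) + (\<Sum>k<N. nrm (s k))"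
  have nn: "nrm (s n) \<ge> 0" for n using nrm_nonneg[OF nrm_Cauchy_mem[OF s]] .
  have sum: "(\<Sum>k<N. nrm (s k)) \<ge> 0" by (rule sum_nonneg) (rule nn)
  have "nrm (s n) \<le> B" for n
  proof (cases "n < N")
    case True
    then have "nrm (s n) \<le> (\<Sum>k<N. nrm (s k))"
      using member_le_sum[of n "{..<N}" "\<lambda>k. nrm (s k)"] nn by simp
    then show ?thesis using nn[of N] unfolding B_def by linarith
  next
    case False
    have "nrm (s n) \<le> nrm (\<lambda>x. s n x - s N x) + nrm (s N)"
      by (intro nrm_le_diff nrm_Cauchy_mem[OF s])
    moreover have "nrm (\<lambda>x. s n x - s N x) < 1" using N[of n N] False by simp
    ultimately show ?thesis using sum unfolding B_def by linarith
  qed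
  moreover have "B > 0" using nn[of N] sum unfolding B_def by linarith
  ultimately show ?thesis by (intro that)
qed

end

sublocale hilbert_function_space \<subseteq> pre: pre_hilbert_function_space H ip
proof
  show "(\<lambda>x. 0) \<in> H" by (fact zero_mem)
  show "ip f f \<in> \<real>\<^sub>\<ge>\<^sub>0" if "f \<in> H" for f using that by (rule ip_nonneg)
qed (fact add_mem scale_mem ip_add ip_scale ip_cnj)+

section \<open>Positive semidefinite functions\<close>

lemma pos_semidef_subset:
  assumes "finite I" "J \<subseteq> I" "pos_semidef I A"
  shows "pos_semidef J A"
  unfolding pos_semidef_def
proof
  fix a
  define b :: "_ \<Rightarrow> complex" where "b = (\<lambda>i. if i \<in> J then a i else 0)"
  have "(\<Sum>i\<in>I. \<Sum>j\<in>I. cnj (b i) * A i j * b j) = (\<Sum>i\<in>I. \<Sum>j\<in>J. cnj (b i) * A i j * b j)"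
    using assms(1,2) by (intro sum.cong[OF refl] sum.mono_neutral_right) (auto simp: b_def)
  also have "\<dots> = (\<Sum>i\<in>J. \<Sum>j\<in>J. cnj (b i) * A i j * b j)"
    using assms(1,2) by (intro sum.mono_neutral_right) (auto simp: b_def)
  also have "\<dots> = (\<Sum>i\<in>J. \<Sum>j\<in>J. cnj (a i) * A i j * a j)"
    by (intro sum.cong refl) (auto simp: b_def)
  finally show "(\<Sum>i\<in>J. \<Sum>j\<in>J. cnj (a i) * A i j * a j) \<in> \<real>\<^sub>\<ge>\<^sub>0"
    using spec[OF assms(3)[unfolded pos_semidef_def], of b] by simp
qed

lemma pos_semidef_cong:
  assumes "\<And>i j. i \<in> I \<Longrightarrow> j \<in> I \<Longrightarrow> A i j = B i j"
  shows "pos_semidef I A \<longleftrightarrow> pos_semidef I B"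
proof -
  have "(\<Sum>i\<in>I. \<Sum>j\<in>I. cnj (a i) * A i j * a j) = (\<Sum>i\<in>I. \<Sum>j\<in>I. cnj (a i) * B i j * a j)" for a
    using assms by (intro sum.cong refl) simp
  then show ?thesis unfolding pos_semidef_def by simp
qed

lemma pos_semidef_diag:
  assumes "finite I" "pos_semidef I A" "i \<in> I"
  shows "A i i \<in> \<real>\<^sub>\<ge>\<^sub>0"
proof -
  have "pos_semidef {i} A" using assms by (intro pos_semidef_subset[OF assms(1) _ assms(2)]) simp
  from spec[OF this[unfolded pos_semidef_def], of "\<lambda>_. 1"] show ?thesis by simp
qed

text \<open>Symmetry is not built into \<open>pos_semidef\<close>; it follows because the quadratic
  form is real on all complex vectors. The vectors (1, 1) and (1, \<i>) on the two coordinates give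
  the imaginary and the real part.\<close>

lemma pos_semidef_hermitian:
  assumes "finite I" "pos_semidef I A" "i \<in> I" "j \<in> I"
  shows "A j i = cnj (A i j)"
proof (cases "i = j")
  case True
  then show ?thesis using pos_semidef_diag[OF assms(1,2,3)]
    by (simp add: complex_nonneg_Reals_iff complex_eq_iff)
next
  case False
  have ii: "Im (A i i) = 0" "Im (A j j) = 0"
    using pos_semidef_diag[OF assms(1,2)] assms by (auto simp: complex_nonneg_Reals_iff)
  have P: "pos_semidef {i, j} A" using assms by (intro pos_semidef_subset[OF assms(1) _ assms(2)]) simp
  have "Im (A i i + c * A i j + cnj c * A j i + cnj c * c * A j j) = 0" for c
  proof -
    from spec[OF P[unfolded pos_semidef_def], of "(\<lambda>_. c)(i := 1)"]
    show ?thesis using False by (simp add: complex_nonneg_Reals_iff algebra_simps)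
  qed
  from this[of 1] this[of \<i>] ii show ?thesis by (simp add: complex_eq_iff)
qed

lemma kernel_on_hermitian:
  "\<lbrakk>kernel_on X K; x \<in> X; y \<in> X\<rbrakk> \<Longrightarrow> K y x = cnj (K x y)"
  using pos_semidef_hermitian[of "{x, y}" K x y] by (simp add: kernel_on_def)

lemma kernel_on_diag: "\<lbrakk>kernel_on X K; x \<in> X\<rbrakk> \<Longrightarrow> K x x \<in> \<real>\<^sub>\<ge>\<^sub>0"
  using pos_semidef_diag[of "{x}" K x] by (simp add: kernel_on_def)

text \<open>The first-order condition at a minimum: a quadratic without constant term that is never
  negative has no linear part. It is applied wherever positivity pins down a value: for the Riesz
  representative, for extensions of the all-one matrix and for zero pivots.\<close>

lemma linear_form_eq_zero:
  fixes d :: complex and \<kappa> :: real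
  assumes pos: "\<And>t. 0 \<le> 2 * Re (t * d) + (norm t)\<^sup>2 * \<kappa>" and \<kappa>: "\<kappa> \<ge> 0"
  shows "d = 0"
proof -
  \<comment> \<open>Any positive r with \<open>r * \<kappa> < 2\<close> serves: at
    \<open>t = - r * cnj d\<close> the form equals |d|^2 r (r \<kappa> - 2).\<close>
  define r where "r = inverse (\<kappa> + 1)"
  have r: "r > 0" "r * \<kappa> < 2" using \<kappa> by (simp_all add: r_def field_simps)
  from pos[of "- of_real r * cnj d"]
  have "0 \<le> (norm d)\<^sup>2 * (r * (r * \<kappa> - 2))"
    unfolding cmod_power2 by (simp add: algebra_simps power2_eq_square)
  moreover have "r * (r * \<kappa> - 2) < 0" using r by (simp add: mult_pos_neg)
  ultimately have "norm d = 0" using mult_pos_neg[of "(norm d)\<^sup>2"] by fastforce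
  then show ?thesis by simp
qed

lemma pos_semidef_add:
  assumes "pos_semidef I A" "pos_semidef I B"
  shows "pos_semidef I (\<lambda>i j. A i j + B i j)"
  unfolding pos_semidef_def
proof
  fix a
  have "(\<Sum>i\<in>I. \<Sum>j\<in>I. cnj (a i) * (A i j + B i j) * a j)
      = (\<Sum>i\<in>I. \<Sum>j\<in>I. cnj (a i) * A i j * a j) + (\<Sum>i\<in>I. \<Sum>j\<in>I. cnj (a i) * B i j * a j)"
    by (simp add: algebra_simps sum.distrib)
  also have "\<dots> \<in> \<real>\<^sub>\<ge>\<^sub>0"
    using spec[OF assms(1)[unfolded pos_semidef_def], of a]
      spec[OF assms(2)[unfolded pos_semidef_def], of a] by (rule nonneg_Reals_add_I)
  finally show "(\<Sum>i\<in>I. \<Sum>j\<in>I. cnj (a i) * (A i j + B i j) * a j) \<in> \<real>\<^sub>\<ge>\<^sub>0" .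
qed

lemma pos_semidef_zero: "pos_semidef I (\<lambda>i j. 0)"
  by (simp add: pos_semidef_def)

lemma pos_semidef_sum:
  assumes "\<And>k. k \<in> S \<Longrightarrow> pos_semidef I (A k)"
  shows "pos_semidef I (\<lambda>i j. \<Sum>k\<in>S. A k i j)"
  using assms
proof (induction S rule: infinite_finite_induct)
  case (insert k S)
  then show ?case using pos_semidef_add[of I "A k" "\<lambda>i j. \<Sum>k\<in>S. A k i j"] by simp
qed (simp_all add: pos_semidef_zero)

text \<open>Schur multiplication by a rank-one kernel only changes the test vector. With sums and
  limits this yields the product with a Szego kernel.\<close>

lemma pos_semidef_mult_rank_one:
  assumes "pos_semidef I A"
  shows "pos_semidef I (\<lambda>i j. g i * cnj (g j) * A i j)"
  unfolding pos_semidef_def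
proof
  fix a
  have "(\<Sum>i\<in>I. \<Sum>j\<in>I. cnj (a i) * (g i * cnj (g j) * A i j) * a j)
      = (\<Sum>i\<in>I. \<Sum>j\<in>I. cnj (cnj (g i) * a i) * A i j * (cnj (g j) * a j))"
    by (simp add: mult_ac)
  also have "\<dots> \<in> \<real>\<^sub>\<ge>\<^sub>0"
    using spec[OF assms[unfolded pos_semidef_def], of "\<lambda>i. cnj (g i) * a i"] .
  finally show "(\<Sum>i\<in>I. \<Sum>j\<in>I. cnj (a i) * (g i * cnj (g j) * A i j) * a j) \<in> \<real>\<^sub>\<ge>\<^sub>0" .
qed

lemma sum_rank_one:
  "(\<Sum>i\<in>I. \<Sum>j\<in>I. cnj (a i) * (g i * cnj (g j)) * a j) = of_real ((norm (\<Sum>i\<in>I. cnj (a i) * g i))\<^sup>2)"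
proof -
  have "cnj (\<Sum>i\<in>I. cnj (a i) * g i) = (\<Sum>j\<in>I. cnj (g j) * a j)"
    by (simp add: cnj_sum mult.commute)
  then have "of_real ((norm (\<Sum>i\<in>I. cnj (a i) * g i))\<^sup>2)
      = (\<Sum>i\<in>I. cnj (a i) * g i) * (\<Sum>j\<in>I. cnj (g j) * a j)"
    unfolding complex_norm_square by simp
  also have "\<dots> = (\<Sum>i\<in>I. \<Sum>j\<in>I. cnj (a i) * (g i * cnj (g j)) * a j)"
    by (simp add: sum_product mult.assoc)
  finally show ?thesis by simp
qed

lemma pos_semidef_one: "pos_semidef I (\<lambda>i j. 1)"
  unfolding pos_semidef_def
proof
  fix a
  have "(\<Sum>i\<in>I. \<Sum>j\<in>I. cnj (a i) * 1 * a j) = of_real ((norm (\<Sum>i\<in>I. cnj (a i)))\<^sup>2)"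
    using sum_rank_one[where I=I and a=a and g="\<lambda>_. 1"] by simp
  then show "(\<Sum>i\<in>I. \<Sum>j\<in>I. cnj (a i) * 1 * a j) \<in> \<real>\<^sub>\<ge>\<^sub>0"
    by (simp only: nonneg_Reals_of_real_iff zero_le_power2)
qed

lemma pos_semidef_rank_one: "pos_semidef I (\<lambda>i j. g i * cnj (g j))"
  using pos_semidef_mult_rank_one[OF pos_semidef_one, of I g] by simp

section \<open>Existence of the reproducing kernel Hilbert space\<close>

definition kernel_comb ::
  "'x set \<Rightarrow> ('x \<Rightarrow> 'x \<Rightarrow> complex) \<Rightarrow> 'x set \<Rightarrow> ('x \<Rightarrow> complex) \<Rightarrow> 'x \<Rightarrow> complex" where
  "kernel_comb X K F a = (\<lambda>x. \<Sum>y\<in>F. a y * kernel_section X K y x)"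

definition kernel_span :: "'x set \<Rightarrow> ('x \<Rightarrow> 'x \<Rightarrow> complex) \<Rightarrow> ('x \<Rightarrow> complex) set" where
  "kernel_span X K = {kernel_comb X K F a |F a. finite F \<and> F \<subseteq> X}"

text \<open>A function in the span may have several representations. The first argument enters
  through its values only, so independence of the representation is at stake for \<open>g\<close>
  alone; the description quantifies over all representations of \<open>g\<close>.\<close>

definition kernel_span_ip ::
  "'x set \<Rightarrow> ('x \<Rightarrow> 'x \<Rightarrow> complex) \<Rightarrow> ('x \<Rightarrow> complex) \<Rightarrow> ('x \<Rightarrow> complex) \<Rightarrow> complex" where
  "kernel_span_ip X K f g = (THE c. \<forall>F b. finite F \<longrightarrow> F \<subseteq> X \<longrightarrow> g = kernel_comb X K F b \<longrightarrow>
      c = (\<Sum>y\<in>F. cnj (b y) * f y))"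

lemma kernel_comb_extend:
  assumes "finite G" "F \<subseteq> G"
  shows "kernel_comb X K F a = kernel_comb X K G (\<lambda>y. if y \<in> F then a y else 0)"
  unfolding kernel_comb_def using assms
  by (intro ext sum.mono_neutral_cong_left) auto

text \<open>Evaluating one combination against the coefficients of the other can be done from either
  side. This gives both the well-definedness of \<open>kernel_span_ip\<close> and its Hermitian
  symmetry.\<close>

lemma kernel_comb_swap:
  assumes "kernel_on X K" "F \<subseteq> X" "G \<subseteq> X"
  shows "(\<Sum>y\<in>G. cnj (b y) * kernel_comb X K F a y)
    = (\<Sum>x\<in>F. a x * cnj (kernel_comb X K G b x))"
proof -
  have "(\<Sum>y\<in>G. cnj (b y) * kernel_comb X K F a y) = (\<Sum>y\<in>G. \<Sum>x\<in>F. cnj (b y) * a x * K y x)"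
    unfolding kernel_comb_def kernel_section_def using assms
    by (intro sum.cong refl) (auto simp: sum_distrib_left mult_ac intro!: sum.cong)
  also have "\<dots> = (\<Sum>x\<in>F. \<Sum>y\<in>G. cnj (b y) * a x * K y x)" by (rule sum.swap)
  also have "\<dots> = (\<Sum>x\<in>F. a x * cnj (kernel_comb X K G b x))"
  proof (rule sum.cong[OF refl])
    fix x assume x: "x \<in> F"
    have "a x * cnj (kernel_comb X K G b x) = (\<Sum>y\<in>G. a x * (cnj (b y) * cnj (K x y)))"
      using x assms(2) by (auto simp: kernel_comb_def kernel_section_def cnj_sum sum_distrib_left)
    also have "\<dots> = (\<Sum>y\<in>G. cnj (b y) * a x * K y x)"
    proof (rule sum.cong[OF refl])
      fix y assume "y \<in> G"
      then have "K y x = cnj (K x y)" using x assms by (intro kernel_on_hermitian[OF assms(1)]) auto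
      then show "a x * (cnj (b y) * cnj (K x y)) = cnj (b y) * a x * K y x" by simp
    qed
    finally show "(\<Sum>y\<in>G. cnj (b y) * a x * K y x) = a x * cnj (kernel_comb X K G b x)" by simp
  qed
  finally show ?thesis .
qed

lemma kernel_span_ip_eq:
  assumes K: "kernel_on X K" and f: "f \<in> kernel_span X K" and G: "finite G" "G \<subseteq> X"
  shows "kernel_span_ip X K f (kernel_comb X K G b) = (\<Sum>y\<in>G. cnj (b y) * f y)"
  unfolding kernel_span_ip_def
proof (rule the_equality)
  obtain F a where F: "finite F" "F \<subseteq> X" "f = kernel_comb X K F a"
    using f by (auto simp: kernel_span_def)
  show "\<forall>H c. finite H \<longrightarrow> H \<subseteq> X \<longrightarrow> kernel_comb X K G b = kernel_comb X K H c \<longrightarrow>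
      (\<Sum>y\<in>G. cnj (b y) * f y) = (\<Sum>y\<in>H. cnj (c y) * f y)"
    using kernel_comb_swap[OF K F(2)] G by (simp add: F(3))
qed (use G in blast)

locale pre_rkhs = pre_hilbert_function_space H ip for H :: "('x \<Rightarrow> complex) set" and ip +
  fixes X :: "'x set" and K :: "'x \<Rightarrow> 'x \<Rightarrow> complex"
  assumes vanish: "\<lbrakk>f \<in> H; x \<notin> X\<rbrakk> \<Longrightarrow> f x = 0"
    and section_mem: "y \<in> X \<Longrightarrow> kernel_section X K y \<in> H"
    and reproducing: "\<lbrakk>f \<in> H; y \<in> X\<rbrakk> \<Longrightarrow> f y = ip f (kernel_section X K y)"
begin

lemma ip_section_section:
  "\<lbrakk>x \<in> X; y \<in> X\<rbrakk> \<Longrightarrow> ip (kernel_section X K y) (kernel_section X K x) = K x y"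
  using reproducing[OF section_mem, of y x] by (simp add: kernel_section_def)

lemma nrm_section: "y \<in> X \<Longrightarrow> nrm (kernel_section X K y) = sqrt (Re (K y y))"
  by (simp add: ip_norm_def ip_section_section)

lemma norm_eval_le:
  "\<lbrakk>f \<in> H; y \<in> X\<rbrakk> \<Longrightarrow> norm (f y) \<le> nrm f * sqrt (Re (K y y))"
  using Cauchy_Schwarz[OF _ section_mem, of f y] reproducing[of f y] by (simp add: nrm_section)

lemma comb_mem: "\<lbrakk>finite F; F \<subseteq> X\<rbrakk> \<Longrightarrow> kernel_comb X K F a \<in> H"
  unfolding kernel_comb_def by (rule sum_mem) (auto intro: section_mem)

lemma ip_comb_right:
  assumes "finite F" "F \<subseteq> X" "f \<in> H"
  shows "ip f (kernel_comb X K F a) = (\<Sum>y\<in>F. cnj (a y) * f y)"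
  unfolding kernel_comb_def using assms
  by (subst ip_sum_right) (auto intro: section_mem intro!: sum.cong simp flip: reproducing)

lemma ip_comb_comb:
  assumes "finite F" "F \<subseteq> X"
  shows "ip (kernel_comb X K F a) (kernel_comb X K F b) = (\<Sum>x\<in>F. \<Sum>y\<in>F. cnj (b x) * K x y * a y)"
  unfolding ip_comb_right[OF assms comb_mem[OF assms]] using assms(2)
  by (intro sum.cong refl) (auto simp: kernel_comb_def kernel_section_def sum_distrib_left mult_ac
      intro!: sum.cong)

end

lemma pre_rkhs_kernel_span:
  assumes K: "kernel_on X K"
  shows "pre_rkhs (kernel_span X K) (kernel_span_ip X K) X K"
proof
  let ?H = "kernel_span X K" and ?ip = "kernel_span_ip X K"
  note ip = kernel_span_ip_eq[OF K]
  show zero: "(\<lambda>x. 0) \<in> ?H"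
    unfolding kernel_span_def kernel_comb_def by (auto intro!: exI[of _ "{}"])
  show add: "(\<lambda>x. f x + g x) \<in> ?H" if fg: "f \<in> ?H" "g \<in> ?H" for f g
  proof -
    obtain F a G b where F: "finite F" "F \<subseteq> X" "f = kernel_comb X K F a"
      and G: "finite G" "G \<subseteq> X" "g = kernel_comb X K G b"
      using fg unfolding kernel_span_def by blast
    have "f = kernel_comb X K (F \<union> G) (\<lambda>y. if y \<in> F then a y else 0)"
      "g = kernel_comb X K (F \<union> G) (\<lambda>y. if y \<in> G then b y else 0)"
      unfolding F G using F G by (auto intro!: kernel_comb_extend)
    then have "(\<lambda>x. f x + g x) = kernel_comb X K (F \<union> G)
        (\<lambda>y. (if y \<in> F then a y else 0) + (if y \<in> G then b y else 0))"
      by (simp add: kernel_comb_def sum.distrib algebra_simps)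
    then show ?thesis using F G unfolding kernel_span_def by blast
  qed
  show scale: "(\<lambda>x. c * f x) \<in> ?H" if f: "f \<in> ?H" for c f
  proof -
    obtain F a where F: "finite F" "F \<subseteq> X" "f = kernel_comb X K F a"
      using f unfolding kernel_span_def by blast
    then have "(\<lambda>x. c * f x) = kernel_comb X K F (\<lambda>y. c * a y)"
      by (simp add: kernel_comb_def sum_distrib_left mult_ac)
    then show ?thesis using F unfolding kernel_span_def by blast
  qed
  show "?ip (\<lambda>x. f x + g x) h = ?ip f h + ?ip g h" if fgh: "f \<in> ?H" "g \<in> ?H" "h \<in> ?H" for f g h
  proof -
    obtain F a where F: "finite F" "F \<subseteq> X" "h = kernel_comb X K F a"
      using fgh(3) unfolding kernel_span_def by blast
    show ?thesis unfolding F(3)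
      unfolding ip[OF add[OF fgh(1,2)] F(1,2)] ip[OF fgh(1) F(1,2)] ip[OF fgh(2) F(1,2)]
      by (simp add: sum.distrib distrib_left)
  qed
  show "?ip (\<lambda>x. c * f x) h = c * ?ip f h" if fh: "f \<in> ?H" "h \<in> ?H" for c f h
  proof -
    obtain F a where F: "finite F" "F \<subseteq> X" "h = kernel_comb X K F a"
      using fh(2) unfolding kernel_span_def by blast
    show ?thesis unfolding F(3)
      unfolding ip[OF scale[OF fh(1)] F(1,2)] ip[OF fh(1) F(1,2)]
      by (simp add: sum_distrib_left mult_ac)
  qed
  show "?ip g f = cnj (?ip f g)" if fg: "f \<in> ?H" "g \<in> ?H" for f g
  proof -
    obtain F a G b where F: "finite F" "F \<subseteq> X" "f = kernel_comb X K F a"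
      and G: "finite G" "G \<subseteq> X" "g = kernel_comb X K G b"
      using fg unfolding kernel_span_def by blast
    have "?ip f g = (\<Sum>y\<in>G. cnj (b y) * f y)" unfolding G(3) by (rule ip[OF fg(1) G(1,2)])
    also have "\<dots> = (\<Sum>x\<in>F. a x * cnj (g x))"
      unfolding F(3) G(3) by (rule kernel_comb_swap[OF K F(2) G(2)])
    also have "\<dots> = cnj (\<Sum>x\<in>F. cnj (a x) * g x)" by (simp add: cnj_sum)
    also have "(\<Sum>x\<in>F. cnj (a x) * g x) = ?ip g f" unfolding F(3) by (rule ip[OF fg(2) F(1,2), symmetric])
    finally show ?thesis by simp
  qed
  show "?ip f f \<in> \<real>\<^sub>\<ge>\<^sub>0" if f: "f \<in> ?H" for f
  proof -
    obtain F a where F: "finite F" "F \<subseteq> X" "f = kernel_comb X K F a"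
      using f unfolding kernel_span_def by blast
    have "?ip f f = (\<Sum>y\<in>F. cnj (a y) * f y)" using ip[OF f F(1,2), of a] F(3) by simp
    also have "\<dots> = (\<Sum>x\<in>F. \<Sum>y\<in>F. cnj (a x) * K x y * a y)"
      unfolding F(3) using F(2)
      by (intro sum.cong refl) (auto simp: kernel_comb_def kernel_section_def sum_distrib_left mult_ac
          intro!: sum.cong)
    finally show ?thesis using K F(1,2) by (auto simp: kernel_on_def pos_semidef_def)
  qed
  show "f x = 0" if f: "f \<in> ?H" "x \<notin> X" for f x
    using that by (auto simp: kernel_span_def kernel_comb_def kernel_section_def)
  have sec: "kernel_section X K y = kernel_comb X K {y} (\<lambda>_. 1)" for y
    by (simp add: kernel_comb_def)
  show "kernel_section X K y \<in> ?H" if "y \<in> X" for y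
    using that unfolding kernel_span_def sec by blast
  show "f y = ?ip f (kernel_section X K y)" if "f \<in> ?H" "y \<in> X" for f y
    unfolding sec using that by (subst ip) auto
qed

section \<open>Completion of the span of the kernel sections as a space of functions\<close>

locale kernel_span_rkhs = pre_rkhs +
  assumes span: "f \<in> H \<Longrightarrow> \<exists>F a. finite F \<and> F \<subseteq> X \<and> f = kernel_comb X K F a"
begin

text \<open>This makes the completion a space of functions: an element is determined by its values.
  The squared norm of \<open>d n\<close> splits into its product with a fixed \<open>d M\<close>,
  which tends to zero because \<open>d M\<close> is a finite combination of evaluations, and its
  product with the small vector \<open>d n - d M\<close>.\<close>

lemma nrm_Cauchy_eval_tendsto_zero:
  assumes d: "nrm_Cauchy d" and lim: "\<And>x. (\<lambda>n. d n x) \<longlonglongrightarrow> 0"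
  shows "(\<lambda>n. nrm (d n)) \<longlonglongrightarrow> 0"
proof -
  note mem = nrm_Cauchy_mem[OF d]
  obtain B where B: "B > 0" "\<And>n. nrm (d n) \<le> B" using nrm_Cauchy_bounded[OF d] by blast
  have "\<exists>N. \<forall>n\<ge>N. nrm (d n) < e" if e: "e > 0" for e :: real
  proof -
    \<comment> \<open>Chosen so that \<open>B * r\<close> is half of the target
      \<open>e\<^sup>2\<close>; the other half is for the product with \<open>d M\<close>.\<close>
    define r where "r = e\<^sup>2 / (2 * B)"
    have r: "r > 0" using e B(1) by (simp add: r_def)
    obtain M where M: "\<And>m n. m \<ge> M \<Longrightarrow> n \<ge> M \<Longrightarrow> nrm (\<lambda>x. d m x - d n x) < r"
      using nrm_CauchyD[OF d r] by blast
    obtain F a where F: "finite F" "F \<subseteq> X" "d M = kernel_comb X K F a"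
      using span[OF mem[of M]] by blast
    have "(\<lambda>n. \<Sum>y\<in>F. cnj (a y) * d n y) \<longlonglongrightarrow> (\<Sum>y\<in>F. cnj (a y) * 0)"
      by (intro tendsto_sum tendsto_mult tendsto_const lim)
    then have "(\<lambda>n. ip (d n) (d M)) \<longlonglongrightarrow> 0"
      unfolding F(3) ip_comb_right[OF F(1,2) mem] by simp
    then obtain N where N: "\<And>n. n \<ge> N \<Longrightarrow> norm (ip (d n) (d M)) < e\<^sup>2 / 2"
      using LIMSEQ_D[of _ 0 "e\<^sup>2 / 2"] e by auto
    have "nrm (d n) < e" if n: "n \<ge> max M N" for n
    proof -
      have "ip (d n) (d n) = ip (d n) (d M) + ip (d n) (\<lambda>x. d n x - d M x)"
        by (simp add: ip_diff_right mem)
      then have "(nrm (d n))\<^sup>2 \<le> norm (ip (d n) (d M)) + norm (ip (d n) (\<lambda>x. d n x - d M x))"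
        unfolding nrm_power2[OF mem] using complex_Re_le_cmod norm_triangle_ineq order_trans by metis
      also have "norm (ip (d n) (\<lambda>x. d n x - d M x)) \<le> B * r"
        using Cauchy_Schwarz[OF mem diff_mem[OF mem mem], of n n M] M[of n M] n B(2)[of n]
          mult_mono[of "nrm (d n)" B "nrm (\<lambda>x. d n x - d M x)" r] B(1)
          nrm_nonneg[OF diff_mem[OF mem mem], of n M] by simp
      also have "B * r = e\<^sup>2 / 2" using B(1) by (simp add: r_def)
      finally have "(nrm (d n))\<^sup>2 < e\<^sup>2" using N[of n] n by simp
      then show ?thesis using e by (simp add: power2_less_imp_less)
    qed
    then show ?thesis by blast
  qed
  then show ?thesis using nrm_nonneg[OF mem] by (simp add: LIMSEQ_iff)
qed

lemma nrm_tendsto_zero_ip: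
  assumes d: "\<And>n. d n \<in> H" "(\<lambda>n. nrm (d n)) \<longlonglongrightarrow> 0" and t: "nrm_Cauchy t"
  shows "(\<lambda>n. ip (d n) (t n)) \<longlonglongrightarrow> 0"
proof -
  obtain B where B: "B > 0" "\<And>n. nrm (t n) \<le> B" using nrm_Cauchy_bounded[OF t] by blast
  have "(\<lambda>n. nrm (d n) * B) \<longlonglongrightarrow> 0" using d(2) by (rule tendsto_mult_left_zero)
  then show ?thesis
  proof (rule Lim_null_comparison[rotated], intro always_eventually allI)
    fix n
    have "norm (ip (d n) (t n)) \<le> nrm (d n) * nrm (t n)"
      by (rule Cauchy_Schwarz[OF d(1) nrm_Cauchy_mem[OF t]])
    also have "\<dots> \<le> nrm (d n) * B" by (rule mult_left_mono[OF B(2) nrm_nonneg[OF d(1)]])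
    finally show "norm (ip (d n) (t n)) \<le> nrm (d n) * B" .
  qed
qed

lemma nrm_Cauchy_ip_convergent:
  assumes s: "nrm_Cauchy s" and t: "nrm_Cauchy t"
  shows "convergent (\<lambda>n. ip (s n) (t n))"
proof -
  note sm = nrm_Cauchy_mem[OF s] and tm = nrm_Cauchy_mem[OF t]
  obtain B where B: "B > 0" "\<And>n. nrm (s n) \<le> B" using nrm_Cauchy_bounded[OF s] by blast
  obtain C where C: "C > 0" "\<And>n. nrm (t n) \<le> C" using nrm_Cauchy_bounded[OF t] by blast
  have "Cauchy (\<lambda>n. ip (s n) (t n))"
  proof (rule metric_CauchyI)
    fix e :: real assume e: "e > 0"
    have pos: "e / (2 * C) > 0" "e / (2 * B) > 0" using e B(1) C(1) by simp_all
    obtain M where M: "\<And>m n. m \<ge> M \<Longrightarrow> n \<ge> M \<Longrightarrow> nrm (\<lambda>x. s m x - s n x) < e / (2 * C)"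
      using nrm_CauchyD[OF s pos(1)] by blast
    obtain N where N: "\<And>m n. m \<ge> N \<Longrightarrow> n \<ge> N \<Longrightarrow> nrm (\<lambda>x. t m x - t n x) < e / (2 * B)"
      using nrm_CauchyD[OF t pos(2)] by blast
    have "dist (ip (s m) (t m)) (ip (s n) (t n)) < e" if mn: "m \<ge> max M N" "n \<ge> max M N" for m n
    proof -
      have "ip (s m) (t m) - ip (s n) (t n)
          = ip (\<lambda>x. s m x - s n x) (t m) + ip (s n) (\<lambda>x. t m x - t n x)"
        by (simp add: ip_diff ip_diff_right sm tm)
      then have "dist (ip (s m) (t m)) (ip (s n) (t n))
          \<le> norm (ip (\<lambda>x. s m x - s n x) (t m)) + norm (ip (s n) (\<lambda>x. t m x - t n x))"
        unfolding dist_norm by (simp add: norm_triangle_ineq)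
      also have "\<dots> \<le> nrm (\<lambda>x. s m x - s n x) * C + B * nrm (\<lambda>x. t m x - t n x)"
      proof (rule add_mono)
        have "norm (ip (\<lambda>x. s m x - s n x) (t m)) \<le> nrm (\<lambda>x. s m x - s n x) * nrm (t m)"
          by (rule Cauchy_Schwarz[OF diff_mem[OF sm sm] tm])
        also have "\<dots> \<le> nrm (\<lambda>x. s m x - s n x) * C"
          by (rule mult_left_mono[OF C(2) nrm_nonneg[OF diff_mem[OF sm sm]]])
        finally show "norm (ip (\<lambda>x. s m x - s n x) (t m)) \<le> nrm (\<lambda>x. s m x - s n x) * C" .
        have "norm (ip (s n) (\<lambda>x. t m x - t n x)) \<le> nrm (s n) * nrm (\<lambda>x. t m x - t n x)"
          by (rule Cauchy_Schwarz[OF sm diff_mem[OF tm tm]])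
        also have "\<dots> \<le> B * nrm (\<lambda>x. t m x - t n x)"
          by (rule mult_right_mono[OF B(2) nrm_nonneg[OF diff_mem[OF tm tm]]])
        finally show "norm (ip (s n) (\<lambda>x. t m x - t n x)) \<le> B * nrm (\<lambda>x. t m x - t n x)" .
      qed
      also have "\<dots> < e"
      proof -
        have "nrm (\<lambda>x. s m x - s n x) * C < e / (2 * C) * C"
          using M[of m n] mn C(1) by (intro mult_strict_right_mono) auto
        moreover have "B * nrm (\<lambda>x. t m x - t n x) < B * (e / (2 * B))"
          using N[of m n] mn B(1) by (intro mult_strict_left_mono) auto
        moreover have "e / (2 * C) * C = e / 2" "B * (e / (2 * B)) = e / 2"
          using B(1) C(1) by simp_all
        ultimately show ?thesis by linarith
      qed
      finally show ?thesis .
    qed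
    then show "\<exists>M. \<forall>m\<ge>M. \<forall>n\<ge>M. dist (ip (s m) (t m)) (ip (s n) (t n)) < e" by blast
  qed
  then show ?thesis by (simp add: Cauchy_convergent_iff)
qed

definition approx :: "(nat \<Rightarrow> 'a \<Rightarrow> complex) \<Rightarrow> ('a \<Rightarrow> complex) \<Rightarrow> bool" where
  "approx s f \<longleftrightarrow> nrm_Cauchy s \<and> (\<forall>x. (\<lambda>n. s n x) \<longlonglongrightarrow> f x)"

definition completion :: "('a \<Rightarrow> complex) set" where
  "completion = {f. \<exists>s. approx s f}"

text \<open>The approximating sequences are picked arbitrarily; \<open>cip_tendsto\<close> shows
  that every other pair gives the same limit.\<close>

definition cip :: "('a \<Rightarrow> complex) \<Rightarrow> ('a \<Rightarrow> complex) \<Rightarrow> complex" where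
  "cip f g = lim (\<lambda>n. ip ((SOME s. approx s f) n) ((SOME s. approx s g) n))"

lemma approx_nrm_diff:
  assumes "approx s f" "approx s' f"
  shows "(\<lambda>n. nrm (\<lambda>x. s n x - s' n x)) \<longlonglongrightarrow> 0"
proof (rule nrm_Cauchy_eval_tendsto_zero)
  show "nrm_Cauchy (\<lambda>n x. s n x - s' n x)"
    using assms by (intro nrm_Cauchy_diff) (auto simp: approx_def)
  show "(\<lambda>n. s n x - s' n x) \<longlonglongrightarrow> 0" for x
    using assms tendsto_diff[of "\<lambda>n. s n x" "f x" sequentially "\<lambda>n. s' n x" "f x"]
    by (simp add: approx_def)
qed

lemma approx_Cauchy: "approx s f \<Longrightarrow> nrm_Cauchy s"
  by (simp add: approx_def)

lemma approx_mem: "approx s f \<Longrightarrow> s n \<in> H"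
  by (simp add: approx_def nrm_Cauchy_mem)

lemma approx_lim: "approx s f \<Longrightarrow> (\<lambda>n. s n x) \<longlonglongrightarrow> f x"
  by (simp add: approx_def)

text \<open>Passing from the given sequences to the chosen ones changes the inner products by two
  terms, each pairing a sequence that is null in norm with a bounded one.\<close>

lemma cip_tendsto:
  assumes s: "approx s f" and t: "approx t g"
  shows "(\<lambda>n. ip (s n) (t n)) \<longlonglongrightarrow> cip f g"
proof -
  define s' t' where "s' = (SOME s. approx s f)" and "t' = (SOME s. approx s g)"
  have s': "approx s' f" unfolding s'_def using s by (rule someI[of "\<lambda>s. approx s f"])
  have t': "approx t' g" unfolding t'_def using t by (rule someI[of "\<lambda>s. approx s g"])
  have 0: "(\<lambda>n. ip (s' n) (t' n)) \<longlonglongrightarrow> cip f g"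
    using nrm_Cauchy_ip_convergent[OF approx_Cauchy[OF s'] approx_Cauchy[OF t']]
    unfolding cip_def s'_def[symmetric] t'_def[symmetric] by (simp add: convergent_LIMSEQ_iff)
  have 1: "(\<lambda>n. ip (\<lambda>x. s n x - s' n x) (t n)) \<longlonglongrightarrow> 0"
    by (rule nrm_tendsto_zero_ip)
      (use approx_nrm_diff[OF s s'] approx_Cauchy[OF t] in
        \<open>auto intro: diff_mem approx_mem[OF s] approx_mem[OF s']\<close>)
  have "(\<lambda>n. ip (\<lambda>x. t n x - t' n x) (s' n)) \<longlonglongrightarrow> 0"
    by (rule nrm_tendsto_zero_ip)
      (use approx_nrm_diff[OF t t'] approx_Cauchy[OF s'] in
        \<open>auto intro: diff_mem approx_mem[OF t] approx_mem[OF t']\<close>)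
  then have "(\<lambda>n. cnj (ip (\<lambda>x. t n x - t' n x) (s' n))) \<longlonglongrightarrow> cnj 0"
    by (rule tendsto_cnj)
  moreover have "cnj (ip (\<lambda>x. t n x - t' n x) (s' n)) = ip (s' n) (\<lambda>x. t n x - t' n x)" for n
    using ip_cnj[OF diff_mem[OF approx_mem[OF t] approx_mem[OF t']] approx_mem[OF s'], of n n n]
    by simp
  ultimately have 2: "(\<lambda>n. ip (s' n) (\<lambda>x. t n x - t' n x)) \<longlonglongrightarrow> 0" by simp
  have "ip (s n) (t n) = ip (s' n) (t' n) + ip (\<lambda>x. s n x - s' n x) (t n)
      + ip (s' n) (\<lambda>x. t n x - t' n x)" for n
    by (simp add: ip_diff ip_diff_right approx_mem[OF s] approx_mem[OF t] approx_mem[OF s'] approx_mem[OF t'])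
  then show ?thesis using tendsto_add[OF tendsto_add[OF 0 1] 2] by simp
qed

lemma approx_add: "\<lbrakk>approx s f; approx t g\<rbrakk> \<Longrightarrow> approx (\<lambda>n x. s n x + t n x) (\<lambda>x. f x + g x)"
  by (auto simp: approx_def intro: nrm_Cauchy_add tendsto_add)

lemma approx_scale: "approx s f \<Longrightarrow> approx (\<lambda>n x. c * s n x) (\<lambda>x. c * f x)"
  by (auto simp: approx_def intro: nrm_Cauchy_scale tendsto_mult_left)

lemma approx_const: "f \<in> H \<Longrightarrow> approx (\<lambda>n. f) f"
  by (simp add: approx_def nrm_Cauchy_const)

lemma completion_mem: "f \<in> H \<Longrightarrow> f \<in> completion"
  unfolding completion_def using approx_const by blast

lemma cip_eq: "\<lbrakk>f \<in> H; g \<in> H\<rbrakk> \<Longrightarrow> cip f g = ip f g"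
  using cip_tendsto[OF approx_const approx_const, of f g] LIMSEQ_unique by (metis tendsto_const)

lemma pre_rkhs_completion: "pre_rkhs completion cip X K"
proof
  show "(\<lambda>x. 0) \<in> completion" using completion_mem[OF zero_mem] .
  show "(\<lambda>x. f x + g x) \<in> completion" if "f \<in> completion" "g \<in> completion" for f g
    using that approx_add unfolding completion_def by blast
  show "(\<lambda>x. c * f x) \<in> completion" if "f \<in> completion" for c f
    using that approx_scale unfolding completion_def by blast
  show "cip (\<lambda>x. f x + g x) h = cip f h + cip g h"
    if fgh: "f \<in> completion" "g \<in> completion" "h \<in> completion" for f g h
  proof -
    obtain s t r where a: "approx s f" "approx t g" "approx r h"
      using fgh unfolding completion_def by blast
    have "(\<lambda>n. ip (s n) (r n) + ip (t n) (r n)) \<longlonglongrightarrow> cip f h + cip g h"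
      by (intro tendsto_add cip_tendsto a)
    moreover have "(\<lambda>n. ip (s n) (r n) + ip (t n) (r n)) = (\<lambda>n. ip (\<lambda>x. s n x + t n x) (r n))"
      using a by (simp add: ip_add approx_mem)
    ultimately show ?thesis using cip_tendsto[OF approx_add[OF a(1,2)] a(3)]
      by (simp add: LIMSEQ_unique)
  qed
  show "cip (\<lambda>x. c * f x) g = c * cip f g" if fg: "f \<in> completion" "g \<in> completion" for c f g
  proof -
    obtain s t where a: "approx s f" "approx t g" using fg unfolding completion_def by blast
    have "(\<lambda>n. c * ip (s n) (t n)) \<longlonglongrightarrow> c * cip f g"
      by (intro tendsto_mult_left cip_tendsto a)
    moreover have "(\<lambda>n. c * ip (s n) (t n)) = (\<lambda>n. ip (\<lambda>x. c * s n x) (t n))"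
      using a by (simp add: ip_scale approx_mem)
    ultimately show ?thesis using cip_tendsto[OF approx_scale[OF a(1), of c] a(2)]
      by (simp add: LIMSEQ_unique)
  qed
  show "cip g f = cnj (cip f g)" if fg: "f \<in> completion" "g \<in> completion" for f g
  proof -
    obtain s t where a: "approx s f" "approx t g" using fg unfolding completion_def by blast
    have "(\<lambda>n. cnj (ip (s n) (t n))) \<longlonglongrightarrow> cnj (cip f g)"
      by (intro tendsto_cnj cip_tendsto a)
    moreover have "(\<lambda>n. cnj (ip (s n) (t n))) = (\<lambda>n. ip (t n) (s n))"
      using ip_cnj[OF approx_mem[OF a(1)] approx_mem[OF a(2)]] by simp
    ultimately show ?thesis using cip_tendsto[OF a(2,1)] by (simp add: LIMSEQ_unique)
  qed
  show "cip f f \<in> \<real>\<^sub>\<ge>\<^sub>0" if f: "f \<in> completion" for f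
  proof -
    obtain s where a: "approx s f" using f unfolding completion_def by blast
    show ?thesis
      by (rule Lim_in_closed_set[OF closed_nonneg_Reals_complex _ _ cip_tendsto[OF a a]])
        (auto intro!: always_eventually ip_nonneg approx_mem[OF a])
  qed
  show "f x = 0" if f: "f \<in> completion" "x \<notin> X" for f x
  proof -
    obtain s where a: "approx s f" using f unfolding completion_def by blast
    have "(\<lambda>n. s n x) = (\<lambda>n. 0)" using vanish[OF approx_mem[OF a] f(2)] by simp
    then show ?thesis using approx_lim[OF a, of x] by (simp add: LIMSEQ_const_iff)
  qed
  show "kernel_section X K y \<in> completion" if "y \<in> X" for y
    by (rule completion_mem[OF section_mem[OF that]])
  show "f y = cip f (kernel_section X K y)" if f: "f \<in> completion" "y \<in> X" for f y
  proof -
    obtain s where a: "approx s f" using f unfolding completion_def by blast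
    have "(\<lambda>n. s n y) = (\<lambda>n. ip (s n) (kernel_section X K y))"
      using reproducing[OF approx_mem[OF a] f(2)] by simp
    then show ?thesis
      using approx_lim[OF a, of y] cip_tendsto[OF a approx_const[OF section_mem[OF f(2)]]]
      by (simp add: LIMSEQ_unique)
  qed
qed

lemma completion_dense:
  assumes f: "f \<in> completion" and e: "e > 0"
  shows "\<exists>g\<in>H. ip_norm cip (\<lambda>x. f x - g x) < e"
proof -
  interpret C: pre_rkhs completion cip X K by (rule pre_rkhs_completion)
  obtain s where a: "approx s f" using f unfolding completion_def by blast
  obtain N where N: "\<And>m n. m \<ge> N \<Longrightarrow> n \<ge> N \<Longrightarrow> nrm (\<lambda>x. s m x - s n x) < e / 2"
    using nrm_CauchyD[OF approx_Cauchy[OF a], of "e / 2"] e by auto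
  have d: "approx (\<lambda>n x. s n x - s N x) (\<lambda>x. f x - s N x)"
    using approx_add[OF a approx_scale[OF approx_const[OF approx_mem[OF a, of N]], of "-1"]] by simp
  have "(\<lambda>n. Re (ip (\<lambda>x. s n x - s N x) (\<lambda>x. s n x - s N x)))
      \<longlonglongrightarrow> Re (cip (\<lambda>x. f x - s N x) (\<lambda>x. f x - s N x))"
    by (intro tendsto_Re cip_tendsto d)
  then have "(\<lambda>n. nrm (\<lambda>x. s n x - s N x)) \<longlonglongrightarrow> ip_norm cip (\<lambda>x. f x - s N x)"
    unfolding ip_norm_def by (rule tendsto_real_sqrt)
  then have "ip_norm cip (\<lambda>x. f x - s N x) \<le> e / 2"
    by (rule LIMSEQ_le_const2) (use N less_imp_le in blast)
  then show ?thesis using e approx_mem[OF a, of N] by force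
qed

lemma rkhs_completion: "reproducing_kernel_space X completion cip K"
proof -
  interpret C: pre_rkhs completion cip X K by (rule pre_rkhs_completion)
  have eqnrm: "C.nrm f = nrm f" if "f \<in> H" for f
    using that by (simp add: ip_norm_def cip_eq)
  show ?thesis
  proof
    \<comment> \<open>Definiteness comes from the evaluation bound: norm zero forces the value zero
      at each point of \<open>X\<close>.\<close>
    show "f = (\<lambda>x. 0)" if f: "f \<in> completion" "cip f f = 0" for f
    proof
      fix x
      show "f x = 0"
      proof (cases "x \<in> X")
        case True
        then show ?thesis using C.norm_eval_le[OF f(1) True] f(2) by (simp add: ip_norm_def)
      qed (use C.vanish f in blast)
    qed
  next
    fix s :: "nat \<Rightarrow> 'a \<Rightarrow> complex"
    assume s: "\<And>n. s n \<in> completion"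
      and cau: "\<And>e. e > 0 \<Longrightarrow> \<exists>N. \<forall>m\<ge>N. \<forall>n\<ge>N.
          sqrt (Re (cip (\<lambda>x. s m x - s n x) (\<lambda>x. s m x - s n x))) < e"
    have cauchy: "\<exists>N. \<forall>m\<ge>N. \<forall>n\<ge>N. C.nrm (\<lambda>x. s m x - s n x) < e" if "e > 0" for e
      using cau[OF that] by (simp add: ip_norm_def)
    \<comment> \<open>Each \<open>s n\<close> is replaced by a span element within 1/(n+1). The new
      sequence is Cauchy in the span, so its pointwise limit lies in the completion and is the limit
      of \<open>s\<close> too.\<close>
    have "\<forall>n. \<exists>g\<in>H. C.nrm (\<lambda>x. s n x - g x) < inverse (real (Suc n))"
      using completion_dense[OF s] by simp
    then obtain g where g: "\<And>n. g n \<in> H" "\<And>n. C.nrm (\<lambda>x. s n x - g n x) < inverse (real (Suc n))"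
      by metis
    have gc: "g n \<in> completion" for n by (rule completion_mem[OF g(1)])
    have small: "\<exists>N. \<forall>n\<ge>N. C.nrm (\<lambda>x. s n x - g n x) < e" if e: "e > 0" for e
    proof -
      obtain N where N: "inverse (real (Suc N)) < e" using reals_Archimedean[OF e] by blast
      have "C.nrm (\<lambda>x. s n x - g n x) < e" if "n \<ge> N" for n
      proof -
        have "inverse (real (Suc n)) \<le> inverse (real (Suc N))"
          using that by (intro le_imp_inverse_le) auto
        then show ?thesis using g(2)[of n] N by linarith
      qed
      then show ?thesis by blast
    qed
    have G: "nrm_Cauchy g"
      unfolding nrm_Cauchy_def
    proof (intro conjI allI impI)
      fix e :: real assume e: "e > 0"
      obtain M where M: "\<And>m n. m \<ge> M \<Longrightarrow> n \<ge> M \<Longrightarrow> C.nrm (\<lambda>x. s m x - s n x) < e / 3"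
        using cauchy[of "e / 3"] e by auto
      obtain N where N: "\<And>n. n \<ge> N \<Longrightarrow> C.nrm (\<lambda>x. s n x - g n x) < e / 3"
        using small[of "e / 3"] e by auto
      have "nrm (\<lambda>x. g m x - g n x) < e" if "m \<ge> max M N" "n \<ge> max M N" for m n
      proof -
        have "C.nrm (\<lambda>x. g m x - g n x) \<le> C.nrm (\<lambda>x. g m x - s m x) + C.nrm (\<lambda>x. s m x - g n x)"
          by (rule C.nrm_triangle_diff[OF gc s gc])
        moreover have "C.nrm (\<lambda>x. s m x - g n x) \<le> C.nrm (\<lambda>x. s m x - s n x) + C.nrm (\<lambda>x. s n x - g n x)"
          by (rule C.nrm_triangle_diff[OF s s gc])
        moreover have "C.nrm (\<lambda>x. g m x - s m x) = C.nrm (\<lambda>x. s m x - g m x)"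
          by (rule C.nrm_minus[OF gc s])
        ultimately have "C.nrm (\<lambda>x. g m x - g n x) < e"
          using M[of m n] N[of m] N[of n] that by simp
        then show ?thesis using eqnrm[OF diff_mem[OF g(1) g(1)]] by simp
      qed
      then show "\<exists>N. \<forall>m\<ge>N. \<forall>n\<ge>N. nrm (\<lambda>x. g m x - g n x) < e" by blast
    qed (rule g(1))
    define f where "f = (\<lambda>x. lim (\<lambda>n. g n x))"
    have "(\<lambda>n. g n x) \<longlonglongrightarrow> f x" for x
    proof (cases "x \<in> X")
      case False
      then have "(\<lambda>n. g n x) = (\<lambda>n. 0)" using vanish[OF g(1)] by simp
      then show ?thesis by (simp add: f_def)
    next
      case True
      have "convergent (\<lambda>n. ip (g n) (kernel_section X K x))"
        by (rule nrm_Cauchy_ip_convergent[OF G nrm_Cauchy_const[OF section_mem[OF True]]])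
      then show ?thesis
        unfolding f_def using reproducing[OF g(1) True] by (simp add: convergent_LIMSEQ_iff)
    qed
    then have a: "approx g f" using G by (simp add: approx_def)
    then have f: "f \<in> completion" unfolding completion_def by blast
    have "\<exists>N. \<forall>n\<ge>N. C.nrm (\<lambda>x. s n x - f x) < e" if e: "e > 0" for e
    proof -
      obtain M where M: "\<And>m n. m \<ge> M \<Longrightarrow> n \<ge> M \<Longrightarrow> nrm (\<lambda>x. g m x - g n x) < e / 3"
        using nrm_CauchyD[OF G, of "e / 3"] e by auto
      obtain N where N: "\<And>n. n \<ge> N \<Longrightarrow> C.nrm (\<lambda>x. s n x - g n x) < e / 3"
        using small[of "e / 3"] e by auto
      have "C.nrm (\<lambda>x. s n x - f x) < e" if n: "n \<ge> max M N" for n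
      proof -
        have "approx (\<lambda>k x. g n x - g k x) (\<lambda>x. g n x - f x)"
          using approx_add[OF approx_const[OF g(1)[of n]] approx_scale[OF a, of "-1"]] by simp
        then have "(\<lambda>k. Re (ip (\<lambda>x. g n x - g k x) (\<lambda>x. g n x - g k x)))
            \<longlonglongrightarrow> Re (cip (\<lambda>x. g n x - f x) (\<lambda>x. g n x - f x))"
          by (intro tendsto_Re cip_tendsto)
        then have "(\<lambda>k. nrm (\<lambda>x. g n x - g k x)) \<longlonglongrightarrow> C.nrm (\<lambda>x. g n x - f x)"
          unfolding ip_norm_def by (rule tendsto_real_sqrt)
        then have "C.nrm (\<lambda>x. g n x - f x) \<le> e / 3"
          by (rule LIMSEQ_le_const2) (use M n less_imp_le in \<open>meson max.boundedE\<close>)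
        moreover have "C.nrm (\<lambda>x. s n x - f x) \<le> C.nrm (\<lambda>x. s n x - g n x) + C.nrm (\<lambda>x. g n x - f x)"
          by (rule C.nrm_triangle_diff[OF s gc f])
        ultimately show ?thesis using N[of n] n e by simp
      qed
      then show ?thesis by blast
    qed
    then have "(\<lambda>n. C.nrm (\<lambda>x. s n x - f x)) \<longlonglongrightarrow> 0"
      using C.nrm_nonneg[OF C.diff_mem[OF s f]] by (simp add: LIMSEQ_iff)
    then show "\<exists>f\<in>completion. (\<lambda>n. sqrt (Re (cip (\<lambda>x. s n x - f x) (\<lambda>x. s n x - f x)))) \<longlonglongrightarrow> 0"
      using f unfolding ip_norm_def by blast
  qed (fact C.vanish C.zero_mem C.add_mem C.scale_mem C.ip_add C.ip_scale C.ip_cnj C.ip_nonneg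
      C.section_mem C.reproducing)+
qed

end

text \<open>It turns the choice in \<open>rkhs\<close> into a usable fact: from here on the chosen
  space is handled through the locale only.\<close>

theorem Moore_Aronszajn:
  assumes "kernel_on X K"
  shows "reproducing_kernel_space X (rkhs_space X K) (snd (rkhs X K)) K"
proof -
  interpret pre_rkhs "kernel_span X K" "kernel_span_ip X K" X K
    by (rule pre_rkhs_kernel_span[OF assms])
  interpret kernel_span_rkhs "kernel_span X K" "kernel_span_ip X K" X K
    by unfold_locales (auto simp: kernel_span_def)
  have "reproducing_kernel_space X (fst (completion, cip)) (snd (completion, cip)) K"
    using rkhs_completion by simp
  then show ?thesis unfolding rkhs_space_def rkhs_def
    by (rule someI[of "\<lambda>S. reproducing_kernel_space X (fst S) (snd S) K"])
qed

section \<open>Membership in the space and multipliers\<close>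

sublocale reproducing_kernel_space \<subseteq> pre: pre_rkhs H ip X K
proof
  show "f x = 0" if "f \<in> H" "x \<notin> X" for f x using that by (rule vanish)
qed (fact section_mem reproducing)+

context reproducing_kernel_space
begin

text \<open>Riesz representation for the functional that sends a combination with coefficients a to
  the sum of \<open>cnj (a y) * f y\<close>. The representative is the limit of a minimising
  sequence of combinations, which is why density of the span comes out as a second
  conclusion.\<close>

lemma bounded_antilinear_imp_mem:
  assumes f0: "\<And>x. x \<notin> X \<Longrightarrow> f x = 0"
    and bnd: "\<And>F a. finite F \<Longrightarrow> F \<subseteq> X \<Longrightarrow>
      norm (\<Sum>y\<in>F. cnj (a y) * f y) \<le> C * pre.nrm (kernel_comb X K F a)"
  shows "f \<in> H \<and> (\<exists>s. (\<forall>n. s n \<in> kernel_span X K) \<and> (\<lambda>n. pre.nrm (\<lambda>x. s n x - f x)) \<longlonglongrightarrow> 0)"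
proof -
  \<comment> \<open>A relation instead of a function of \<open>h\<close>: each representation of
    \<open>h\<close> brings its own value \<open>l\<close> of the functional.\<close>
  define P where "P h l \<longleftrightarrow> (\<exists>F a. finite F \<and> F \<subseteq> X \<and> h = kernel_comb X K F a \<and>
      l = (\<Sum>y\<in>F. cnj (a y) * f y))" for h l
  \<comment> \<open>The energy whose minimiser represents the functional. By \<open>P_bound\<close>
    it is at least |h|^2 - 2 C |h|, hence at least -C^2.\<close>
  define J where "J h l = (pre.nrm h)\<^sup>2 - 2 * Re l" for h l
  have P_mem: "h \<in> H" if "P h l" for h l
    using that pre.comb_mem unfolding P_def by blast
  have P_zero: "P (\<lambda>x. 0) 0"
    unfolding P_def by (rule exI[of _ "{}"]) (simp add: kernel_comb_def)
  have P_section: "P (kernel_section X K y) (f y)" if "y \<in> X" for y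
    unfolding P_def using that by (intro exI[of _ "{y}"] exI[of _ "\<lambda>_. 1"]) (simp add: kernel_comb_def)
  have P_scale: "P (\<lambda>x. c * h x) (cnj c * l)" if hl: "P h l" for c h l
  proof -
    obtain F a where F: "finite F" "F \<subseteq> X" "h = kernel_comb X K F a" "l = (\<Sum>y\<in>F. cnj (a y) * f y)"
      using hl unfolding P_def by blast
    show ?thesis unfolding P_def using F
      by (intro exI[of _ F] exI[of _ "\<lambda>y. c * a y"])
        (simp add: kernel_comb_def sum_distrib_left mult_ac)
  qed
  have P_add: "P (\<lambda>x. h x + g x) (l + k)" if hg: "P h l" "P g k" for h l g k
  proof -
    obtain F a where F: "finite F" "F \<subseteq> X" "h = kernel_comb X K F a" "l = (\<Sum>y\<in>F. cnj (a y) * f y)"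
      using hg(1) unfolding P_def by blast
    obtain G b where G: "finite G" "G \<subseteq> X" "g = kernel_comb X K G b" "k = (\<Sum>y\<in>G. cnj (b y) * f y)"
      using hg(2) unfolding P_def by blast
    let ?a = "\<lambda>y. if y \<in> F then a y else 0" and ?b = "\<lambda>y. if y \<in> G then b y else 0"
    have "h = kernel_comb X K (F \<union> G) ?a" "g = kernel_comb X K (F \<union> G) ?b"
      unfolding F(3) G(3) using F(1) G(1) by (auto intro!: kernel_comb_extend)
    moreover have "l = (\<Sum>y\<in>F \<union> G. cnj (?a y) * f y)" "k = (\<Sum>y\<in>F \<union> G. cnj (?b y) * f y)"
      unfolding F(4) G(4) using F(1) G(1) by (auto intro!: sum.mono_neutral_cong_left)
    ultimately show ?thesis unfolding P_def using F(1,2) G(1,2)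
      by (intro exI[of _ "F \<union> G"] exI[of _ "\<lambda>y. ?a y + ?b y"])
        (simp add: kernel_comb_def sum.distrib distrib_right)
  qed
  have P_bound: "norm l \<le> C * pre.nrm h" if hl: "P h l" for h l
    using hl bnd unfolding P_def by blast
  have J_bound: "- C\<^sup>2 \<le> J h l" if hl: "P h l" for h l
  proof -
    have "Re l \<le> C * pre.nrm h" using P_bound[OF hl] complex_Re_le_cmod order_trans by blast
    moreover have "0 \<le> (pre.nrm h - C)\<^sup>2" by simp
    ultimately show ?thesis unfolding J_def by (simp add: power2_diff mult_ac)
  qed
  define j where "j = Inf {J h l |h l. P h l}"
  have ne: "{J h l |h l. P h l} \<noteq> {}" using P_zero by blast
  have bdd: "bdd_below {J h l |h l. P h l}" using J_bound by (intro bdd_belowI[of _ "- C\<^sup>2"]) blast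
  have j_le: "j \<le> J h l" if "P h l" for h l
    unfolding j_def using that bdd by (intro cInf_lower) blast+
  have "\<exists>h l. P h l \<and> J h l < j + inverse (real (Suc n))" for n
  proof -
    have "Inf {J h l |h l. P h l} < j + inverse (real (Suc n))" unfolding j_def by simp
    then show ?thesis using cInf_lessD[OF ne] by blast
  qed
  then obtain h l where h: "\<And>n. P (h n) (l n)" "\<And>n. J (h n) (l n) < j + inverse (real (Suc n))"
    by metis
  note hm = P_mem[OF h(1)]
  have par: "(pre.nrm (\<lambda>x. h m x - h n x))\<^sup>2 < 2 * inverse (real (Suc m)) + 2 * inverse (real (Suc n))"
    for m n
  proof -
    let ?s = "\<lambda>x. h m x + h n x"
    \<comment> \<open>The midpoint of two almost minimal elements competes for the infimum; with the
      parallelogram law this makes the minimising sequence Cauchy.\<close>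
    have "j \<le> J (\<lambda>x. (1/2) * ?s x) (cnj (1/2) * (l m + l n))"
      by (intro j_le P_scale P_add h)
    also have "\<dots> = (1/4) * (pre.nrm ?s)\<^sup>2 - (Re (l m) + Re (l n))"
      unfolding J_def pre.nrm_scale[OF pre.add_mem[OF hm hm]]
      by (simp add: power_mult_distrib power2_eq_square field_simps)
    finally have "4 * j \<le> (pre.nrm ?s)\<^sup>2 - 4 * (Re (l m) + Re (l n))" by simp
    moreover have "(pre.nrm (\<lambda>x. h m x - h n x))\<^sup>2 + (pre.nrm ?s)\<^sup>2
        = 2 * (pre.nrm (h m))\<^sup>2 + 2 * (pre.nrm (h n))\<^sup>2"
      using pre.nrm_add_power2[OF hm hm, of m n] pre.nrm_diff_power2[OF hm hm, of m n] by simp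
    moreover have "(pre.nrm (h m))\<^sup>2 - 2 * Re (l m) < j + inverse (real (Suc m))"
      "(pre.nrm (h n))\<^sup>2 - 2 * Re (l n) < j + inverse (real (Suc n))"
      using h(2) unfolding J_def by blast+
    moreover have "d < 2 * x + 2 * y"
      if "4 * j \<le> s - 4 * (p + q)" "d + s = 2 * a + 2 * b" "a - 2 * p < j + x" "b - 2 * q < j + y"
      for a b d s p q x y :: real using that by (simp add: algebra_simps)
    ultimately show ?thesis by blast
  qed
  have "\<exists>N. \<forall>m\<ge>N. \<forall>n\<ge>N. pre.nrm (\<lambda>x. h m x - h n x) < e" if e: "e > 0" for e
  proof -
    obtain N where N: "inverse (real (Suc N)) < e\<^sup>2 / 4"
      using reals_Archimedean[of "e\<^sup>2 / 4"] e by auto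
    have "pre.nrm (\<lambda>x. h m x - h n x) < e" if mn: "m \<ge> N" "n \<ge> N" for m n
    proof -
      have "inverse (real (Suc m)) \<le> inverse (real (Suc N))" "inverse (real (Suc n)) \<le> inverse (real (Suc N))"
        using mn by (auto intro: le_imp_inverse_le)
      then have "(pre.nrm (\<lambda>x. h m x - h n x))\<^sup>2 < e\<^sup>2" using par[of m n] N by linarith
      then show ?thesis using e by (simp add: power2_less_imp_less)
    qed
    then show ?thesis by blast
  qed
  then obtain g where g: "g \<in> H" "(\<lambda>n. pre.nrm (\<lambda>x. h n x - g x)) \<longlonglongrightarrow> 0"
    using complete[of h] hm unfolding ip_norm_def by blast
  have lim: "(\<lambda>n. h n x) \<longlonglongrightarrow> g x" if x: "x \<in> X" for x
  proof -
    have "(\<lambda>n. pre.nrm (\<lambda>x. h n x - g x) * sqrt (Re (K x x))) \<longlonglongrightarrow> 0"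
      using g(2) by (rule tendsto_mult_left_zero)
    then have "(\<lambda>n. h n x - g x) \<longlonglongrightarrow> 0"
      by (rule Lim_null_comparison[rotated])
        (use pre.norm_eval_le[OF pre.diff_mem[OF hm g(1)] x] in simp)
    then show ?thesis by (rule LIM_zero_cancel)
  qed
  \<comment> \<open>First variation in the direction of the kernel section at x. Adding
    \<open>t * ?k\<close> to \<open>h n\<close> lowers \<open>J\<close> by less than 1/(n+1), so in
    the limit a nonnegative quadratic in t remains, whose linear part is the difference of the two
    values.\<close>
  have fg: "f x = g x" if x: "x \<in> X" for x
  proof -
    let ?k = "kernel_section X K x"
    define \<kappa> where "\<kappa> = (pre.nrm ?k)\<^sup>2"
    define d where "d = g x - f x"
    have "0 \<le> 2 * Re (cnj t * d) + (norm t)\<^sup>2 * \<kappa>" for t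
    proof -
      have "- inverse (real (Suc n)) \<le> 2 * Re (cnj t * (h n x - f x)) + (norm t)\<^sup>2 * \<kappa>" for n
      proof -
        note km = section_mem[OF x]
        have "j \<le> J (\<lambda>y. h n y + t * ?k y) (l n + cnj t * f x)"
          by (intro j_le P_scale P_add h P_section x)
        also have "\<dots> = J (h n) (l n) + 2 * Re (cnj t * (h n x - f x)) + (norm t)\<^sup>2 * \<kappa>"
          unfolding J_def pre.nrm_add_power2[OF hm pre.scale_mem[OF km]]
            pre.ip_scale_right[OF km hm] reproducing[OF hm x, symmetric] pre.nrm_scale[OF km] \<kappa>_def
          by (simp add: algebra_simps power_mult_distrib)
        finally show ?thesis using h(2)[of n] by linarith
      qed
      moreover have "(\<lambda>n. 2 * Re (cnj t * (h n x - f x)) + (norm t)\<^sup>2 * \<kappa>)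
          \<longlonglongrightarrow> 2 * Re (cnj t * d) + (norm t)\<^sup>2 * \<kappa>"
        unfolding d_def by (intro tendsto_intros lim x)
      moreover have "(\<lambda>n. - inverse (real (Suc n))) \<longlonglongrightarrow> - 0"
        by (intro tendsto_minus LIMSEQ_inverse_real_of_nat)
      ultimately have "- 0 \<le> 2 * Re (cnj t * d) + (norm t)\<^sup>2 * \<kappa>"
        by (intro LIMSEQ_le[rotated 2]) auto
      then show ?thesis by simp
    qed
    note pos = this
    have "d = 0" by (rule linear_form_eq_zero[of d \<kappa>]) (use pos[of "cnj _"] in \<open>simp_all add: \<kappa>_def\<close>)
    then show ?thesis by (simp add: d_def)
  qed
  have "f = g" using fg f0 vanish[OF g(1)] by (intro ext) metis
  moreover have "h n \<in> kernel_span X K" for n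
    using h(1)[of n] unfolding P_def kernel_span_def by blast
  ultimately show ?thesis using g by blast
qed

text \<open>By Cauchy-Schwarz a member f satisfies the boundedness condition of
  \<open>bounded_antilinear_imp_mem\<close> with its own norm as constant, and that lemma supplies
  the approximating sequence.\<close>

lemma kernel_span_dense:
  assumes f: "f \<in> H"
  shows "\<exists>s. (\<forall>n. s n \<in> kernel_span X K) \<and> (\<lambda>n. pre.nrm (\<lambda>x. s n x - f x)) \<longlonglongrightarrow> 0"
proof -
  have "norm (\<Sum>y\<in>F. cnj (a y) * f y) \<le> pre.nrm f * pre.nrm (kernel_comb X K F a)"
    if F: "finite F" "F \<subseteq> X" for F a
    using pre.Cauchy_Schwarz[OF f pre.comb_mem[OF F, of a]] pre.ip_comb_right[OF F f, of a] by simp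
  then show ?thesis using bounded_antilinear_imp_mem[of f "pre.nrm f"] vanish[OF f] by blast
qed

lemma kernel_span_mem: "h \<in> kernel_span X K \<Longrightarrow> h \<in> H"
  using pre.comb_mem unfolding kernel_span_def by blast

text \<open>Duality for tuples. Letting the test tuple tend to g itself turns the hypothesis into
  \<open>R\<^sup>2 \<le> C * R\<close>, where R is the norm of the tuple g.\<close>

lemma nrm_tuple_le:
  assumes I: "finite I" and g: "\<And>i. i \<in> I \<Longrightarrow> g i \<in> H" and C: "C \<ge> 0"
    and bnd: "\<And>h. (\<And>i. i \<in> I \<Longrightarrow> h i \<in> kernel_span X K) \<Longrightarrow>
      norm (\<Sum>i\<in>I. ip (g i) (h i)) \<le> C * sqrt (\<Sum>i\<in>I. (pre.nrm (h i))\<^sup>2)"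
  shows "sqrt (\<Sum>i\<in>I. (pre.nrm (g i))\<^sup>2) \<le> C"
proof -
  define R where "R = sqrt (\<Sum>i\<in>I. (pre.nrm (g i))\<^sup>2)"
  have "\<forall>i\<in>I. \<exists>s. (\<forall>n. s n \<in> kernel_span X K) \<and> (\<lambda>n. pre.nrm (\<lambda>x. s n x - g i x)) \<longlonglongrightarrow> 0"
    using kernel_span_dense g by blast
  then obtain s where s: "\<And>i n. i \<in> I \<Longrightarrow> s i n \<in> kernel_span X K"
    "\<And>i. i \<in> I \<Longrightarrow> (\<lambda>n. pre.nrm (\<lambda>x. s i n x - g i x)) \<longlonglongrightarrow> 0"
    by metis
  have sm: "s i n \<in> H" if "i \<in> I" for i n using s(1)[OF that] by (rule kernel_span_mem)
  have 1: "(\<lambda>n. ip (g i) (s i n)) \<longlonglongrightarrow> ip (g i) (g i)" if i: "i \<in> I" for i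
  proof -
    have "(\<lambda>n. pre.nrm (g i) * pre.nrm (\<lambda>x. s i n x - g i x)) \<longlonglongrightarrow> 0"
      using s(2)[OF i] by (rule tendsto_mult_right_zero)
    then have "(\<lambda>n. ip (g i) (\<lambda>x. s i n x - g i x)) \<longlonglongrightarrow> 0"
      by (rule Lim_null_comparison[rotated])
        (use pre.Cauchy_Schwarz[OF g[OF i] pre.diff_mem[OF sm[OF i] g[OF i]]] in simp)
    then show ?thesis
      unfolding pre.ip_diff_right[OF sm[OF i] g[OF i] g[OF i]] by (rule LIM_zero_cancel)
  qed
  have 2: "(\<lambda>n. pre.nrm (s i n)) \<longlonglongrightarrow> pre.nrm (g i)" if i: "i \<in> I" for i
  proof -
    have "norm (pre.nrm (s i n) - pre.nrm (g i)) \<le> pre.nrm (\<lambda>x. s i n x - g i x)" for n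
      using pre.nrm_le_diff[OF sm[OF i] g[OF i], of n] pre.nrm_le_diff[OF g[OF i] sm[OF i], of n]
        pre.nrm_minus[OF g[OF i] sm[OF i], of n] by simp
    then have "(\<lambda>n. pre.nrm (s i n) - pre.nrm (g i)) \<longlonglongrightarrow> 0"
      by (intro Lim_null_comparison[OF _ s(2)[OF i]]) simp
    then show ?thesis by (rule LIM_zero_cancel)
  qed
  have "norm (\<Sum>i\<in>I. ip (g i) (g i)) \<le> C * R"
  proof (rule LIMSEQ_le)
    show "(\<lambda>n. norm (\<Sum>i\<in>I. ip (g i) (s i n))) \<longlonglongrightarrow> norm (\<Sum>i\<in>I. ip (g i) (g i))"
      by (intro tendsto_norm tendsto_sum 1)
    show "(\<lambda>n. C * sqrt (\<Sum>i\<in>I. (pre.nrm (s i n))\<^sup>2)) \<longlonglongrightarrow> C * R"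
      unfolding R_def by (intro tendsto_mult_left tendsto_real_sqrt tendsto_sum tendsto_power 2)
    show "\<exists>N. \<forall>n\<ge>N. norm (\<Sum>i\<in>I. ip (g i) (s i n)) \<le> C * sqrt (\<Sum>i\<in>I. (pre.nrm (s i n))\<^sup>2)"
      using bnd[of "\<lambda>i. s i _"] s(1) by blast
  qed
  moreover have "(\<Sum>i\<in>I. ip (g i) (g i)) = of_real (\<Sum>i\<in>I. (pre.nrm (g i))\<^sup>2)"
    unfolding of_real_sum by (rule sum.cong[OF refl]) (rule pre.ip_self[OF g])
  moreover have nn: "(\<Sum>i\<in>I. (pre.nrm (g i))\<^sup>2) \<ge> 0" by (simp add: sum_nonneg)
  ultimately have "R\<^sup>2 \<le> C * R" unfolding R_def by (simp only: norm_of_real abs_of_nonneg real_sqrt_pow2)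
  moreover have "R \<ge> 0" using nn by (simp add: R_def)
  ultimately have "R \<le> C" using C by (cases "R = 0") (auto simp: power2_eq_square)
  then show ?thesis by (simp add: R_def)
qed

text \<open>On the kernel section at y the adjoint of the row operator multiplies by
  \<open>cnj (\<Phi> y r)\<close>. The quadratic form in question is therefore the squared norm of a
  combination g minus that of its image under the adjoint.\<close>

lemma multiplier_row_kernel:
  assumes mult: "\<And>h. (\<And>r. r < n \<Longrightarrow> h r \<in> H) \<Longrightarrow> (\<lambda>x. \<Sum>r<n. \<Phi> x r * h r x) \<in> H \<and>
      pre.nrm (\<lambda>x. \<Sum>r<n. \<Phi> x r * h r x) \<le> sqrt (\<Sum>r<n. (pre.nrm (h r))\<^sup>2)"
  shows "kernel_on X (\<lambda>x y. (1 - (\<Sum>r<n. \<Phi> x r * cnj (\<Phi> y r))) * K x y)"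
  unfolding kernel_on_def pos_semidef_def
proof (intro allI impI)
  fix F a assume "finite F \<and> F \<subseteq> X"
  then have F: "finite F" "F \<subseteq> X" by auto
  define g where "g = kernel_comb X K F a"
  \<comment> \<open>The components of the adjoint applied to \<open>g\<close>. Contractivity is used
    on this very tuple: pairing its image with \<open>g\<close> returns S, so S \<le> sqrt S
    |g|.\<close>
  define h where "h r = kernel_comb X K F (\<lambda>y. a y * cnj (\<Phi> y r))" for r
  define S where "S = (\<Sum>r<n. (pre.nrm (h r))\<^sup>2)"
  have S: "S \<ge> 0" by (simp add: S_def sum_nonneg)
  have gm: "g \<in> H" and hm: "h r \<in> H" for r
    using pre.comb_mem[OF F] by (simp_all add: g_def h_def)
  let ?Mh = "\<lambda>x. \<Sum>r<n. \<Phi> x r * h r x"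
  have M: "?Mh \<in> H" "pre.nrm ?Mh \<le> sqrt S"
    using mult[of h] hm by (simp_all add: S_def)
  have "ip ?Mh g = (\<Sum>y\<in>F. \<Sum>r<n. cnj (a y) * (\<Phi> y r * h r y))"
    unfolding g_def pre.ip_comb_right[OF F M(1)] by (simp add: sum_distrib_left)
  also have "\<dots> = (\<Sum>r<n. \<Sum>y\<in>F. cnj (a y * cnj (\<Phi> y r)) * h r y)"
    by (subst sum.swap) (simp add: mult_ac)
  also have "\<dots> = (\<Sum>r<n. ip (h r) (h r))"
  proof (rule sum.cong[OF refl])
    fix r
    show "(\<Sum>y\<in>F. cnj (a y * cnj (\<Phi> y r)) * h r y) = ip (h r) (h r)"
      using pre.ip_comb_right[OF F hm[of r], of "\<lambda>y. a y * cnj (\<Phi> y r)"] by (simp add: h_def)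
  qed
  also have "\<dots> = of_real S"
    unfolding S_def of_real_sum by (rule sum.cong[OF refl]) (rule pre.ip_self[OF hm])
  finally have "S \<le> pre.nrm ?Mh * pre.nrm g"
    using pre.Cauchy_Schwarz[OF M(1) gm] S by simp
  also have "\<dots> \<le> sqrt S * pre.nrm g"
    by (rule mult_right_mono[OF M(2) pre.nrm_nonneg[OF gm]])
  finally have 1: "sqrt S * sqrt S \<le> sqrt S * pre.nrm g" using S by simp
  have "sqrt S \<le> pre.nrm g"
  proof (cases "S = 0")
    case False
    then have "sqrt S > 0" using S by simp
    with 1 show ?thesis by (simp only: mult_le_cancel_left_pos)
  qed (use pre.nrm_nonneg[OF gm] in simp)
  then have le: "S \<le> (pre.nrm g)\<^sup>2"
    using S by (simp add: real_le_rsqrt sqrt_le_D)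
  have "(\<Sum>x\<in>F. \<Sum>y\<in>F. cnj (a x) * ((1 - (\<Sum>r<n. \<Phi> x r * cnj (\<Phi> y r))) * K x y) * a y)
      = ip g g - (\<Sum>r<n. ip (h r) (h r))"
  proof -
    have "(\<Sum>r<n. ip (h r) (h r))
        = (\<Sum>r<n. \<Sum>x\<in>F. \<Sum>y\<in>F. cnj (a x) * (\<Phi> x r * cnj (\<Phi> y r) * K x y) * a y)"
      unfolding h_def pre.ip_comb_comb[OF F] by (simp add: mult_ac)
    also have "\<dots> = (\<Sum>x\<in>F. \<Sum>r<n. \<Sum>y\<in>F. cnj (a x) * (\<Phi> x r * cnj (\<Phi> y r) * K x y) * a y)"
      by (rule sum.swap)
    also have "\<dots> = (\<Sum>x\<in>F. \<Sum>y\<in>F. \<Sum>r<n. cnj (a x) * (\<Phi> x r * cnj (\<Phi> y r) * K x y) * a y)"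
      by (rule sum.cong[OF refl]) (rule sum.swap)
    also have "\<dots> = (\<Sum>x\<in>F. \<Sum>y\<in>F. cnj (a x) * ((\<Sum>r<n. \<Phi> x r * cnj (\<Phi> y r)) * K x y) * a y)"
      by (simp add: sum_distrib_left sum_distrib_right)
    finally show ?thesis
      unfolding g_def pre.ip_comb_comb[OF F]
      by (simp add: left_diff_distrib right_diff_distrib sum_subtractf)
  qed
  also have "\<dots> = of_real ((pre.nrm g)\<^sup>2 - S)"
    unfolding S_def of_real_diff of_real_sum pre.ip_self[OF gm] using pre.ip_self[OF hm] by simp
  finally show "(\<Sum>x\<in>F. \<Sum>y\<in>F. cnj (a x) * ((1 - (\<Sum>r<n. \<Phi> x r * cnj (\<Phi> y r))) * K x y) * a y) \<in> \<real>\<^sub>\<ge>\<^sub>0"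
    using le by (simp only: nonneg_Reals_of_real_iff)
qed

end

section \<open>Kernels with the complete Nevanlinna-Pick property\<close>

text \<open>The interpolation property for matrices with one row, with the contractive extension
  restated as positivity of a kernel on all of \<open>X\<close>. In this form a single new node can
  be examined.\<close>

lemma cnp_kernel_extend_row:
  fixes n :: nat
  assumes cnp: "cnp_kernel X K" and F: "finite F" "F \<subseteq> X"
    and psd: "pos_semidef F (\<lambda>x y. (1 - (\<Sum>r<n. W x r * cnj (W y r))) * K x y)"
  obtains \<Phi> where "\<And>x r. x \<in> F \<Longrightarrow> r < n \<Longrightarrow> \<Phi> x r = W x r"
    and "kernel_on X (\<lambda>x y. (1 - (\<Sum>r<n. \<Phi> x r * cnj (\<Phi> y r))) * K x y)"
proof -
  have K: "kernel_on X K" using cnp by (simp add: cnp_kernel_def)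
  interpret reproducing_kernel_space X "rkhs_space X K" "snd (rkhs X K)" K
    by (rule Moore_Aronszajn[OF K])
  define A :: "'a \<times> nat \<Rightarrow> 'a \<times> nat \<Rightarrow> complex" where
    "A = (\<lambda>(x, p) (y, q). ((if p = q then 1 else 0) - (\<Sum>r<n. W x r * cnj (W y r))) * K x y)"
  have "pos_semidef (F \<times> {..<1}) A"
    unfolding pos_semidef_def
  proof
    fix a :: "'a \<times> nat \<Rightarrow> complex"
    have "(\<Sum>i\<in>F \<times> {..<1}. \<Sum>j\<in>F \<times> {..<1}. cnj (a i) * A i j * a j)
      = (\<Sum>x\<in>F. \<Sum>y\<in>F. cnj (a (x, 0)) * ((1 - (\<Sum>r<n. W x r * cnj (W y r))) * K x y) * a (y, 0))"
      by (simp add: A_def sum.cartesian_product' lessThan_Suc)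
    also have "\<dots> \<in> \<real>\<^sub>\<ge>\<^sub>0" using spec[OF psd[unfolded pos_semidef_def], of "\<lambda>x. a (x, 0)"] .
    finally show "(\<Sum>i\<in>F \<times> {..<1}. \<Sum>j\<in>F \<times> {..<1}. cnj (a i) * A i j * a j) \<in> \<real>\<^sub>\<ge>\<^sub>0" .
  qed
  then have "\<exists>\<Psi>\<in>contractive_matrix_multipliers 1 n X K. \<forall>x\<in>F. \<forall>p<1. \<forall>q<n. \<Psi> x p q = W x q"
    using cnp F unfolding cnp_kernel_def A_def
    by (elim conjE allE[of _ "1::nat"] allE[of _ n] allE[of _ F] allE[of _ "\<lambda>x p. W x"]) auto
  then obtain \<Psi> where \<Psi>: "\<Psi> \<in> contractive_matrix_multipliers 1 n X K"
    "\<And>x q. x \<in> F \<Longrightarrow> q < n \<Longrightarrow> \<Psi> x 0 q = W x q"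
    by auto
  have "kernel_on X (\<lambda>x y. (1 - (\<Sum>r<n. \<Psi> x 0 r * cnj (\<Psi> y 0 r))) * K x y)"
  proof (rule multiplier_row_kernel)
    fix h assume h: "\<And>r. r < n \<Longrightarrow> h r \<in> rkhs_space X K"
    let ?g = "\<lambda>x. \<Sum>r<n. \<Psi> x 0 r * h r x"
    have g: "?g \<in> rkhs_space X K"
      "sqrt ((rkhs_norm X K ?g)\<^sup>2) \<le> sqrt (\<Sum>j<n. (rkhs_norm X K (h j))\<^sup>2)"
      using \<Psi>(1) h unfolding contractive_matrix_multipliers_def
      by (auto dest!: spec[of _ h])
    then show "?g \<in> rkhs_space X K \<and> pre.nrm ?g \<le> sqrt (\<Sum>r<n. (pre.nrm (h r))\<^sup>2)"
      using pre.nrm_nonneg[OF g(1)] by (simp add: rkhs_norm_def ip_norm_def)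
  qed
  then show ?thesis using that[of "\<lambda>x r. \<Psi> x 0 r"] \<Psi>(2) by simp
qed

text \<open>The necessity half of the McCullough-Quiggin theorem. On the nodes treated so far
  \<open>(1 - \<langle>W x, W y\<rangle>) * K x y = 1\<close>, and a positive semidefinite extension of the all-one
  matrix by one point has to be constantly one off the new diagonal entry.\<close>

lemma cnp_kernel_gram:
  assumes cnp: "cnp_kernel X K" and w: "w \<in> X" and norm1: "\<And>x. x \<in> X \<Longrightarrow> K x w = 1"
    and nz: "\<And>x y. x \<in> X \<Longrightarrow> y \<in> X \<Longrightarrow> K x y \<noteq> 0"
    and F: "finite F" "F \<subseteq> X"
  shows "\<exists>(n::nat) W. \<forall>x\<in>F. \<forall>y\<in>F. (\<Sum>r<n. W x r * cnj (W y r)) = 1 - 1 / K x y"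
proof -
  have K: "kernel_on X K" using cnp by (simp add: cnp_kernel_def)
  have herm: "K y x = cnj (K x y)" if "x \<in> X" "y \<in> X" for x y
    by (rule kernel_on_hermitian[OF K that])
  \<comment> \<open>The base point is kept among the nodes: its Gram vector is zero at every stage,
    which fixes \<open>L w z = 1\<close> for each new point z.\<close>
  have "\<exists>(n::nat) W. \<forall>x\<in>insert w F. \<forall>y\<in>insert w F. (\<Sum>r<n. W x r * cnj (W y r)) = 1 - 1 / K x y"
    using F
  proof (induction F rule: finite_induct)
    case empty
    then show ?case using norm1[OF w] by (intro exI[of _ 0]) simp
  next
    case (insert z G)
    show ?case
    proof (cases "z = w")
      case True
      then show ?thesis using insert by simp
    next
      case False
      let ?F = "insert w G"
      have F: "finite ?F" "?F \<subseteq> X" "z \<notin> ?F" "z \<in> X" "w \<in> ?F"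
        using insert False w by auto
      have "\<exists>(n::nat) W. \<forall>x\<in>?F. \<forall>y\<in>?F. (\<Sum>r<n. W x r * cnj (W y r)) = 1 - 1 / K x y"
        using insert.IH insert.prems by simp
      then obtain n :: nat and W
        where W: "\<And>x y. x \<in> ?F \<Longrightarrow> y \<in> ?F \<Longrightarrow> (\<Sum>r<n. W x r * cnj (W y r)) = 1 - 1 / K x y"
        by blast
      have one: "(1 - (\<Sum>r<n. W x r * cnj (W y r))) * K x y = 1" if "x \<in> ?F" "y \<in> ?F" for x y
        using W[OF that] nz[of x y] F(2) that by auto
      have "pos_semidef ?F (\<lambda>x y. (1 - (\<Sum>r<n. W x r * cnj (W y r))) * K x y)"
        using pos_semidef_one[of ?F] by (subst pos_semidef_cong[OF one])
      then obtain \<Phi> where \<Phi>: "\<And>x r. x \<in> ?F \<Longrightarrow> r < n \<Longrightarrow> \<Phi> x r = W x r"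
        and L: "kernel_on X (\<lambda>x y. (1 - (\<Sum>r<n. \<Phi> x r * cnj (\<Phi> y r))) * K x y)"
      proof (rule cnp_kernel_extend_row[OF cnp F(1,2)], goal_cases)
        case prems: (1 \<Phi>)
        show ?case by (rule prems(1)[of \<Phi>]) (fact prems(2) prems(3))+
      qed
      define L where "L x y = (1 - (\<Sum>r<n. \<Phi> x r * cnj (\<Phi> y r))) * K x y" for x y
      have L: "kernel_on X L" using L unfolding L_def .
      have L1: "L x y = 1" if "x \<in> ?F" "y \<in> ?F" for x y
        using one[OF that] \<Phi> that by (simp add: L_def)
      have "(\<Sum>r<n. W w r * cnj (W w r)) = 0" using W[OF F(5) F(5)] norm1[OF w] by simp
      then have "complex_of_real (\<Sum>r<n. (norm (W w r))\<^sup>2) = 0"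
        unfolding of_real_sum complex_norm_square .
      then have Ww: "W w r = 0" if "r < n" for r
        using that by (simp only: of_real_eq_0_iff) (simp add: sum_nonneg_eq_0_iff)
      have Lwz: "L w z = 1"
        using herm[OF F(4) w] norm1[OF F(4)] by (simp add: L_def \<Phi>[OF F(5)] Ww)
      have Lz: "L z z \<in> \<real>\<^sub>\<ge>\<^sub>0" using kernel_on_diag[OF L F(4)] .
      have hermL: "L y x = cnj (L x y)" if "x \<in> X" "y \<in> X" for x y
        by (rule kernel_on_hermitian[OF L that])
      have Lxz: "L x z = 1" if x: "x \<in> ?F" for x
      proof (cases "x = w")
        case False
        have xX: "x \<in> X" and xz: "x \<noteq> z" and wz: "w \<noteq> z" using x F by auto
        have psd: "pos_semidef {x, w, z} L" using L xX w F(4) by (simp add: kernel_on_def)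
        \<comment> \<open>Test vector 1 at x, -1 at w and t at z. On x and w the matrix is
          constantly one, so their block contributes zero and no constant term is left.\<close>
        have "0 \<le> 2 * Re (t * (L x z - 1)) + (norm t)\<^sup>2 * Re (L z z)" for t
        proof -
          let ?a = "(\<lambda>_. t)(x := 1, w := -1)"
          have "(\<Sum>i\<in>{x, w, z}. \<Sum>j\<in>{x, w, z}. cnj (?a i) * L i j * ?a j)
              = t * (L x z - 1) + cnj (t * (L x z - 1)) + cnj t * t * L z z"
            using False xz wz x F(5) hermL[OF xX F(4)] hermL[OF w F(4)]
            by (simp add: L1 Lwz algebra_simps)
          then have "0 \<le> Re (t * (L x z - 1) + cnj (t * (L x z - 1)) + cnj t * t * L z z)"
            using spec[OF psd[unfolded pos_semidef_def], of ?a] by (simp add: complex_nonneg_Reals_iff)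
          then show ?thesis using Lz unfolding cmod_power2 complex_nonneg_Reals_iff
            by (simp add: algebra_simps power2_eq_square)
        qed
        then have "L x z - 1 = 0"
          by (rule linear_form_eq_zero) (use Lz in \<open>simp add: complex_nonneg_Reals_iff\<close>)
        then show ?thesis by simp
      qed (use Lwz in simp)
      \<comment> \<open>Test vector -1 at w and 1 at z. The bound makes the square root defining
        \<open>c\<close> below meaningful.\<close>
      have "Re (L z z) \<ge> 1"
      proof -
        have wz: "w \<noteq> z" using F by auto
        have "pos_semidef {w, z} L" using L w F(4) by (simp add: kernel_on_def)
        from spec[OF this[unfolded pos_semidef_def], of "(\<lambda>_. 1)(w := -1)"] show ?thesis
          using wz hermL[OF w F(4)] by (simp add: L1 Lwz complex_nonneg_Reals_iff)
      qed
      moreover have "Re (K z z) > 0" "Im (K z z) = 0"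
        using kernel_on_diag[OF K F(4)] nz[OF F(4,4)]
        by (auto simp: complex_nonneg_Reals_iff complex_eq_iff order.order_iff_strict)
      ultimately obtain k l where kl: "K z z = of_real k" "L z z = of_real l" "k > 0" "l \<ge> 1"
        using Lz by (metis complex_is_Real_iff complex_nonneg_Reals_iff of_real_Re)
      \<comment> \<open>The vectors \<open>\<Phi>\<close> have the right products except at (z, z),
        where they give 1 - l/k instead of 1 - 1/k. One additional coordinate, nonzero at z only,
        supplies the difference (l - 1)/k.\<close>
      define c where "c = sqrt ((l - 1) / k)"
      have c: "c * c = (l - 1) / k" using kl by (simp add: c_def)
      define V where "V x r = (if r < n then \<Phi> x r else if x = z then of_real c else 0)" for x r
      have V: "(\<Sum>r<Suc n. V x r * cnj (V y r))
          = (\<Sum>r<n. \<Phi> x r * cnj (\<Phi> y r)) + (if x = z \<and> y = z then of_real (c * c) else 0)" for x y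
        by (simp add: V_def)
      have gram: "(\<Sum>r<n. \<Phi> x r * cnj (\<Phi> y r)) = 1 - L x y / K x y" if "x \<in> X" "y \<in> X" for x y
        using nz[OF that] by (simp add: L_def)
      have "(\<Sum>r<Suc n. V x r * cnj (V y r)) = 1 - 1 / K x y"
        if xy: "x \<in> insert z ?F" "y \<in> insert z ?F" for x y
      proof -
        have xyX: "x \<in> X" "y \<in> X" using xy F by auto
        consider "x = z" "y = z" | "x = z" "y \<in> ?F" "y \<noteq> z" | "x \<in> ?F" "x \<noteq> z" "y = z"
          | "x \<in> ?F" "y \<in> ?F" "x \<noteq> z"
          using xy by blast
        then show ?thesis
        proof cases
          case 1
          show ?thesis unfolding V gram[OF xyX] using 1 kl
            by (simp add: c diff_divide_distrib del: of_real_mult)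
        next
          case 2
          then have "L x y = 1" using Lxz[of y] hermL[of y x] xyX by simp
          then show ?thesis unfolding V gram[OF xyX] using 2 by simp
        next
          case 3
          then show ?thesis unfolding V gram[OF xyX] using Lxz by simp
        next
          case 4
          then show ?thesis unfolding V gram[OF xyX] using L1 by simp
        qed
      qed
      then show ?thesis by (auto simp: insert_commute intro!: exI[of _ "Suc n"] exI[of _ V])
    qed
  qed
  then show ?thesis by blast
qed

section \<open>Products with Szego kernels\<close>

lemma norm_mult_cnj_less_one:
  fixes x y :: complex
  assumes "norm x < 1" "norm y < 1"
  shows "norm (x * cnj y) < 1"
  using mult_strict_mono'[of "norm x" 1 "norm y" 1] assms by (simp add: norm_mult)

lemma one_minus_mult_cnj_nonzero:
  fixes x y :: complex
  assumes "norm x < 1" "norm y < 1"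
  shows "1 - x * cnj y \<noteq> 0"
  using norm_mult_cnj_less_one[OF assms] by auto

text \<open>Partial sums of the geometric series are sums of rank-one Schur multiples of A, and the
  nonnegative reals are closed.\<close>

lemma pos_semidef_mult_szego:
  assumes psd: "pos_semidef I A" and g: "\<And>i. i \<in> I \<Longrightarrow> norm (g i) < 1"
  shows "pos_semidef I (\<lambda>i j. A i j / (1 - g i * cnj (g j)))"
  unfolding pos_semidef_def
proof
  fix a
  define S where "S N = (\<Sum>i\<in>I. \<Sum>j\<in>I. cnj (a i) * (\<Sum>n<N. g i ^ n * cnj (g j ^ n) * A i j) * a j)" for N
  have "S N \<in> \<real>\<^sub>\<ge>\<^sub>0" for N
  proof -
    have "pos_semidef I (\<lambda>i j. \<Sum>n<N. g i ^ n * cnj (g j ^ n) * A i j)"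
      by (intro pos_semidef_sum pos_semidef_mult_rank_one psd)
    then show ?thesis unfolding S_def pos_semidef_def by blast
  qed
  moreover have "S \<longlonglongrightarrow> (\<Sum>i\<in>I. \<Sum>j\<in>I. cnj (a i) * (A i j / (1 - g i * cnj (g j))) * a j)"
    unfolding S_def
  proof (intro tendsto_sum tendsto_mult tendsto_const)
    fix i j assume "i \<in> I" "j \<in> I"
    then have "(\<lambda>n. (g i * cnj (g j)) ^ n) sums (1 / (1 - g i * cnj (g j)))"
      by (intro geometric_sums norm_mult_cnj_less_one g)
    from sums_mult2[OF this, of "A i j"]
    show "(\<lambda>N. \<Sum>n<N. g i ^ n * cnj (g j ^ n) * A i j) \<longlonglongrightarrow> A i j / (1 - g i * cnj (g j))"
      by (simp add: sums_def power_mult_distrib)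
  qed
  ultimately show "(\<Sum>i\<in>I. \<Sum>j\<in>I. cnj (a i) * (A i j / (1 - g i * cnj (g j))) * a j) \<in> \<real>\<^sub>\<ge>\<^sub>0"
    by (intro Lim_in_closed_set[OF closed_nonneg_Reals_complex always_eventually trivial_limit_sequentially]) auto
qed

text \<open>The product kernel is the sum of the rank-one kernels of all monomials in u and v.
  Without the two of degree one there remain the constant, the higher powers of u, those of v, and
  the multiples of u v, each group again a Szego-type kernel.\<close>

lemma pos_semidef_bidisc_minus_linear:
  assumes u: "\<And>i. i \<in> I \<Longrightarrow> norm (u i) < 1" and v: "\<And>i. i \<in> I \<Longrightarrow> norm (v i) < 1"
  shows "pos_semidef I (\<lambda>i j. 1 / ((1 - u i * cnj (u j)) * (1 - v i * cnj (v j)))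
    - u i * cnj (u j) - v i * cnj (v j))"
proof -
  let ?A = "\<lambda>i j. 1 + u i ^ 2 * cnj (u j ^ 2) * (1 / (1 - u i * cnj (u j)))
      + v i ^ 2 * cnj (v j ^ 2) * (1 / (1 - v i * cnj (v j)))
      + (u i * v i) * cnj (u j * v j) * (1 / (1 - u i * cnj (u j)) / (1 - v i * cnj (v j)))"
  have "pos_semidef I ?A"
    by (intro pos_semidef_add pos_semidef_mult_rank_one pos_semidef_mult_szego pos_semidef_one u v)
  moreover have "?A i j = 1 / ((1 - u i * cnj (u j)) * (1 - v i * cnj (v j)))
      - u i * cnj (u j) - v i * cnj (v j)" if "i \<in> I" "j \<in> I" for i j
  proof -
    define \<alpha> \<beta> where "\<alpha> = u i * cnj (u j)" and "\<beta> = v i * cnj (v j)"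
    have nz: "1 - \<alpha> \<noteq> 0" "1 - \<beta> \<noteq> 0"
      unfolding \<alpha>_def \<beta>_def
      by (rule one_minus_mult_cnj_nonzero[OF u[OF that(1)] u[OF that(2)]],
          rule one_minus_mult_cnj_nonzero[OF v[OF that(1)] v[OF that(2)]])
    have "?A i j = 1 + \<alpha>\<^sup>2 * (1 / (1 - \<alpha>)) + \<beta>\<^sup>2 * (1 / (1 - \<beta>)) + \<alpha> * \<beta> * (1 / (1 - \<alpha>) / (1 - \<beta>))"
      unfolding \<alpha>_def \<beta>_def by (simp add: power_mult_distrib mult_ac)
    also have "\<dots> = 1 / ((1 - \<alpha>) * (1 - \<beta>)) - \<alpha> - \<beta>"
      using nz by (simp add: divide_simps) (simp add: algebra_simps power2_eq_square)
    finally show ?thesis unfolding \<alpha>_def \<beta>_def by simp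
  qed
  ultimately show ?thesis using pos_semidef_cong[of I ?A] by simp
qed

context reproducing_kernel_space
begin

lemma bounded_antilinear_nrm_le:
  assumes f: "f \<in> H" and C: "C \<ge> 0"
    and bnd: "\<And>F a. finite F \<Longrightarrow> F \<subseteq> X \<Longrightarrow>
      norm (\<Sum>y\<in>F. cnj (a y) * f y) \<le> C * pre.nrm (kernel_comb X K F a)"
  shows "pre.nrm f \<le> C"
proof -
  have "norm (ip f h) \<le> C * pre.nrm h" if h: "h \<in> kernel_span X K" for h
  proof -
    obtain F a where F: "finite F" "F \<subseteq> X" "h = kernel_comb X K F a"
      using h unfolding kernel_span_def by blast
    show ?thesis unfolding F(3) pre.ip_comb_right[OF F(1,2) f] by (rule bnd[OF F(1,2)])
  qed
  then have "sqrt (\<Sum>i\<in>{()}. (pre.nrm f)\<^sup>2) \<le> C"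
    using pre.nrm_nonneg[OF kernel_span_mem] by (intro nrm_tuple_le f C) auto
  then show ?thesis using pre.nrm_nonneg[OF f] by simp
qed

end

section \<open>First-order expansion in the space of the bidisc kernel\<close>

locale bidisc_kernel_space = reproducing_kernel_space +
  fixes u v :: "'a \<Rightarrow> complex" and w :: 'a
  assumes u: "p \<in> X \<Longrightarrow> norm (u p) < 1" and v: "p \<in> X \<Longrightarrow> norm (v p) < 1"
    and kernel: "\<lbrakk>p \<in> X; q \<in> X\<rbrakk> \<Longrightarrow> K p q = 1 / ((1 - u p * cnj (u q)) * (1 - v p * cnj (v q)))"
    and w: "w \<in> X" "u w = 0" "v w = 0"
begin

definition lin :: "complex \<Rightarrow> complex \<Rightarrow> 'a \<Rightarrow> complex" where
  "lin \<alpha> \<beta> p = (if p \<in> X then \<alpha> * u p + \<beta> * v p else 0)"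

text \<open>Domination of the rank-one kernels of u and v by K bounds |U|^2 + |V|^2 by the squared
  norm of the combination; the rest is Cauchy-Schwarz in dimension two.\<close>

lemma lin_bound:
  assumes F: "finite F" "F \<subseteq> X"
  shows "norm (\<Sum>p\<in>F. cnj (a p) * lin \<alpha> \<beta> p)
    \<le> sqrt ((norm \<alpha>)\<^sup>2 + (norm \<beta>)\<^sup>2) * pre.nrm (kernel_comb X K F a)"
proof -
  define U V where "U = (\<Sum>p\<in>F. cnj (a p) * u p)" and "V = (\<Sum>p\<in>F. cnj (a p) * v p)"
  note cm = pre.comb_mem[OF F, of a]
  have "pos_semidef F (\<lambda>i j. 1 / ((1 - u i * cnj (u j)) * (1 - v i * cnj (v j)))
    - u i * cnj (u j) - v i * cnj (v j))"
    using F u v by (intro pos_semidef_bidisc_minus_linear) auto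
  then have "pos_semidef F (\<lambda>i j. K i j - u i * cnj (u j) - v i * cnj (v j))"
    using F(2) kernel by (subst pos_semidef_cong) (auto simp: subset_iff)
  from spec[OF this[unfolded pos_semidef_def], of a]
  have "ip (kernel_comb X K F a) (kernel_comb X K F a) - of_real ((norm U)\<^sup>2) - of_real ((norm V)\<^sup>2) \<in> \<real>\<^sub>\<ge>\<^sub>0"
    unfolding pre.ip_comb_comb[OF F] U_def V_def sum_rank_one[symmetric]
    by (simp add: right_diff_distrib left_diff_distrib sum_subtractf)
  then have le: "(norm U)\<^sup>2 + (norm V)\<^sup>2 \<le> (pre.nrm (kernel_comb X K F a))\<^sup>2"
    unfolding pre.ip_self[OF cm] by (simp add: complex_nonneg_Reals_iff)
  have "(\<Sum>p\<in>F. cnj (a p) * lin \<alpha> \<beta> p) = (\<Sum>p\<in>F. \<alpha> * (cnj (a p) * u p) + \<beta> * (cnj (a p) * v p))"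
    using F(2) by (intro sum.cong refl) (auto simp: lin_def algebra_simps)
  also have "\<dots> = \<alpha> * U + \<beta> * V"
    unfolding U_def V_def by (simp add: sum.distrib sum_distrib_left)
  finally have "norm (\<Sum>p\<in>F. cnj (a p) * lin \<alpha> \<beta> p) \<le> norm \<alpha> * norm U + norm \<beta> * norm V"
    using norm_triangle_ineq[of "\<alpha> * U" "\<beta> * V"] by (simp add: norm_mult)
  also have "\<dots> \<le> sqrt ((norm \<alpha>)\<^sup>2 + (norm \<beta>)\<^sup>2) * sqrt ((norm U)\<^sup>2 + (norm V)\<^sup>2)"
  proof -
    have "0 \<le> (norm \<alpha> * norm V - norm \<beta> * norm U)\<^sup>2" by simp
    then have "(norm \<alpha> * norm U + norm \<beta> * norm V)\<^sup>2
        \<le> ((norm \<alpha>)\<^sup>2 + (norm \<beta>)\<^sup>2) * ((norm U)\<^sup>2 + (norm V)\<^sup>2)"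
      by (simp add: power2_sum power2_diff algebra_simps power_mult_distrib)
    then show ?thesis by (simp add: real_le_rsqrt flip: real_sqrt_mult)
  qed
  also have "\<dots> \<le> sqrt ((norm \<alpha>)\<^sup>2 + (norm \<beta>)\<^sup>2) * pre.nrm (kernel_comb X K F a)"
    using le pre.nrm_nonneg[OF cm] by (intro mult_left_mono real_le_lsqrt) auto
  finally show ?thesis .
qed

lemma lin_mem: "lin \<alpha> \<beta> \<in> H"
  using bounded_antilinear_imp_mem[of "lin \<alpha> \<beta>", OF _ lin_bound] by (simp add: lin_def)

text \<open>Equality can fail when u and v are dependent: for u = v the kernel contains 2 u cnj u,
  so \<open>lin 1 0\<close> has squared norm at most 1/2. Later arguments are arranged to use this
  direction only.\<close>

lemma nrm_lin_le: "(pre.nrm (lin \<alpha> \<beta>))\<^sup>2 \<le> (norm \<alpha>)\<^sup>2 + (norm \<beta>)\<^sup>2"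
proof -
  have "pre.nrm (lin \<alpha> \<beta>) \<le> sqrt ((norm \<alpha>)\<^sup>2 + (norm \<beta>)\<^sup>2)"
    by (rule bounded_antilinear_nrm_le[OF lin_mem _ lin_bound]) simp_all
  then show ?thesis using pre.nrm_nonneg[OF lin_mem] by (simp add: sqrt_ge_absD)
qed

lemma lin_eq: "lin \<alpha> \<beta> = (\<lambda>p. \<alpha> * lin 1 0 p + \<beta> * lin 0 1 p)"
  by (auto simp: lin_def)

lemma ip_lin_right:
  assumes "f \<in> H"
  shows "ip f (lin \<alpha> \<beta>) = cnj \<alpha> * ip f (lin 1 0) + cnj \<beta> * ip f (lin 0 1)"
  unfolding lin_eq[of \<alpha> \<beta>]
  by (simp only: pre.ip_add_right pre.ip_scale_right pre.scale_mem lin_mem assms)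

lemma kernel_w: "p \<in> X \<Longrightarrow> K p w = 1"
  using kernel[OF _ w(1)] by (simp add: w)

text \<open>The coefficients are the inner products of f with u and v. As f vanishes at w, the error
  at p is the inner product of f with the second-order part of the kernel section at p, so the
  kernel alone controls it. A Bessel inequality gives the bound on the coefficients, and its
  equality case forces f to be linear in u and v.\<close>

lemma unit_ball_expansion:
  assumes f: "f \<in> H" "pre.nrm f \<le> 1" "f w = 0"
  obtains a b where "(norm a)\<^sup>2 + (norm b)\<^sup>2 \<le> 1"
    and "\<And>p. p \<in> X \<Longrightarrow> (norm (u p))\<^sup>2 + (norm (v p))\<^sup>2 \<le> 1 / 2 \<Longrightarrow>
      norm (f p - (a * u p + b * v p)) \<le> 2 * ((norm (u p))\<^sup>2 + (norm (v p))\<^sup>2)"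
    and "\<And>p. (norm a)\<^sup>2 + (norm b)\<^sup>2 = 1 \<Longrightarrow> p \<in> X \<Longrightarrow> f p = a * u p + b * v p"
proof -
  define a b where "a = ip f (lin 1 0)" and "b = ip f (lin 0 1)"
  \<comment> \<open>Bessel without orthonormality: the product of f with \<open>lin a b\<close> is
    exactly |a|^2 + |b|^2, and the squared norm of \<open>lin a b\<close> is at most that.\<close>
  have "(pre.nrm (\<lambda>p. f p - lin a b p))\<^sup>2 \<le> (pre.nrm f)\<^sup>2 - ((norm a)\<^sup>2 + (norm b)\<^sup>2)"
  proof -
    have "Re (ip f (lin a b)) = (norm a)\<^sup>2 + (norm b)\<^sup>2"
      unfolding ip_lin_right[OF f(1), of a b, folded a_def b_def] cmod_power2
      by (simp add: power2_eq_square)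
    then show ?thesis
      using nrm_lin_le[of a b] pre.nrm_diff_power2[OF f(1) lin_mem, of a b] by simp
  qed
  moreover have "(pre.nrm f)\<^sup>2 \<le> 1" using f(2) pre.nrm_nonneg[OF f(1)] by (simp add: power_le_one)
  ultimately have le: "(pre.nrm (\<lambda>p. f p - lin a b p))\<^sup>2 \<le> 1 - ((norm a)\<^sup>2 + (norm b)\<^sup>2)" by simp
  show ?thesis
  proof (rule that)
    show "(norm a)\<^sup>2 + (norm b)\<^sup>2 \<le> 1"
      using le zero_le_power2[of "pre.nrm (\<lambda>p. f p - lin a b p)"] by linarith
    show "f p = a * u p + b * v p" if "(norm a)\<^sup>2 + (norm b)\<^sup>2 = 1" "p \<in> X" for p
    proof -
      have m: "(\<lambda>p. f p - lin a b p) \<in> H" by (rule pre.diff_mem[OF f(1) lin_mem])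
      have "ip (\<lambda>p. f p - lin a b p) (\<lambda>p. f p - lin a b p) = 0"
        unfolding pre.ip_self[OF m] using le that by simp
      then have "(\<lambda>p. f p - lin a b p) = (\<lambda>p. 0)" by (rule ip_definite[OF m])
      from fun_cong[OF this, of p] show ?thesis using that(2) by (simp add: lin_def)
    qed
    show "norm (f p - (a * u p + b * v p)) \<le> 2 * ((norm (u p))\<^sup>2 + (norm (v p))\<^sup>2)"
      if p: "p \<in> X" and small: "(norm (u p))\<^sup>2 + (norm (v p))\<^sup>2 \<le> 1 / 2" for p
    proof -
      define \<sigma> where "\<sigma> = (norm (u p))\<^sup>2 + (norm (v p))\<^sup>2"
      let ?k = "kernel_section X K p" and ?kw = "kernel_section X K w"
      let ?g = "lin (cnj (u p)) (cnj (v p))"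
      \<comment> \<open>The section at p without its constant part, which is the section at w, and
        without its linear part. The conjugates in \<open>?g\<close> offset the antilinearity of
        \<open>ip\<close> in the second argument.\<close>
      let ?e = "\<lambda>x. (?k x - ?kw x) - ?g x"
      note km = section_mem[OF p] and k0m = section_mem[OF w(1)]
      note dm = pre.diff_mem[OF km k0m]
      have em: "?e \<in> H" by (rule pre.diff_mem[OF dm lin_mem])
      have "ip f ?e = f p - f w - ip f ?g"
        unfolding pre.ip_diff_right[OF dm lin_mem f(1)] pre.ip_diff_right[OF km k0m f(1)]
          reproducing[OF f(1) p] reproducing[OF f(1) w(1)] ..
      also have "\<dots> = f p - (a * u p + b * v p)"
        unfolding ip_lin_right[OF f(1), of "cnj (u p)", folded a_def b_def] f(3) by simp
      finally have fe: "f p - (a * u p + b * v p) = ip f ?e" by simp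
      have "ip ?g (\<lambda>x. ?k x - ?kw x) = ?g p - ?g w"
        unfolding pre.ip_diff_right[OF km k0m lin_mem] reproducing[OF lin_mem p]
          reproducing[OF lin_mem w(1)] ..
      also have "\<dots> = of_real \<sigma>"
        using p w unfolding \<sigma>_def of_real_add complex_norm_square by (simp add: lin_def mult_ac)
      finally have "ip (\<lambda>x. ?k x - ?kw x) ?g = of_real \<sigma>"
        using pre.ip_cnj[OF lin_mem dm] by simp
      moreover have "(pre.nrm (\<lambda>x. ?k x - ?kw x))\<^sup>2 = Re (K p p) - 1"
        unfolding pre.nrm_diff_power2[OF km k0m] pre.nrm_power2[OF km] pre.nrm_power2[OF k0m]
          pre.ip_section_section[OF p p] pre.ip_section_section[OF w(1) w(1)]
          pre.ip_section_section[OF w(1) p]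
        using kernel[OF w(1) p] w kernel_w by simp
      ultimately have "(pre.nrm ?e)\<^sup>2 \<le> Re (K p p) - 1 - \<sigma>"
        using pre.nrm_diff_power2[OF dm lin_mem, of "cnj (u p)" "cnj (v p)"]
          nrm_lin_le[of "cnj (u p)" "cnj (v p)"] by (simp add: \<sigma>_def)
      also have "\<dots> \<le> 4 * \<sigma>\<^sup>2"
      proof -
        define s t where "s = (norm (u p))\<^sup>2" and "t = (norm (v p))\<^sup>2"
        have st: "s \<ge> 0" "t \<ge> 0" "s + t \<le> 1 / 2" using small by (simp_all add: s_def t_def)
        have "K p p = of_real (1 / ((1 - s) * (1 - t)))"
          unfolding kernel[OF p p] s_def t_def complex_norm_square[symmetric] by simp
        then have Kpp: "Re (K p p) = 1 / ((1 - s) * (1 - t))" by simp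
        have "(1 - s) * (1 - t) \<ge> 1 - \<sigma>" using st by (simp add: \<sigma>_def s_def t_def algebra_simps)
        moreover have \<sigma>: "0 \<le> \<sigma>" "\<sigma> \<le> 1 / 2" using small by (simp_all add: \<sigma>_def)
        ultimately have "1 / ((1 - s) * (1 - t)) \<le> 1 / (1 - \<sigma>)" by (intro divide_left_mono) auto
        also have "\<dots> = 1 + \<sigma> + \<sigma>\<^sup>2 / (1 - \<sigma>)"
          using \<sigma> by (simp add: field_simps power2_eq_square)
        \<comment> \<open>Since \<sigma> \<le> 1/2, the factor 1/(1 - \<sigma>) is at most 2. The
          coefficient is rounded up to 4 to make the bound the square of
          \<open>2 * \<sigma>\<close>.\<close>
        also have "\<dots> \<le> 1 + \<sigma> + 4 * \<sigma>\<^sup>2"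
        proof -
          have "\<sigma>\<^sup>2 / (1 - \<sigma>) \<le> \<sigma>\<^sup>2 / (1 / 2)" using \<sigma> by (intro divide_left_mono) auto
          moreover have "\<sigma>\<^sup>2 / (1 / 2) \<le> 4 * \<sigma>\<^sup>2" using zero_le_power2[of \<sigma>] by simp
          ultimately show ?thesis by linarith
        qed
        finally show ?thesis unfolding Kpp by simp
      qed
      finally have "(pre.nrm ?e)\<^sup>2 \<le> (2 * \<sigma>)\<^sup>2" by (simp add: power_mult_distrib)
      then have "pre.nrm ?e \<le> 2 * \<sigma>" by (rule power2_le_imp_le) (simp add: \<sigma>_def)
      moreover have "norm (ip f ?e) \<le> 1 * pre.nrm ?e"
        using pre.Cauchy_Schwarz[OF f(1) em] mult_right_mono[OF f(2) pre.nrm_nonneg[OF em]] by linarith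
      ultimately show ?thesis unfolding fe \<sigma>_def by linarith
    qed
  qed
qed

end

section \<open>The second-order obstruction\<close>

text \<open>Entrywise R (1 - f cnj f) = N, where N is a signed sum of four rank-one kernels. One
  substitution gives R = N + f cnj f N + f f cnj (f f) R, each rank-one kernel contributes one
  \<open>\<Lambda>\<close>, and those with a minus sign are moved to the left. In the last term R
  has size \<rho>^2 and the factors f give \<open>\<rho> ^ 4\<close>, whence the remainder of order
  six.\<close>

lemma gram_second_order_bound:
  fixes U V f :: "'i \<Rightarrow> complex" and n :: nat
  assumes I: "finite I"
    and gram: "\<And>i j. i \<in> I \<Longrightarrow> j \<in> I \<Longrightarrow> (\<Sum>r<n. W i r * cnj (W j r))
      = 1 - (1 - U i * cnj (U j)) * (1 - V i * cnj (V j)) / (1 - f i * cnj (f j))"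
    and U: "\<And>i. i \<in> I \<Longrightarrow> norm (U i) \<le> \<rho>" and V: "\<And>i. i \<in> I \<Longrightarrow> norm (V i) \<le> \<rho>"
    and f: "\<And>i. i \<in> I \<Longrightarrow> norm (f i) \<le> A * \<rho>"
    and small: "A * \<rho> \<le> 1 / 2" "0 \<le> \<rho>" "\<rho> \<le> 1"
    and s: "\<And>i. i \<in> I \<Longrightarrow> norm (s i) \<le> 1"
  defines "\<Lambda> g \<equiv> (norm (\<Sum>i\<in>I. cnj (s i) * g i))\<^sup>2"
  shows "\<Lambda> (\<lambda>i. U i * V i) + \<Lambda> f + \<Lambda> (\<lambda>i. f i * (U i * V i)) + \<Lambda> (\<lambda>i. f i * f i)
    \<le> \<Lambda> U + \<Lambda> V + \<Lambda> (\<lambda>i. f i * U i) + \<Lambda> (\<lambda>i. f i * V i)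
      + (real (card I))\<^sup>2 * (2 * A ^ 4 * (3 + A\<^sup>2) * \<rho> ^ 6)"
proof -
  define Q where "Q B = (\<Sum>i\<in>I. \<Sum>j\<in>I. cnj (s i) * B i j * s j)" for B :: "'i \<Rightarrow> 'i \<Rightarrow> complex"
  define R where "R i j = (\<Sum>r<n. W i r * cnj (W j r))" for i j
  define N where "N i j = U i * cnj (U j) + V i * cnj (V j) - (U i * V i) * cnj (U j * V j) - f i * cnj (f j)" for i j
  define E where "E i j = (f i * f i) * cnj (f j * f j) * R i j" for i j
  have Q_rank_one: "Q (\<lambda>i j. g i * cnj (g j)) = of_real (\<Lambda> g)" for g
    unfolding Q_def \<Lambda>_def by (rule sum_rank_one)
  have Q_add: "Q (\<lambda>i j. B i j + C i j) = Q B + Q C" for B C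
    by (simp add: Q_def algebra_simps sum.distrib)
  have Q_diff: "Q (\<lambda>i j. B i j - C i j) = Q B - Q C" for B C
    by (simp add: Q_def algebra_simps sum_subtractf)
  have QN: "Q (\<lambda>i j. g i * cnj (g j) * N i j) = of_real (\<Lambda> (\<lambda>i. g i * U i) + \<Lambda> (\<lambda>i. g i * V i)
      - \<Lambda> (\<lambda>i. g i * (U i * V i)) - \<Lambda> (\<lambda>i. g i * f i))" for g
  proof -
    have "(\<lambda>i j. g i * cnj (g j) * N i j) = (\<lambda>i j. (g i * U i) * cnj (g j * U j) + (g i * V i) * cnj (g j * V j)
        - (g i * (U i * V i)) * cnj (g j * (U j * V j)) - (g i * f i) * cnj (g j * f j))"
      by (intro ext) (simp add: N_def algebra_simps)
    then show ?thesis by (simp only: Q_diff Q_add Q_rank_one of_real_add of_real_diff)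
  qed
  have ff: "norm (f i * cnj (f j)) \<le> 1 / 2" "norm (f i * f i) \<le> A\<^sup>2 * \<rho>\<^sup>2" "norm (f i * cnj (f j)) \<le> A\<^sup>2 * \<rho>\<^sup>2"
    if "i \<in> I" "j \<in> I" for i j
  proof -
    have "norm (f i) * norm (f j) \<le> (1 / 2) * 1"
      using f[OF that(1)] f[OF that(2)] small(1) by (intro mult_mono) auto
    then show "norm (f i * cnj (f j)) \<le> 1 / 2" by (simp add: norm_mult)
    have "norm (f i) * norm (f j) \<le> (A * \<rho>) * (A * \<rho>)" "norm (f i) * norm (f i) \<le> (A * \<rho>) * (A * \<rho>)"
      using f that order_trans[OF norm_ge_zero f[OF that(1)]] by (auto intro!: mult_mono)
    then show "norm (f i * f i) \<le> A\<^sup>2 * \<rho>\<^sup>2" "norm (f i * cnj (f j)) \<le> A\<^sup>2 * \<rho>\<^sup>2"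
      by (simp_all add: norm_mult power2_eq_square mult_ac)
  qed
  have R: "R i j * (1 - f i * cnj (f j)) = N i j" if "i \<in> I" "j \<in> I" for i j
  proof -
    have "1 - f i * cnj (f j) \<noteq> 0" using ff(1)[OF that] by auto
    then show ?thesis unfolding R_def N_def gram[OF that] by (simp add: field_simps)
  qed
  have "Q R = Q (\<lambda>i j. N i j + f i * cnj (f j) * N i j + E i j)"
    unfolding Q_def
  proof (intro sum.cong refl)
    fix i j assume ij: "i \<in> I" "j \<in> I"
    show "cnj (s i) * R i j * s j = cnj (s i) * (N i j + f i * cnj (f j) * N i j + E i j) * s j"
      unfolding E_def R[OF ij, symmetric] by (simp add: algebra_simps)
  qed
  also have "\<dots> = of_real (\<Lambda> U + \<Lambda> V - \<Lambda> (\<lambda>i. U i * V i) - \<Lambda> f + (\<Lambda> (\<lambda>i. f i * U i) + \<Lambda> (\<lambda>i. f i * V i)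
      - \<Lambda> (\<lambda>i. f i * (U i * V i)) - \<Lambda> (\<lambda>i. f i * f i))) + Q E"
    using QN[of "\<lambda>_. 1"] QN[of f] by (simp add: Q_add)
  finally have QR: "Re (Q R) = \<Lambda> U + \<Lambda> V - \<Lambda> (\<lambda>i. U i * V i) - \<Lambda> f + (\<Lambda> (\<lambda>i. f i * U i)
      + \<Lambda> (\<lambda>i. f i * V i) - \<Lambda> (\<lambda>i. f i * (U i * V i)) - \<Lambda> (\<lambda>i. f i * f i)) + Re (Q E)"
    by simp
  have "Q R \<in> \<real>\<^sub>\<ge>\<^sub>0"
  proof -
    have "pos_semidef I R" unfolding R_def by (intro pos_semidef_sum pos_semidef_rank_one)
    then show ?thesis unfolding Q_def pos_semidef_def by blast
  qed
  then have "0 \<le> Re (Q R)" by (simp add: complex_nonneg_Reals_iff)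
  moreover have "Re (Q E) \<le> (real (card I))\<^sup>2 * (2 * A ^ 4 * (3 + A\<^sup>2) * \<rho> ^ 6)"
  proof -
    have "norm (cnj (s i) * E i j * s j) \<le> 2 * A ^ 4 * (3 + A\<^sup>2) * \<rho> ^ 6" if ij: "i \<in> I" "j \<in> I" for i j
    proof -
      \<comment> \<open>Three summands of \<open>N\<close> are bounded by \<rho>^2 and the last by
        A^2 \<rho>^2. The divisor \<open>1 - f i * cnj (f j)\<close> has modulus at least 1/2, which
        doubles the bound.\<close>
      have "norm (R i j) \<le> 2 * ((3 + A\<^sup>2) * \<rho>\<^sup>2)"
      proof -
        have UU: "norm (U i * cnj (U j)) \<le> \<rho>\<^sup>2" "norm (V i * cnj (V j)) \<le> \<rho>\<^sup>2"
          using U V ij small(2) by (auto simp: norm_mult power2_eq_square intro!: mult_mono)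
        have "norm ((U i * V i) * cnj (U j * V j)) = norm (U i * cnj (U j)) * norm (V i * cnj (V j))"
          by (simp add: norm_mult)
        also have "\<dots> \<le> \<rho>\<^sup>2 * 1"
          using UU small by (intro mult_mono) (auto intro: order_trans[OF _ power_le_one])
        finally have "norm ((U i * V i) * cnj (U j * V j)) \<le> \<rho>\<^sup>2" by simp
        moreover have "norm (a + b - c - d) \<le> norm a + norm b + norm c + norm d" for a b c d :: complex
          using norm_triangle_ineq4[of "a + b - c" d] norm_triangle_ineq4[of "a + b" c]
            norm_triangle_ineq[of a b] by linarith
        ultimately have "norm (N i j) \<le> \<rho>\<^sup>2 + \<rho>\<^sup>2 + \<rho>\<^sup>2 + A\<^sup>2 * \<rho>\<^sup>2"
          unfolding N_def using UU ff(3)[OF ij] by (meson add_mono order_trans)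
        moreover have "norm (R i j) * (1 / 2) \<le> norm (R i j) * norm (1 - f i * cnj (f j))"
          using ff(1)[OF ij] norm_triangle_ineq2[of 1 "f i * cnj (f j)"] by (intro mult_left_mono) auto
        ultimately show ?thesis unfolding norm_mult[symmetric] R[OF ij] by (simp add: algebra_simps)
      qed
      then have "norm (E i j) \<le> (A\<^sup>2 * \<rho>\<^sup>2) * (A\<^sup>2 * \<rho>\<^sup>2) * (2 * ((3 + A\<^sup>2) * \<rho>\<^sup>2))"
        unfolding E_def norm_mult[of "_ * _" "R i j"] norm_mult[of "f i * f i"] complex_mod_cnj
        using ff(2)[OF ij] ff(2)[OF ij(2,1)] by (intro mult_mono) auto
      also have "\<dots> = 2 * A ^ 4 * (3 + A\<^sup>2) * \<rho> ^ 6"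
        by (simp add: algebra_simps flip: power_add power_mult)
      finally have E: "norm (E i j) \<le> 2 * A ^ 4 * (3 + A\<^sup>2) * \<rho> ^ 6" .
      have "norm (cnj (s i) * E i j * s j) = norm (s i) * norm (s j) * norm (E i j)"
        by (simp add: norm_mult)
      also have "\<dots> \<le> 1 * norm (E i j)"
        using s[OF ij(1)] s[OF ij(2)] mult_le_one[of "norm (s i)" "norm (s j)"] by (intro mult_right_mono) auto
      finally show ?thesis using E by simp
    qed
    then have "norm (Q E) \<le> (\<Sum>i\<in>I. \<Sum>j\<in>I. 2 * A ^ 4 * (3 + A\<^sup>2) * \<rho> ^ 6)"
      unfolding Q_def by (intro sum_norm_le)
    also have "\<dots> = (real (card I))\<^sup>2 * (2 * A ^ 4 * (3 + A\<^sup>2) * \<rho> ^ 6)"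
      by (simp add: power2_eq_square mult_ac)
    finally show ?thesis using complex_Re_le_cmod order_trans by blast
  qed
  ultimately show ?thesis unfolding QR by linarith
qed

text \<open>Here \<open>z\<close> and \<open>w\<close> play the part of u(x) and v(y), and
  \<open>f1\<close>, \<open>f2\<close>, \<open>f3\<close> are the values of one function at (x, w2),
  (w1, y) and (x, y). After division by \<open>\<rho> ^ 4\<close> each quotient is within O(\<rho>)
  of its limit: b, a and 2 a b respectively.\<close>

lemma second_order_limit:
  fixes a b :: complex
  assumes \<delta>: "\<delta> > 0" and M: "M \<ge> 0"
    and step: "\<And>\<rho>. 0 < \<rho> \<Longrightarrow> \<rho> \<le> \<delta> \<Longrightarrow> \<exists>z w f1 f2 f3 :: complex. norm z = \<rho> \<and> norm w = \<rho> \<and>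
      norm (f1 - a * z) \<le> M * \<rho>\<^sup>2 \<and> norm (f2 - b * w) \<le> M * \<rho>\<^sup>2 \<and>
      norm (f3 - (a * z + b * w)) \<le> M * \<rho>\<^sup>2 \<and>
      \<rho> ^ 4 + (norm (f3\<^sup>2 - f1\<^sup>2 - f2\<^sup>2))\<^sup>2 \<le> (\<rho> * norm (f3 - f1))\<^sup>2 + (\<rho> * norm (f3 - f2))\<^sup>2 + C * \<rho> ^ 6"
  shows "1 + 4 * (norm (a * b))\<^sup>2 \<le> (norm a)\<^sup>2 + (norm b)\<^sup>2"
proof -
  define r where "r n = \<delta> / real (Suc n)" for n
  have r: "0 < r n" "r n \<le> \<delta>" for n
    using \<delta> by (auto simp: r_def divide_simps)
  have r0: "r \<longlonglongrightarrow> 0"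
    using tendsto_mult_right_zero[OF LIMSEQ_inverse_real_of_nat, of \<delta>]
    by (simp add: r_def[abs_def] divide_inverse)
  have "\<forall>n. \<exists>z w f1 f2 f3 :: complex. norm z = r n \<and> norm w = r n \<and>
      norm (f1 - a * z) \<le> M * (r n)\<^sup>2 \<and> norm (f2 - b * w) \<le> M * (r n)\<^sup>2 \<and>
      norm (f3 - (a * z + b * w)) \<le> M * (r n)\<^sup>2 \<and>
      r n ^ 4 + (norm (f3\<^sup>2 - f1\<^sup>2 - f2\<^sup>2))\<^sup>2
        \<le> (r n * norm (f3 - f1))\<^sup>2 + (r n * norm (f3 - f2))\<^sup>2 + C * r n ^ 6"
    using step r by blast
  then obtain z w f1 f2 f3 :: "nat \<Rightarrow> complex" where
    zw: "\<And>n. norm (z n) = r n" "\<And>n. norm (w n) = r n"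
    and f1: "\<And>n. norm (f1 n - a * z n) \<le> M * (r n)\<^sup>2"
    and f2: "\<And>n. norm (f2 n - b * w n) \<le> M * (r n)\<^sup>2"
    and f3: "\<And>n. norm (f3 n - (a * z n + b * w n)) \<le> M * (r n)\<^sup>2"
    and ineq: "\<And>n. r n ^ 4 + (norm ((f3 n)\<^sup>2 - (f1 n)\<^sup>2 - (f2 n)\<^sup>2))\<^sup>2
        \<le> (r n * norm (f3 n - f1 n))\<^sup>2 + (r n * norm (f3 n - f2 n))\<^sup>2 + C * r n ^ 6"
    unfolding choice_iff by blast
  have nz: "z n \<noteq> 0" "w n \<noteq> 0" for n using zw[of n] r(1)[of n] by auto
  have lim: "s \<longlonglongrightarrow> l" if "\<And>n. norm (s n - l) \<le> B * r n" for s :: "nat \<Rightarrow> complex" and l B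
  proof -
    have "(\<lambda>n. s n - l) \<longlonglongrightarrow> 0"
      by (rule Lim_null_comparison[OF _ tendsto_mult_right_zero[OF r0, of B]]) (simp add: that)
    then show ?thesis by (rule LIM_zero_cancel)
  qed
  have P: "(\<lambda>n. (f3 n - f1 n) / w n) \<longlonglongrightarrow> b"
  proof (rule lim)
    fix n
    have "norm (f3 n - f1 n - b * w n) \<le> (2 * M * r n) * r n"
      using norm_triangle_ineq4[of "f3 n - (a * z n + b * w n)" "f1 n - a * z n"] f1[of n] f3[of n]
      by (simp add: algebra_simps power2_eq_square)
    moreover have "(f3 n - f1 n) / w n - b = (f3 n - f1 n - b * w n) / w n"
      using nz by (simp add: field_simps)
    ultimately show "norm ((f3 n - f1 n) / w n - b) \<le> 2 * M * r n"
      using r(1)[of n] by (simp add: norm_divide zw pos_divide_le_eq)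
  qed
  have Q: "(\<lambda>n. (f3 n - f2 n) / z n) \<longlonglongrightarrow> a"
  proof (rule lim)
    fix n
    have "norm (f3 n - f2 n - a * z n) \<le> (2 * M * r n) * r n"
      using norm_triangle_ineq4[of "f3 n - (a * z n + b * w n)" "f2 n - b * w n"] f2[of n] f3[of n]
      by (simp add: algebra_simps power2_eq_square)
    moreover have "(f3 n - f2 n) / z n - a = (f3 n - f2 n - a * z n) / z n"
      using nz by (simp add: field_simps)
    ultimately show "norm ((f3 n - f2 n) / z n - a) \<le> 2 * M * r n"
      using r(1)[of n] by (simp add: norm_divide zw pos_divide_le_eq)
  qed
  define B where "B = 2 * (norm a + norm b) + M * \<delta>"
  \<comment> \<open>Knowing g up to order two determines its square up to order three, by factoring
    the difference of squares: one factor is O(\<rho>^2), the other O(\<rho>).\<close>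
  have sq: "norm (g\<^sup>2 - h\<^sup>2) \<le> M * B * (r n) ^ 3"
    if g: "norm (g - h) \<le> M * (r n)\<^sup>2" and h: "norm h \<le> (norm a + norm b) * r n" for g h :: complex and n
  proof -
    have "norm (g + h) \<le> norm (g - h) + 2 * norm h"
      using norm_triangle_ineq[of "g - h" "2 * h"] by (simp add: norm_mult algebra_simps)
    also have "\<dots> \<le> M * \<delta> * r n + 2 * ((norm a + norm b) * r n)"
    proof -
      have "M * (r n)\<^sup>2 \<le> M * \<delta> * r n"
        using mult_left_mono[OF mult_right_mono[OF r(2)[of n], of "r n"] M] r(1)[of n]
        by (simp add: power2_eq_square mult_ac)
      then show ?thesis using g h by linarith
    qed
    finally have "norm (g + h) \<le> B * r n" by (simp add: B_def algebra_simps)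
    then have "norm (g - h) * norm (g + h) \<le> (M * (r n)\<^sup>2) * (B * r n)"
      using g M by (intro mult_mono) auto
    moreover have "g\<^sup>2 - h\<^sup>2 = (g - h) * (g + h)" by (simp add: algebra_simps power2_eq_square)
    ultimately show ?thesis by (simp add: norm_mult power2_eq_square power3_eq_cube mult_ac)
  qed
  have S: "(\<lambda>n. ((f3 n)\<^sup>2 - (f1 n)\<^sup>2 - (f2 n)\<^sup>2) / (z n * w n)) \<longlonglongrightarrow> 2 * (a * b)"
  proof (rule lim)
    fix n
    have ab: "norm (a * z n) \<le> (norm a + norm b) * r n" "norm (b * w n) \<le> (norm a + norm b) * r n"
      "norm (a * z n + b * w n) \<le> (norm a + norm b) * r n"
      using norm_triangle_ineq[of "a * z n" "b * w n"] r(1)[of n]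
      by (simp_all add: norm_mult zw algebra_simps)
    let ?x = "(f3 n)\<^sup>2 - (a * z n + b * w n)\<^sup>2" and ?y = "(f1 n)\<^sup>2 - (a * z n)\<^sup>2"
      and ?t = "(f2 n)\<^sup>2 - (b * w n)\<^sup>2"
    have "norm (?x - ?y - ?t) \<le> norm ?x + norm ?y + norm ?t"
      using norm_triangle_ineq4[of "?x - ?y" ?t] norm_triangle_ineq4[of ?x ?y] by linarith
    also have "\<dots> \<le> 3 * (M * B * (r n) ^ 3)"
      using sq[OF f3 ab(3)] sq[OF f1 ab(1)] sq[OF f2 ab(2)] by linarith
    \<comment> \<open>Squaring a z + b w and removing both pure squares leaves 2 a b z w. This is
      the source of the coefficient 4 in the conclusion.\<close>
    also have "?x - ?y - ?t = (f3 n)\<^sup>2 - (f1 n)\<^sup>2 - (f2 n)\<^sup>2 - 2 * (a * b) * (z n * w n)"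
      by (simp add: algebra_simps power2_eq_square)
    finally have "norm ((f3 n)\<^sup>2 - (f1 n)\<^sup>2 - (f2 n)\<^sup>2 - 2 * (a * b) * (z n * w n)) \<le> (3 * M * B * r n) * (r n * r n)"
      by (simp add: power3_eq_cube mult_ac)
    moreover have "((f3 n)\<^sup>2 - (f1 n)\<^sup>2 - (f2 n)\<^sup>2) / (z n * w n) - 2 * (a * b)
        = ((f3 n)\<^sup>2 - (f1 n)\<^sup>2 - (f2 n)\<^sup>2 - 2 * (a * b) * (z n * w n)) / (z n * w n)"
      using nz by (simp add: diff_divide_distrib)
    ultimately show "norm (((f3 n)\<^sup>2 - (f1 n)\<^sup>2 - (f2 n)\<^sup>2) / (z n * w n) - 2 * (a * b)) \<le> 3 * M * B * r n"
      using r(1)[of n] by (simp add: norm_divide norm_mult zw pos_divide_le_eq)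
  qed
  have "1 + (norm (2 * (a * b)))\<^sup>2 \<le> (norm b)\<^sup>2 + (norm a)\<^sup>2 + C * 0\<^sup>2"
  proof (rule LIMSEQ_le)
    show "(\<lambda>n. 1 + (norm (((f3 n)\<^sup>2 - (f1 n)\<^sup>2 - (f2 n)\<^sup>2) / (z n * w n)))\<^sup>2) \<longlonglongrightarrow> 1 + (norm (2 * (a * b)))\<^sup>2"
      by (intro tendsto_intros S)
    show "(\<lambda>n. (norm ((f3 n - f1 n) / w n))\<^sup>2 + (norm ((f3 n - f2 n) / z n))\<^sup>2 + C * (r n)\<^sup>2)
        \<longlonglongrightarrow> (norm b)\<^sup>2 + (norm a)\<^sup>2 + C * 0\<^sup>2"
      by (intro tendsto_intros P Q r0)
    have "1 + (norm (((f3 n)\<^sup>2 - (f1 n)\<^sup>2 - (f2 n)\<^sup>2) / (z n * w n)))\<^sup>2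
        \<le> (norm ((f3 n - f1 n) / w n))\<^sup>2 + (norm ((f3 n - f2 n) / z n))\<^sup>2 + C * (r n)\<^sup>2" for n
    proof -
      define T X Y where "T = norm ((f3 n)\<^sup>2 - (f1 n)\<^sup>2 - (f2 n)\<^sup>2)"
        and "X = norm (f3 n - f1 n)" and "Y = norm (f3 n - f2 n)"
      have rn: "r n > 0" by (rule r)
      have "1 + (T / (r n * r n))\<^sup>2 = (r n ^ 4 + T\<^sup>2) / r n ^ 4"
        using rn by (simp add: field_simps power2_eq_square power4_eq_xxxx)
      also have "\<dots> \<le> ((r n * X)\<^sup>2 + (r n * Y)\<^sup>2 + C * r n ^ 6) / r n ^ 4"
        using ineq[of n] rn unfolding T_def X_def Y_def by (intro divide_right_mono) auto
      also have "\<dots> = (X / r n)\<^sup>2 + (Y / r n)\<^sup>2 + C * (r n)\<^sup>2"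
        using rn by (simp add: field_simps power2_eq_square eval_nat_numeral)
      finally show ?thesis unfolding T_def X_def Y_def by (simp add: norm_divide norm_mult zw)
    qed
    then show "\<exists>N. \<forall>n\<ge>N. 1 + (norm (((f3 n)\<^sup>2 - (f1 n)\<^sup>2 - (f2 n)\<^sup>2) / (z n * w n)))\<^sup>2
        \<le> (norm ((f3 n - f1 n) / w n))\<^sup>2 + (norm ((f3 n - f2 n) / z n))\<^sup>2 + C * (r n)\<^sup>2"
      by blast
  qed
  then show ?thesis by (simp add: norm_mult power_mult_distrib)
qed

section \<open>Points of prescribed modulus, and the necessity of the coordinate form\<close>

lemma holomorphic_vec_on_imp_continuous_on:
  "holomorphic_vec_on f \<Omega> \<Longrightarrow> continuous_on \<Omega> f"
  unfolding holomorphic_vec_on_def continuous_on_eq_continuous_within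
  using has_derivative_continuous by blast

text \<open>Prescribing the modulus exactly, rather than merely finding small nonzero values, allows
  u and v to be taken at the same scale.\<close>

lemma exists_small_modulus:
  fixes u :: "'a::topological_space \<Rightarrow> complex"
  assumes "connected \<Omega>" "continuous_on \<Omega> u" "\<not> u constant_on \<Omega>" "w \<in> \<Omega>" "u w = 0"
  obtains \<delta> where "\<delta> > 0" "\<And>\<rho>. 0 < \<rho> \<Longrightarrow> \<rho> \<le> \<delta> \<Longrightarrow> \<exists>x\<in>\<Omega>. norm (u x) = \<rho>"
proof -
  obtain x where x: "x \<in> \<Omega>" "u x \<noteq> 0" using assms(3) unfolding constant_on_def by blast
  have "connected ((\<lambda>x. norm (u x)) ` \<Omega>)"
    using assms by (intro connected_continuous_image continuous_on_norm)
  moreover have "0 \<in> (\<lambda>x. norm (u x)) ` \<Omega>" using assms(4,5) by force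
  moreover have "norm (u x) \<in> (\<lambda>x. norm (u x)) ` \<Omega>" using x by blast
  ultimately have sub: "{0..norm (u x)} \<subseteq> (\<lambda>x. norm (u x)) ` \<Omega>" by (rule connected_contains_Icc)
  show ?thesis
  proof (rule that)
    show "norm (u x) > 0" using x by simp
    fix \<rho> assume "0 < \<rho>" "\<rho> \<le> norm (u x)"
    then have "\<rho> \<in> {0..norm (u x)}" by simp
    then have "\<rho> \<in> (\<lambda>x. norm (u x)) ` \<Omega>" by (rule subsetD[OF sub])
    then show "\<exists>x\<in>\<Omega>. norm (u x) = \<rho>" by auto
  qed
qed

lemma kernel_tensor_disc_kernel_eq:
  "kernel_tensor (disc_kernel u) (disc_kernel v) p q
    = 1 / ((1 - u (fst p) * cnj (u (fst q))) * (1 - v (snd p) * cnj (v (snd q))))"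
  by (simp add: kernel_tensor_def disc_kernel_def)

lemma kernel_on_tensor_disc_kernel:
  assumes "u ` \<Omega> \<subseteq> ball 0 1" "v ` \<Omega> \<subseteq> ball 0 1"
  shows "kernel_on (\<Omega> \<times> \<Omega>) (kernel_tensor (disc_kernel u) (disc_kernel v))"
  unfolding kernel_on_def
proof (intro allI impI)
  fix F assume F: "finite F \<and> F \<subseteq> \<Omega> \<times> \<Omega>"
  have "pos_semidef F (\<lambda>p q. 1 / (1 - u (fst p) * cnj (u (fst q))) / (1 - v (snd p) * cnj (v (snd q))))"
    using F assms by (intro pos_semidef_mult_szego pos_semidef_one) (force simp: subset_iff)+
  then show "pos_semidef F (kernel_tensor (disc_kernel u) (disc_kernel v))"
    by (subst pos_semidef_cong) (auto simp: kernel_tensor_disc_kernel_eq)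
qed

lemma cnp_dBR_kernel_imp_coordinate:
  fixes u v :: "'a::topological_space \<Rightarrow> complex"
  assumes conn: "connected \<Omega>"
    and uD: "u ` \<Omega> \<subseteq> ball 0 1" and vD: "v ` \<Omega> \<subseteq> ball 0 1"
    and cont: "continuous_on \<Omega> u" "continuous_on \<Omega> v"
    and nonconst: "\<not> u constant_on \<Omega>" "\<not> v constant_on \<Omega>"
    and w: "w1 \<in> \<Omega>" "w2 \<in> \<Omega>" "u w1 = 0" "v w2 = 0"
    and K_def: "K = kernel_tensor (disc_kernel u) (disc_kernel v)"
    and \<phi>D: "\<phi> ` (\<Omega> \<times> \<Omega>) \<subseteq> ball 0 1"
    and mult: "\<phi> \<in> contractive_multipliers (\<Omega> \<times> \<Omega>) K"
    and \<phi>w: "\<phi> (w1, w2) = 0"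
    and cnp: "cnp_kernel (\<Omega> \<times> \<Omega>) (dBR_kernel \<phi> K)"
  shows "\<exists>c. norm c = 1 \<and>
    ((\<forall>x\<in>\<Omega>. \<forall>y\<in>\<Omega>. \<phi> (x, y) = c * u x) \<or> (\<forall>x\<in>\<Omega>. \<forall>y\<in>\<Omega>. \<phi> (x, y) = c * v y))"
proof -
  define X where "X = \<Omega> \<times> \<Omega>"
  define U V where "U p = u (fst p)" and "V p = v (snd p)" for p :: "'a \<times> 'a"
  have U: "norm (U p) < 1" and V: "norm (V p) < 1" and \<phi>1: "norm (\<phi> p) < 1" if "p \<in> X" for p
    using that uD vD \<phi>D by (auto simp: X_def U_def V_def image_subset_iff)
  have kernel: "K p q = 1 / ((1 - U p * cnj (U q)) * (1 - V p * cnj (V q)))" for p q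
    by (simp add: K_def kernel_tensor_disc_kernel_eq U_def V_def)
  have K: "kernel_on X K" unfolding X_def K_def by (rule kernel_on_tensor_disc_kernel[OF uD vD])
  interpret reproducing_kernel_space X "rkhs_space X K" "snd (rkhs X K)" K
    by (rule Moore_Aronszajn[OF K])
  interpret B: bidisc_kernel_space X "rkhs_space X K" "snd (rkhs X K)" K U V "(w1, w2)"
    by unfold_locales (use w in \<open>auto simp: X_def U_def V_def kernel U[unfolded X_def U_def] V[unfolded X_def V_def]\<close>)
  let ?w = "(w1, w2)"
  have wX: "?w \<in> X" using w by (simp add: X_def)
  \<comment> \<open>The function \<phi> as an element of the space: the kernel section at the base
    point is 1 on \<open>X\<close> and 0 elsewhere, so f is \<phi> extended by zero, and
    contractivity bounds its norm by that of the section, which is 1.\<close>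
  define f where "f p = \<phi> p * kernel_section X K ?w p" for p
  have f_eq: "f p = \<phi> p" if "p \<in> X" for p
    using B.kernel_w[OF that] that by (simp add: f_def kernel_section_def)
  have f: "f \<in> rkhs_space X K" "pre.nrm f \<le> 1" "f ?w = 0"
  proof -
    have "f \<in> rkhs_space X K \<and> rkhs_norm X K f \<le> rkhs_norm X K (kernel_section X K ?w)"
      using mult section_mem[OF wX] unfolding contractive_multipliers_def f_def X_def by blast
    then show "f \<in> rkhs_space X K" "pre.nrm f \<le> 1"
      using pre.nrm_section[OF wX] B.kernel_w[OF wX] by (simp_all add: rkhs_norm_def ip_norm_def)
    show "f ?w = 0" using f_eq[OF wX] \<phi>w by simp
  qed
  obtain a b where ab: "(norm a)\<^sup>2 + (norm b)\<^sup>2 \<le> 1"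
    and expand: "\<And>p. p \<in> X \<Longrightarrow> (norm (U p))\<^sup>2 + (norm (V p))\<^sup>2 \<le> 1 / 2 \<Longrightarrow>
      norm (f p - (a * U p + b * V p)) \<le> 2 * ((norm (U p))\<^sup>2 + (norm (V p))\<^sup>2)"
    and equality: "\<And>p. (norm a)\<^sup>2 + (norm b)\<^sup>2 = 1 \<Longrightarrow> p \<in> X \<Longrightarrow> f p = a * U p + b * V p"
  proof (rule B.unit_ball_expansion[OF f], goal_cases)
    case prems: (1 a b)
    show ?case by (rule prems(1)[of a b]) (fact prems(2), erule (1) prems(3), erule (1) prems(4))
  qed
  have "norm t \<le> 1" if "(norm t)\<^sup>2 \<le> 1" for t :: complex
    using that power2_le_imp_le[of "norm t" 1] by simp
  moreover have "(norm a)\<^sup>2 \<le> 1" "(norm b)\<^sup>2 \<le> 1"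
    using ab zero_le_power2[of "norm a"] zero_le_power2[of "norm b"] by linarith+
  ultimately have ab1: "norm a \<le> 1" "norm b \<le> 1" by blast+
  define K' where "K' = dBR_kernel \<phi> K"
  have K'nz: "K' p q \<noteq> 0" if "p \<in> X" "q \<in> X" for p q
    using one_minus_mult_cnj_nonzero U V \<phi>1 that unfolding K'_def dBR_kernel_def kernel by simp
  have K'w: "K' p ?w = 1" if "p \<in> X" for p
    using B.kernel_w[OF that] \<phi>w by (simp add: K'_def dBR_kernel_def)
  obtain \<delta>u where \<delta>u: "\<delta>u > 0" "\<And>\<rho>. 0 < \<rho> \<Longrightarrow> \<rho> \<le> \<delta>u \<Longrightarrow> \<exists>x\<in>\<Omega>. norm (u x) = \<rho>"
    using exists_small_modulus[OF conn cont(1) nonconst(1) w(1,3)] by blast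
  obtain \<delta>v where \<delta>v: "\<delta>v > 0" "\<And>\<rho>. 0 < \<rho> \<Longrightarrow> \<rho> \<le> \<delta>v \<Longrightarrow> \<exists>x\<in>\<Omega>. norm (v x) = \<rho>"
    using exists_small_modulus[OF conn cont(2) nonconst(2) w(2,4)] by blast
  \<comment> \<open>The bound 1/12 ensures 6 \<rho> \<le> 1/2, the smallness asked of f, and also
    the condition |U|^2 + |V|^2 \<le> 1/2 of the expansion.\<close>
  define \<delta> where "\<delta> = min (min \<delta>u \<delta>v) (1 / 12)"
  \<comment> \<open>The remainder constant of \<open>gram_second_order_bound\<close> for three nodes
    and \<open>A = 6\<close>.\<close>
  define C :: real where "C = 3\<^sup>2 * (2 * 6 ^ 4 * (3 + 6\<^sup>2))"
  have "1 + 4 * (norm (a * b))\<^sup>2 \<le> (norm a)\<^sup>2 + (norm b)\<^sup>2"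
  proof (rule second_order_limit[of \<delta> 4 a b C])
    fix \<rho> :: real assume \<rho>: "0 < \<rho>" "\<rho> \<le> \<delta>"
    obtain x y where x: "x \<in> \<Omega>" "norm (u x) = \<rho>" and y: "y \<in> \<Omega>" "norm (v y) = \<rho>"
      using \<delta>u(2)[of \<rho>] \<delta>v(2)[of \<rho>] \<rho> by (auto simp: \<delta>_def)
    \<comment> \<open>Three corners of the mixed difference. The fourth, \<open>(w1, w2)\<close>, is
      omitted since U, V and f vanish there. All indices from 2 on give (x, y), so P takes just
      three values.\<close>
    define P where "P i = (if i = 0 then (x, w2) else if i = 1 then (w1, y) else (x, y))" for i :: nat
    define s :: "nat \<Rightarrow> complex" where "s i = (if i = 2 then 1 else - 1)" for i
    have PX: "P i \<in> X" for i using x y w by (simp add: P_def X_def)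
    have PU: "norm (U (P i)) \<le> \<rho>" and PV: "norm (V (P i)) \<le> \<rho>" for i
      using x y w \<rho> by (auto simp: P_def U_def V_def)
    have near: "norm (f (P i) - (a * U (P i) + b * V (P i))) \<le> 4 * \<rho>\<^sup>2" for i
    proof -
      have "(norm (U (P i)))\<^sup>2 \<le> \<rho>\<^sup>2" "(norm (V (P i)))\<^sup>2 \<le> \<rho>\<^sup>2"
        using PU PV by (auto intro: power_mono)
      moreover have "\<rho>\<^sup>2 \<le> (1 / 12)\<^sup>2" using \<rho> by (intro power_mono) (auto simp: \<delta>_def)
      ultimately show ?thesis using expand[OF PX, of i] by (simp add: power2_eq_square)
    qed
    \<comment> \<open>The linear part is at most 2 \<rho> and the error 4 \<rho>^2 at most 4 \<rho>;
      this is where the constant 6 comes from.\<close>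
    have Pf: "norm (f (P i)) \<le> 6 * \<rho>" for i
    proof -
      have "norm (a * U (P i)) \<le> 1 * \<rho>" "norm (b * V (P i)) \<le> 1 * \<rho>"
        unfolding norm_mult by (intro mult_mono ab1 PU PV; simp)+
      then have "norm (a * U (P i) + b * V (P i)) \<le> 2 * \<rho>"
        using norm_triangle_ineq[of "a * U (P i)" "b * V (P i)"] by linarith
      moreover have "\<rho>\<^sup>2 \<le> \<rho>" using \<rho> by (simp add: power2_eq_square \<delta>_def)
      ultimately show ?thesis
        using near[of i] norm_triangle_ineq2[of "f (P i)" "a * U (P i) + b * V (P i)"] by linarith
    qed
    have "\<exists>(n::nat) W. \<forall>p\<in>range P. \<forall>q\<in>range P. (\<Sum>r<n. W p r * cnj (W q r)) = 1 - 1 / K' p q"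
    proof (rule cnp_kernel_gram[OF _ wX])
      show "cnp_kernel X K'" using cnp by (simp add: X_def K'_def)
      have "range P \<subseteq> P ` {0, 1, 2}"
        by (auto simp: P_def image_iff)
      then show "finite (range P)" by (rule finite_subset) simp
      show "range P \<subseteq> X" using PX by blast
    qed (use K'w K'nz in auto)
    then obtain n :: nat and W where W: "\<And>i j. (\<Sum>r<n. W (P i) r * cnj (W (P j) r)) = 1 - 1 / K' (P i) (P j)"
      by blast
    have gram: "(\<Sum>r<n. W (P i) r * cnj (W (P j) r)) = 1 - (1 - U (P i) * cnj (U (P j))) *
        (1 - V (P i) * cnj (V (P j))) / (1 - f (P i) * cnj (f (P j)))" for i j
      unfolding W K'_def dBR_kernel_def kernel f_eq[OF PX] by simp
    define \<Lambda> where "\<Lambda> g = (norm (\<Sum>i\<in>{..<3}. cnj (s i) * g i))\<^sup>2" for g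
    have \<Lambda>: "\<Lambda> g = (norm (g 2 - g 0 - g 1))\<^sup>2" for g
      by (simp add: \<Lambda>_def s_def eval_nat_numeral norm_minus_commute algebra_simps)
    have main: "\<Lambda> (\<lambda>i. U (P i) * V (P i)) + \<Lambda> (\<lambda>i. f (P i)) + \<Lambda> (\<lambda>i. f (P i) * (U (P i) * V (P i)))
          + \<Lambda> (\<lambda>i. f (P i) * f (P i))
        \<le> \<Lambda> (\<lambda>i. U (P i)) + \<Lambda> (\<lambda>i. V (P i)) + \<Lambda> (\<lambda>i. f (P i) * U (P i)) + \<Lambda> (\<lambda>i. f (P i) * V (P i))
          + (real (card {..<3::nat}))\<^sup>2 * (2 * 6 ^ 4 * (3 + 6\<^sup>2) * \<rho> ^ 6)"
      unfolding \<Lambda>_def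
      by (rule gram_second_order_bound[OF _ gram PU PV Pf]) (use \<rho> in \<open>auto simp: \<delta>_def s_def\<close>)
    have vals: "U (P 0) = u x" "U (P 1) = 0" "U (P 2) = u x" "V (P 0) = 0" "V (P 1) = v y" "V (P 2) = v y"
      using w by (simp_all add: U_def V_def P_def)
    \<comment> \<open>By \<open>vals\<close> the differences of U and of V are zero. On the smaller
      side the squares belonging to f and to f u v are nonnegative and are discarded.\<close>
    have "(norm (u x * v y))\<^sup>2 + (norm (f (P 2) * f (P 2) - f (P 0) * f (P 0) - f (P 1) * f (P 1)))\<^sup>2
        \<le> (norm (f (P 2) * u x - f (P 0) * u x))\<^sup>2 + (norm (f (P 2) * v y - f (P 1) * v y))\<^sup>2 + C * \<rho> ^ 6"
    proof -
      have "(norm (u x * v y))\<^sup>2 + (norm (f (P 2) - f (P 0) - f (P 1)))\<^sup>2 + (norm (f (P 2) * (u x * v y)))\<^sup>2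
          + (norm (f (P 2) * f (P 2) - f (P 0) * f (P 0) - f (P 1) * f (P 1)))\<^sup>2
        \<le> (norm (f (P 2) * u x - f (P 0) * u x))\<^sup>2 + (norm (f (P 2) * v y - f (P 1) * v y))\<^sup>2 + C * \<rho> ^ 6"
        using main unfolding \<Lambda> vals C_def by simp
      then show ?thesis by (rule order_trans[rotated]) simp
    qed
    moreover have "norm (u x * v y) = \<rho>\<^sup>2" using x y by (simp add: norm_mult power2_eq_square)
    moreover have "norm (f (P 2) * u x - f (P 0) * u x) = \<rho> * norm (f (P 2) - f (P 0))"
      using x by (simp add: norm_mult flip: left_diff_distrib)
    moreover have "norm (f (P 2) * v y - f (P 1) * v y) = \<rho> * norm (f (P 2) - f (P 1))"
      using y by (simp add: norm_mult flip: left_diff_distrib)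
    ultimately have "\<rho> ^ 4 + (norm ((f (P 2))\<^sup>2 - (f (P 0))\<^sup>2 - (f (P 1))\<^sup>2))\<^sup>2
        \<le> (\<rho> * norm (f (P 2) - f (P 0)))\<^sup>2 + (\<rho> * norm (f (P 2) - f (P 1)))\<^sup>2 + C * \<rho> ^ 6"
      by (simp add: power2_eq_square[of "f _"])
    then show "\<exists>z w f1 f2 f3. norm z = \<rho> \<and> norm w = \<rho> \<and>
      norm (f1 - a * z) \<le> 4 * \<rho>\<^sup>2 \<and> norm (f2 - b * w) \<le> 4 * \<rho>\<^sup>2 \<and>
      norm (f3 - (a * z + b * w)) \<le> 4 * \<rho>\<^sup>2 \<and>
      \<rho> ^ 4 + (norm (f3\<^sup>2 - f1\<^sup>2 - f2\<^sup>2))\<^sup>2 \<le> (\<rho> * norm (f3 - f1))\<^sup>2 + (\<rho> * norm (f3 - f2))\<^sup>2 + C * \<rho> ^ 6"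
      using near[of 0] near[of 1] near[of 2] x y unfolding vals
      by (intro exI[of _ "u x"] exI[of _ "v y"] exI[of _ "f (P 0)"] exI[of _ "f (P 1)"] exI[of _ "f (P 2)"]) simp
  qed (use \<delta>u(1) \<delta>v(1) in \<open>auto simp: \<delta>_def\<close>)
  with ab have sum1: "(norm a)\<^sup>2 + (norm b)\<^sup>2 = 1" and prod0: "a * b = 0"
  proof -
    assume 1: "1 + 4 * (norm (a * b))\<^sup>2 \<le> (norm a)\<^sup>2 + (norm b)\<^sup>2"
    have "(norm (a * b))\<^sup>2 \<ge> 0" by simp
    with 1 ab show "(norm a)\<^sup>2 + (norm b)\<^sup>2 = 1" by linarith
    have "(norm (a * b))\<^sup>2 \<le> 0" using 1 ab by linarith
    then show "a * b = 0" by simp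
  qed
  have \<phi>: "\<phi> (x, y) = a * u x + b * v y" if "x \<in> \<Omega>" "y \<in> \<Omega>" for x y
    using equality[OF sum1, of "(x, y)"] f_eq[of "(x, y)"] that by (simp add: X_def U_def V_def)
  have unit: "norm t = 1" if "(norm t)\<^sup>2 = 1" for t :: complex
    using that norm_ge_zero[of t] unfolding power2_eq_1_iff by linarith
  show ?thesis
  proof (cases "b = 0")
    case True
    then have "norm a = 1" using sum1 by (intro unit) simp
    then show ?thesis using \<phi> True by auto
  next
    case False
    then have "a = 0" using prod0 by simp
    then have "norm b = 1" using sum1 by (intro unit) simp
    then show ?thesis using \<phi> \<open>a = 0\<close> by auto
  qed
qed

section \<open>Matrix-valued multipliers\<close>

context reproducing_kernel_space
begin

text \<open>Unlike in \<open>kernel_comb\<close> the points \<open>x i\<close> may coincide. This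
  permits sums indexed by pairs of a point and a row.\<close>

lemma ip_section_sum:
  assumes I: "finite I" "\<And>i. i \<in> I \<Longrightarrow> x i \<in> X"
  shows "(\<lambda>t. \<Sum>i\<in>I. b i * kernel_section X K (x i) t) \<in> H"
    and "f \<in> H \<Longrightarrow> ip f (\<lambda>t. \<Sum>i\<in>I. b i * kernel_section X K (x i) t) = (\<Sum>i\<in>I. cnj (b i) * f (x i))"
    and "complex_of_real ((pre.nrm (\<lambda>t. \<Sum>i\<in>I. b i * kernel_section X K (x i) t))\<^sup>2)
      = (\<Sum>i\<in>I. \<Sum>j\<in>I. cnj (b i) * K (x i) (x j) * b j)"
proof -
  let ?S = "\<lambda>t. \<Sum>i\<in>I. b i * kernel_section X K (x i) t"
  show mem: "?S \<in> H" using I section_mem by (intro pre.sum_mem) auto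
  show 1: "ip f ?S = (\<Sum>i\<in>I. cnj (b i) * f (x i))" if f: "f \<in> H" for f
  proof -
    have "ip f ?S = (\<Sum>i\<in>I. cnj (b i) * ip f (kernel_section X K (x i)))"
      using I section_mem f by (intro pre.ip_sum_right) auto
    then show ?thesis using reproducing[OF f] I(2) by simp
  qed
  have "complex_of_real ((pre.nrm ?S)\<^sup>2) = ip ?S ?S" by (rule pre.ip_self[OF mem, symmetric])
  also have "\<dots> = (\<Sum>i\<in>I. cnj (b i) * ?S (x i))" by (rule 1[OF mem])
  also have "\<dots> = (\<Sum>i\<in>I. \<Sum>j\<in>I. cnj (b i) * K (x i) (x j) * b j)"
    using I(2) by (intro sum.cong refl) (simp add: kernel_section_def sum_distrib_left mult_ac)
  finally show "complex_of_real ((pre.nrm ?S)\<^sup>2) = (\<Sum>i\<in>I. \<Sum>j\<in>I. cnj (b i) * K (x i) (x j) * b j)" .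
qed

text \<open>Positivity says that the formal adjoint, defined on tuples of kernel combinations, does
  not increase norms. Pairing g with a tuple equals pairing f with its image under the adjoint,
  which Cauchy-Schwarz bounds by the norm of f. Duality then gives membership of every
  \<open>g p\<close> and the joint norm bound.\<close>

lemma matrix_kernel_imp_multiplier:
  fixes m n :: nat and \<Phi> :: "'a \<Rightarrow> nat \<Rightarrow> nat \<Rightarrow> complex"
  assumes pos: "\<And>F. finite F \<Longrightarrow> F \<subseteq> X \<Longrightarrow> pos_semidef (F \<times> {..<m}) (\<lambda>i j.
      ((if snd i = snd j then 1 else 0) - (\<Sum>r<n. \<Phi> (fst i) (snd i) r * cnj (\<Phi> (fst j) (snd j) r)))
        * K (fst i) (fst j))"
    and f: "\<And>r. r < n \<Longrightarrow> f r \<in> H"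
  defines "g \<equiv> \<lambda>p x. \<Sum>r<n. \<Phi> x p r * f r x"
  shows "(\<forall>p<m. g p \<in> H) \<and> sqrt (\<Sum>p<m. (pre.nrm (g p))\<^sup>2) \<le> sqrt (\<Sum>r<n. (pre.nrm (f r))\<^sup>2)"
proof -
  define C where "C = sqrt (\<Sum>r<n. (pre.nrm (f r))\<^sup>2)"
  have C: "C \<ge> 0" by (simp add: C_def sum_nonneg)
  have bound: "norm (\<Sum>p<m. \<Sum>x\<in>F. cnj (a p x) * g p x)
      \<le> C * sqrt (\<Sum>p<m. (pre.nrm (kernel_comb X K F (a p)))\<^sup>2)" if F: "finite F" "F \<subseteq> X" for F a
  proof -
    define I where "I = F \<times> {..<m}"
    define c where "c i = a (snd i) (fst i)" for i :: "'a \<times> nat"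
    define \<Psi> where "\<Psi> i = \<Phi> (fst i) (snd i)" for i :: "'a \<times> nat"
    define S where "S b = (\<lambda>t. \<Sum>i\<in>I. b i * kernel_section X K (fst i) t)" for b :: "'a \<times> nat \<Rightarrow> complex"
    have I: "finite I" "\<And>i. i \<in> I \<Longrightarrow> fst i \<in> X" using F by (auto simp: I_def)
    have S_mem: "S b \<in> H" for b
      unfolding S_def by (rule ip_section_sum(1)[OF I])
    have S_ip: "ip f' (S b) = (\<Sum>i\<in>I. cnj (b i) * f' (fst i))" if "f' \<in> H" for f' b
      unfolding S_def by (rule ip_section_sum(2)[OF I that])
    have S_nrm: "complex_of_real ((pre.nrm (S b))\<^sup>2) = (\<Sum>i\<in>I. \<Sum>j\<in>I. cnj (b i) * K (fst i) (fst j) * b j)" for b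
      unfolding S_def by (rule ip_section_sum(3)[OF I])
    have comb: "kernel_comb X K F (a p) = S (\<lambda>i. if snd i = p then c i else 0)" if "p < m" for p
    proof
      fix t
      have "S (\<lambda>i. if snd i = p then c i else 0) t
          = (\<Sum>x\<in>F. \<Sum>q<m. if q = p then a q x * kernel_section X K x t else 0)"
        unfolding S_def I_def c_def sum.cartesian_product' by (intro sum.cong refl) auto
      also have "\<dots> = kernel_comb X K F (a p) t" using that by (simp add: kernel_comb_def)
      finally show "kernel_comb X K F (a p) t = S (\<lambda>i. if snd i = p then c i else 0) t" by simp
    qed
    \<comment> \<open>On the left is the squared norm of the tuple minus that of its image under the
      formal adjoint; on the right is the quadratic form of the hypothesis at the vector
      \<open>c\<close>.\<close>
    have "complex_of_real ((\<Sum>p<m. (pre.nrm (kernel_comb X K F (a p)))\<^sup>2) - (\<Sum>r<n. (pre.nrm (S (\<lambda>i. c i * cnj (\<Psi> i r))))\<^sup>2))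
      = (\<Sum>i\<in>I. \<Sum>j\<in>I. cnj (c i) * (((if snd i = snd j then 1 else 0) - (\<Sum>r<n. \<Psi> i r * cnj (\<Psi> j r))) * K (fst i) (fst j)) * c j)"
    proof -
      have "complex_of_real (\<Sum>p<m. (pre.nrm (kernel_comb X K F (a p)))\<^sup>2)
          = (\<Sum>p<m. \<Sum>i\<in>I. \<Sum>j\<in>I. cnj (if snd i = p then c i else 0) * K (fst i) (fst j) * (if snd j = p then c j else 0))"
        unfolding of_real_sum
      proof (rule sum.cong[OF refl])
        fix p assume "p \<in> {..<m}"
        then show "complex_of_real ((pre.nrm (kernel_comb X K F (a p)))\<^sup>2)
          = (\<Sum>i\<in>I. \<Sum>j\<in>I. cnj (if snd i = p then c i else 0) * K (fst i) (fst j) * (if snd j = p then c j else 0))"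
          using S_nrm[of "\<lambda>i. if snd i = p then c i else 0"] comb[of p] by (simp only: lessThan_iff)
      qed
      also have "\<dots> = (\<Sum>i\<in>I. \<Sum>p<m. \<Sum>j\<in>I. cnj (if snd i = p then c i else 0) * K (fst i) (fst j) * (if snd j = p then c j else 0))"
        by (rule sum.swap)
      also have "\<dots> = (\<Sum>i\<in>I. \<Sum>j\<in>I. \<Sum>p<m. cnj (if snd i = p then c i else 0) * K (fst i) (fst j) * (if snd j = p then c j else 0))"
        by (rule sum.cong[OF refl]) (rule sum.swap)
      also have "\<dots> = (\<Sum>i\<in>I. \<Sum>j\<in>I. cnj (c i) * ((if snd i = snd j then 1 else 0) * K (fst i) (fst j)) * c j)"
      proof (intro sum.cong refl)
        fix i j assume "i \<in> I" "j \<in> I"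
        then have "snd i < m" by (auto simp: I_def)
        moreover have "(\<Sum>p<m. cnj (if snd i = p then c i else 0) * K (fst i) (fst j) * (if snd j = p then c j else 0))
          = (\<Sum>p<m. if p = snd i then cnj (c i) * ((if snd i = snd j then 1 else 0) * K (fst i) (fst j)) * c j else 0)"
          by (intro sum.cong refl) auto
        ultimately show "(\<Sum>p<m. cnj (if snd i = p then c i else 0) * K (fst i) (fst j) * (if snd j = p then c j else 0))
          = cnj (c i) * ((if snd i = snd j then 1 else 0) * K (fst i) (fst j)) * c j" by simp
      qed
      finally have 1: "complex_of_real (\<Sum>p<m. (pre.nrm (kernel_comb X K F (a p)))\<^sup>2)
        = (\<Sum>i\<in>I. \<Sum>j\<in>I. cnj (c i) * ((if snd i = snd j then 1 else 0) * K (fst i) (fst j)) * c j)" .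
      have "complex_of_real (\<Sum>r<n. (pre.nrm (S (\<lambda>i. c i * cnj (\<Psi> i r))))\<^sup>2)
          = (\<Sum>r<n. \<Sum>i\<in>I. \<Sum>j\<in>I. cnj (c i) * (\<Psi> i r * cnj (\<Psi> j r) * K (fst i) (fst j)) * c j)"
        unfolding of_real_sum S_nrm by (simp add: mult_ac)
      also have "\<dots> = (\<Sum>i\<in>I. \<Sum>r<n. \<Sum>j\<in>I. cnj (c i) * (\<Psi> i r * cnj (\<Psi> j r) * K (fst i) (fst j)) * c j)"
        by (rule sum.swap)
      also have "\<dots> = (\<Sum>i\<in>I. \<Sum>j\<in>I. \<Sum>r<n. cnj (c i) * (\<Psi> i r * cnj (\<Psi> j r) * K (fst i) (fst j)) * c j)"
        by (rule sum.cong[OF refl]) (rule sum.swap)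
      also have "\<dots> = (\<Sum>i\<in>I. \<Sum>j\<in>I. cnj (c i) * ((\<Sum>r<n. \<Psi> i r * cnj (\<Psi> j r)) * K (fst i) (fst j)) * c j)"
        by (simp only: sum_distrib_left sum_distrib_right)
      finally show ?thesis unfolding of_real_diff 1
        by (simp only: left_diff_distrib right_diff_distrib sum_subtractf)
    qed
    also have "\<dots> \<in> \<real>\<^sub>\<ge>\<^sub>0"
      using spec[OF pos[OF F, unfolded pos_semidef_def], of c] unfolding I_def \<Psi>_def .
    finally have le: "(\<Sum>r<n. (pre.nrm (S (\<lambda>i. c i * cnj (\<Psi> i r))))\<^sup>2) \<le> (\<Sum>p<m. (pre.nrm (kernel_comb X K F (a p)))\<^sup>2)"
      by (simp only: nonneg_Reals_of_real_iff)
    \<comment> \<open>The matrix \<Phi> is moved to the other side of the pairing, where it acts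
      conjugated on the coefficients.\<close>
    have "(\<Sum>p<m. \<Sum>x\<in>F. cnj (a p x) * g p x) = (\<Sum>x\<in>F. \<Sum>p<m. cnj (a p x) * g p x)"
      by (rule sum.swap)
    also have "\<dots> = (\<Sum>i\<in>I. cnj (c i) * (\<Sum>r<n. \<Psi> i r * f r (fst i)))"
      by (simp add: I_def c_def \<Psi>_def g_def sum.cartesian_product')
    also have "\<dots> = (\<Sum>i\<in>I. \<Sum>r<n. cnj (c i * cnj (\<Psi> i r)) * f r (fst i))"
      by (simp add: sum_distrib_left mult_ac)
    also have "\<dots> = (\<Sum>r<n. \<Sum>i\<in>I. cnj (c i * cnj (\<Psi> i r)) * f r (fst i))" by (rule sum.swap)
    also have "\<dots> = (\<Sum>r<n. ip (f r) (S (\<lambda>i. c i * cnj (\<Psi> i r))))"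
      using S_ip[OF f] by simp
    finally have "norm (\<Sum>p<m. \<Sum>x\<in>F. cnj (a p x) * g p x) \<le> (\<Sum>r<n. norm (ip (f r) (S (\<lambda>i. c i * cnj (\<Psi> i r)))))"
      by (simp only: norm_sum)
    also have "\<dots> \<le> (\<Sum>r<n. \<bar>pre.nrm (f r)\<bar> * \<bar>pre.nrm (S (\<lambda>i. c i * cnj (\<Psi> i r)))\<bar>)"
    proof (rule sum_mono)
      fix r assume "r \<in> {..<n}"
      then have "norm (ip (f r) (S (\<lambda>i. c i * cnj (\<Psi> i r)))) \<le> pre.nrm (f r) * pre.nrm (S (\<lambda>i. c i * cnj (\<Psi> i r)))"
        using f by (intro pre.Cauchy_Schwarz S_mem) auto
      also have "\<dots> \<le> \<bar>pre.nrm (f r)\<bar> * \<bar>pre.nrm (S (\<lambda>i. c i * cnj (\<Psi> i r)))\<bar>"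
        by (simp flip: abs_mult)
      finally show "norm (ip (f r) (S (\<lambda>i. c i * cnj (\<Psi> i r)))) \<le> \<bar>pre.nrm (f r)\<bar> * \<bar>pre.nrm (S (\<lambda>i. c i * cnj (\<Psi> i r)))\<bar>" .
    qed
    also have "\<dots> \<le> C * sqrt (\<Sum>r<n. (pre.nrm (S (\<lambda>i. c i * cnj (\<Psi> i r))))\<^sup>2)"
      unfolding C_def using L2_set_mult_ineq[of "\<lambda>r. pre.nrm (f r)" _ "{..<n}"] by (simp only: L2_set_def)
    also have "\<dots> \<le> C * sqrt (\<Sum>p<m. (pre.nrm (kernel_comb X K F (a p)))\<^sup>2)"
      using le C by (intro mult_left_mono) auto
    finally show ?thesis .
  qed
  have gH: "g p \<in> H" if p: "p < m" for p
  proof -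
    \<comment> \<open>The joint bound for a tuple whose only nonzero entry is in row p.\<close>
    have "norm (\<Sum>x\<in>F. cnj (a x) * g p x) \<le> C * pre.nrm (kernel_comb X K F a)"
      if F: "finite F" "F \<subseteq> X" for F a
    proof -
      have zero: "kernel_comb X K F (\<lambda>_. 0) = (\<lambda>_. 0)" by (simp add: kernel_comb_def)
      have 1: "(\<Sum>q<m. \<Sum>x\<in>F. cnj ((if q = p then a else (\<lambda>_. 0)) x) * g q x) = (\<Sum>x\<in>F. cnj (a x) * g p x)"
      proof -
        have "(\<Sum>q<m. \<Sum>x\<in>F. cnj ((if q = p then a else (\<lambda>_. 0)) x) * g q x)
            = (\<Sum>q<m. if q = p then (\<Sum>x\<in>F. cnj (a x) * g q x) else 0)"
          by (intro sum.cong refl) auto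
        then show ?thesis using p by simp
      qed
      have 2: "(\<Sum>q<m. (pre.nrm (kernel_comb X K F (if q = p then a else (\<lambda>_. 0))))\<^sup>2) = (pre.nrm (kernel_comb X K F a))\<^sup>2"
      proof -
        have "(\<Sum>q<m. (pre.nrm (kernel_comb X K F (if q = p then a else (\<lambda>_. 0))))\<^sup>2)
            = (\<Sum>q<m. if q = p then (pre.nrm (kernel_comb X K F a))\<^sup>2 else 0)"
          by (intro sum.cong refl) (auto simp: zero pre.nrm_zero)
        then show ?thesis using p by simp
      qed
      show ?thesis using bound[OF F, of "\<lambda>q. if q = p then a else (\<lambda>_. 0)"] pre.nrm_nonneg[OF pre.comb_mem[OF F, of a]]
        unfolding 1 2 by simp
    qed
    moreover have "g p x = 0" if "x \<notin> X" for x
      unfolding g_def using vanish[OF f that] by simp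
    ultimately show ?thesis using bounded_antilinear_imp_mem[of "g p" C] by blast
  qed
  have "sqrt (\<Sum>p<m. (pre.nrm (g p))\<^sup>2) \<le> C"
  proof (rule nrm_tuple_le)
    fix h assume h: "\<And>p. p \<in> {..<m} \<Longrightarrow> h p \<in> kernel_span X K"
    then have "\<forall>p\<in>{..<m}. \<exists>F a. finite F \<and> F \<subseteq> X \<and> h p = kernel_comb X K F a"
      unfolding kernel_span_def by blast
    then obtain F a where Fa: "\<And>p. p < m \<Longrightarrow> finite (F p)" "\<And>p. p < m \<Longrightarrow> F p \<subseteq> X"
      "\<And>p. p < m \<Longrightarrow> h p = kernel_comb X K (F p) (a p)"
      by (metis lessThan_iff)
    \<comment> \<open>The rows of the test tuple may have different supports, while
      \<open>bound\<close> works with a single node set; coefficients are extended by zero to the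
      union.\<close>
    define G where "G = (\<Union>p<m. F p)"
    have G: "finite G" "G \<subseteq> X" using Fa by (auto simp: G_def)
    define b where "b p y = (if y \<in> F p then a p y else 0)" for p y
    have hb: "h p = kernel_comb X K G (b p)" if "p < m" for p
      unfolding Fa(3)[OF that] b_def using that G(1) by (intro kernel_comb_extend) (auto simp: G_def)
    have "(\<Sum>p<m. ip (g p) (h p)) = (\<Sum>p<m. \<Sum>y\<in>G. cnj (b p y) * g p y)"
      by (intro sum.cong refl) (simp add: hb pre.ip_comb_right[OF G gH])
    moreover have "(\<Sum>p<m. (pre.nrm (h p))\<^sup>2) = (\<Sum>p<m. (pre.nrm (kernel_comb X K G (b p)))\<^sup>2)"
      by (intro sum.cong refl) (simp add: hb)
    ultimately show "norm (\<Sum>p<m. ip (g p) (h p)) \<le> C * sqrt (\<Sum>p<m. (pre.nrm (h p))\<^sup>2)"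
      using bound[OF G, of b] by simp
  qed (use C gH in auto)
  then show ?thesis using gH by (simp add: C_def)
qed

end

lemma contractive_matrix_multipliersI:
  assumes K: "kernel_on X K"
    and pos: "\<And>F. finite F \<Longrightarrow> F \<subseteq> X \<Longrightarrow> pos_semidef (F \<times> {..<m}) (\<lambda>i j.
      ((if snd i = snd j then 1 else 0) - (\<Sum>r<n. \<Phi> (fst i) (snd i) r * cnj (\<Phi> (fst j) (snd j) r)))
        * K (fst i) (fst j))"
  shows "\<Phi> \<in> contractive_matrix_multipliers m n X K"
proof -
  interpret reproducing_kernel_space X "rkhs_space X K" "snd (rkhs X K)" K
    by (rule Moore_Aronszajn[OF K])
  show ?thesis
    unfolding contractive_matrix_multipliers_def mem_Collect_eq
  proof (intro allI impI)
    fix f assume "\<forall>j<n. f j \<in> rkhs_space X K"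
    then have f: "\<And>r. r < n \<Longrightarrow> f r \<in> rkhs_space X K" by blast
    show "(\<forall>i<m. (\<lambda>x. \<Sum>j<n. \<Phi> x i j * f j x) \<in> rkhs_space X K) \<and>
        sqrt (\<Sum>i<m. (rkhs_norm X K (\<lambda>x. \<Sum>j<n. \<Phi> x i j * f j x))\<^sup>2) \<le> sqrt (\<Sum>j<n. (rkhs_norm X K (f j))\<^sup>2)"
      using matrix_kernel_imp_multiplier[where m=m and n=n and \<Phi>=\<Phi> and f=f, OF pos f]
      by (simp add: rkhs_norm_def ip_norm_def)
  qed
qed

section \<open>Finite-dimensional linear algebra\<close>

text \<open>Cholesky factorisation by pivoting on the new index: a zero pivot forces its row to
  vanish, and a positive one is split off as a rank-one matrix, leaving a Schur complement to which
  the induction hypothesis applies.\<close>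

lemma pos_semidef_gram:
  assumes "finite I" "pos_semidef I A"
  shows "\<exists>(N::nat) G. \<forall>i\<in>I. \<forall>j\<in>I. A i j = (\<Sum>l<N. G i l * cnj (G j l))"
  using assms
proof (induction I arbitrary: A rule: finite_induct)
  case (insert k I)
  let ?J = "insert k I"
  have fin: "finite ?J" using insert.hyps by simp
  have herm: "A j i = cnj (A i j)" if "i \<in> ?J" "j \<in> ?J" for i j
    using pos_semidef_hermitian[OF fin insert.prems that] .
  have kk: "A k k \<in> \<real>\<^sub>\<ge>\<^sub>0" by (rule pos_semidef_diag[OF fin insert.prems]) simp
  then obtain d where d: "A k k = of_real d" "d \<ge> 0"
    by (metis nonneg_Reals_cases)
  show ?case
  proof (cases "d = 0")
    case True
    have zero: "A k i = 0" if i: "i \<in> I" for i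
    proof -
      have ki: "k \<noteq> i" using insert.hyps i by auto
      have psd: "pos_semidef {k, i} A" using i by (intro pos_semidef_subset[OF fin _ insert.prems]) auto
      \<comment> \<open>Test vector 1 at k and s at i; the zero pivot removes the constant
        term.\<close>
      have "0 \<le> 2 * Re (s * A k i) + (norm s)\<^sup>2 * Re (A i i)" for s
      proof -
        have "0 \<le> Re (s * A k i + cnj s * A i k + cnj s * s * A i i)"
          using spec[OF psd[unfolded pos_semidef_def], of "(\<lambda>_. s)(k := 1)"] ki True
          by (simp add: d complex_nonneg_Reals_iff algebra_simps)
        moreover have "A i k = cnj (A k i)" using i by (intro herm) auto
        ultimately show ?thesis
          using pos_semidef_diag[OF fin insert.prems, of i] i unfolding cmod_power2
          by (simp add: complex_nonneg_Reals_iff algebra_simps power2_eq_square)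
      qed
      then show ?thesis
        by (rule linear_form_eq_zero)
          (use pos_semidef_diag[OF fin insert.prems, of i] i in \<open>simp add: complex_nonneg_Reals_iff\<close>)
    qed
    have "pos_semidef I A" by (intro pos_semidef_subset[OF fin _ insert.prems]) auto
    then obtain N :: nat and G where G: "\<And>i j. i \<in> I \<Longrightarrow> j \<in> I \<Longrightarrow> A i j = (\<Sum>l<N. G i l * cnj (G j l))"
      using insert.IH by blast
    define G' where "G' i l = (if i = k then 0 else G i l)" for i l
    have "A i j = (\<Sum>l<N. G' i l * cnj (G' j l))" if "i \<in> ?J" "j \<in> ?J" for i j
    proof -
      have "A i k = 0" if "i \<in> ?J" using herm[of k i] that zero[of i] d True by auto
      then show ?thesis using that G[of i j] zero[of j] d True insert.hyps(2) by (auto simp: G'_def intro!: sum.cong)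
    qed
    then show ?thesis by blast
  next
    case False
    then have dpos: "d > 0" using d by simp
    define B where "B i j = A i j - A i k * A k j / of_real d" for i j
    have "pos_semidef I B"
      unfolding pos_semidef_def
    proof
      fix a
      define s where "s = (\<Sum>j\<in>I. A k j * a j)"
      \<comment> \<open>The value at the pivot minimises the form over that coordinate, and the
        minimum is the form of the Schur complement at a.\<close>
      define b where "b = a(k := - s / of_real d)"
      have bI: "b i = a i" if "i \<in> I" for i using that insert.hyps by (auto simp: b_def)
      have cs: "cnj s = (\<Sum>i\<in>I. cnj (a i) * A i k)"
        unfolding s_def cnj_sum
      proof (rule sum.cong[OF refl])
        fix i assume "i \<in> I"
        then have "A i k = cnj (A k i)" by (intro herm) auto
        then show "cnj (A k i * a i) = cnj (a i) * A i k" by simp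
      qed
      have "(\<Sum>i\<in>?J. \<Sum>j\<in>?J. cnj (b i) * A i j * b j)
          = cnj (b k) * A k k * b k + cnj (b k) * s + cnj s * b k + (\<Sum>i\<in>I. \<Sum>j\<in>I. cnj (a i) * A i j * a j)"
        using insert.hyps unfolding cs unfolding s_def
        by (simp add: bI sum.distrib sum_distrib_left sum_distrib_right mult.assoc cong: sum.cong)
      also have "\<dots> = (\<Sum>i\<in>I. \<Sum>j\<in>I. cnj (a i) * A i j * a j) - cnj s * s / of_real d"
        using dpos by (simp add: b_def d field_simps)
      also have "\<dots> = (\<Sum>i\<in>I. \<Sum>j\<in>I. cnj (a i) * B i j * a j)"
        unfolding B_def cs unfolding s_def
        by (simp add: sum_product right_diff_distrib left_diff_distrib sum_subtractf sum_divide_distrib mult.assoc)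
      finally show "(\<Sum>i\<in>I. \<Sum>j\<in>I. cnj (a i) * B i j * a j) \<in> \<real>\<^sub>\<ge>\<^sub>0"
        using spec[OF insert.prems[unfolded pos_semidef_def], of b] by simp
    qed
    then obtain N :: nat and G where G: "\<And>i j. i \<in> I \<Longrightarrow> j \<in> I \<Longrightarrow> B i j = (\<Sum>l<N. G i l * cnj (G j l))"
      using insert.IH by blast
    \<comment> \<open>Coordinate \<open>N\<close> carries the pivot column divided by sqrt d. It
      restores the rank-one matrix subtracted in \<open>B\<close> and alone accounts for the row and
      column of k.\<close>
    define G' where "G' i l = (if l < N then (if i = k then 0 else G i l) else A i k / of_real (sqrt d))" for i l
    have "A i j = (\<Sum>l<Suc N. G' i l * cnj (G' j l))" if ij: "i \<in> ?J" "j \<in> ?J" for i j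
    proof -
      have sd: "complex_of_real (sqrt d) * complex_of_real (sqrt d) = of_real d"
        using dpos by (simp flip: of_real_mult)
      have "(\<Sum>l<Suc N. G' i l * cnj (G' j l))
          = (if i = k \<or> j = k then 0 else (\<Sum>l<N. G i l * cnj (G j l))) + A i k * A k j / of_real d"
        using herm[OF ij(2), of k] sd by (simp add: G'_def)
      also have "\<dots> = A i j"
        using ij G[of i j] d dpos by (auto simp: B_def diff_eq_eq)
      finally show ?thesis by simp
    qed
    then show ?thesis by blast
  qed
qed simp

section \<open>Inner products on finite index sets and linear contractions\<close>

definition cdot :: "'j set \<Rightarrow> ('j \<Rightarrow> complex) \<Rightarrow> ('j \<Rightarrow> complex) \<Rightarrow> complex" where
  "cdot J x y = (\<Sum>a\<in>J. x a * cnj (y a))"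

text \<open>Vectors are total functions of which only the coordinates in \<open>J\<close> count, so
  this is a squared seminorm on all functions. Disjoint unions of index sets then serve as direct
  sums.\<close>

definition sqn :: "'j set \<Rightarrow> ('j \<Rightarrow> complex) \<Rightarrow> real" where
  "sqn J x = (\<Sum>a\<in>J. (norm (x a))\<^sup>2)"

lemma cdot_self: "cdot J x x = of_real (sqn J x)"
  unfolding cdot_def sqn_def of_real_sum complex_norm_square ..

lemma cdot_diff_left: "cdot J (\<lambda>a. x a - y a) z = cdot J x z - cdot J y z"
  by (simp add: cdot_def left_diff_distrib sum_subtractf)

lemma cdot_diff_right: "cdot J z (\<lambda>a. x a - y a) = cdot J z x - cdot J z y"
  by (simp add: cdot_def right_diff_distrib sum_subtractf)

lemma cdot_add_left: "cdot J (\<lambda>a. x a + y a) z = cdot J x z + cdot J y z"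
  by (simp add: cdot_def distrib_right sum.distrib)

lemma cdot_add_right: "cdot J z (\<lambda>a. x a + y a) = cdot J z x + cdot J z y"
  by (simp add: cdot_def distrib_left sum.distrib)

lemma cdot_scale_left: "cdot J (\<lambda>a. c * x a) z = c * cdot J x z"
  by (simp add: cdot_def sum_distrib_left mult.assoc)

lemma cdot_scale_right: "cdot J z (\<lambda>a. c * x a) = cnj c * cdot J z x"
  by (simp add: cdot_def sum_distrib_left mult_ac)

lemmas cdot_simps = cdot_diff_left cdot_diff_right cdot_add_left cdot_add_right cdot_scale_left cdot_scale_right

lemma cdot_cnj: "cnj (cdot J x y) = cdot J y x"
  by (simp add: cdot_def cnj_sum mult.commute)

lemma cdot_cong:
  "\<lbrakk>\<And>a. a \<in> J \<Longrightarrow> x a = x' a; \<And>a. a \<in> J \<Longrightarrow> y a = y' a\<rbrakk> \<Longrightarrow> cdot J x y = cdot J x' y'"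
  by (simp add: cdot_def)

lemma sqn_nonneg: "sqn J x \<ge> 0"
  by (simp add: sqn_def sum_nonneg)

lemma sqn_eq_0_iff: "finite J \<Longrightarrow> sqn J x = 0 \<longleftrightarrow> (\<forall>a\<in>J. x a = 0)"
  by (simp add: sqn_def sum_nonneg_eq_0_iff)

lemma sqn_scale: "sqn J (\<lambda>a. c * x a) = (norm c)\<^sup>2 * sqn J x"
  by (simp add: sqn_def norm_mult power_mult_distrib sum_distrib_left)

lemma sqn_cong: "(\<And>a. a \<in> J \<Longrightarrow> x a = x' a) \<Longrightarrow> sqn J x = sqn J x'"
  by (simp add: sqn_def)

lemma sqn_residual:
  assumes d: "sqn J k = d" "d > 0"
  shows "sqn J (\<lambda>a. x a - cdot J x k / of_real d * k a) = sqn J x - (norm (cdot J x k))\<^sup>2 / d"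
    and "cdot J (\<lambda>a. x a - cdot J x k / of_real d * k a) k = 0"
proof -
  have kk: "cdot J k k = of_real d" using d by (simp add: cdot_self)
  show 1: "cdot J (\<lambda>a. x a - cdot J x k / of_real d * k a) k = 0"
    unfolding cdot_diff_left cdot_scale_left kk using d by simp
  let ?y = "\<lambda>a. x a - cdot J x k / of_real d * k a"
  have "complex_of_real (sqn J ?y) = cdot J ?y x - cnj (cdot J x k / of_real d) * cdot J ?y k"
    by (simp only: cdot_self[symmetric] cdot_diff_right cdot_scale_right)
  also have "\<dots> = cdot J x x - cdot J x k * cnj (cdot J x k) / of_real d"
    unfolding 1 unfolding cdot_diff_left cdot_scale_left cdot_cnj by simp
  also have "\<dots> = of_real (sqn J x - (norm (cdot J x k))\<^sup>2 / d)"
    unfolding cdot_self of_real_diff of_real_divide complex_norm_square ..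
  finally show "sqn J ?y = sqn J x - (norm (cdot J x k))\<^sup>2 / d"
    by (simp only: of_real_eq_iff)
qed

lemma sqn_add_orthogonal:
  assumes "cdot J y k = 0"
  shows "sqn J (\<lambda>a. y a + c * k a) = sqn J y + (norm c)\<^sup>2 * sqn J k"
proof -
  have "cdot J k y = 0" using assms cdot_cnj[of J y k] by simp
  then have "complex_of_real (sqn J (\<lambda>a. y a + c * k a)) = cdot J y y + c * cnj c * cdot J k k"
    unfolding cdot_self[symmetric] using assms by (simp add: cdot_simps algebra_simps)
  also have "\<dots> = of_real (sqn J y + (norm c)\<^sup>2 * sqn J k)"
    unfolding cdot_self of_real_add of_real_mult complex_norm_square ..
  finally show ?thesis by (simp only: of_real_eq_iff)
qed

text \<open>Linearity is demanded on total functions, while norms see only \<open>J\<close> and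
  \<open>J'\<close>. For finite \<open>J'\<close> the bound makes the part of \<open>T x\<close> on
  \<open>J'\<close> depend only on the part of x on \<open>J\<close>.\<close>

definition linear_contraction :: "'a set \<Rightarrow> 'b set \<Rightarrow> (('a \<Rightarrow> complex) \<Rightarrow> 'b \<Rightarrow> complex) \<Rightarrow> bool" where
  "linear_contraction J J' T \<longleftrightarrow> (\<forall>x y. T (\<lambda>a. x a + y a) = (\<lambda>b. T x b + T y b)) \<and>
     (\<forall>c x. T (\<lambda>a. c * x a) = (\<lambda>b. c * T x b)) \<and> (\<forall>x. sqn J' (T x) \<le> sqn J x)"

lemma linear_contraction_add: "linear_contraction J J' T \<Longrightarrow> T (\<lambda>a. x a + y a) = (\<lambda>b. T x b + T y b)"
  by (simp add: linear_contraction_def)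

lemma linear_contraction_scale: "linear_contraction J J' T \<Longrightarrow> T (\<lambda>a. c * x a) = (\<lambda>b. c * T x b)"
  by (simp add: linear_contraction_def)

lemma linear_contraction_sqn: "linear_contraction J J' T \<Longrightarrow> sqn J' (T x) \<le> sqn J x"
  by (simp add: linear_contraction_def)

lemma linear_contraction_diff:
  assumes "linear_contraction J J' T"
  shows "T (\<lambda>a. x a - y a) = (\<lambda>b. T x b - T y b)"
  using linear_contraction_add[OF assms, of x "\<lambda>a. (-1) * y a"] linear_contraction_scale[OF assms, of "-1" y]
  by simp

lemma linear_contraction_zero: "linear_contraction J J' T \<Longrightarrow> T (\<lambda>_. 0) = (\<lambda>_. 0)"
  using linear_contraction_scale[of J J' T 0 "\<lambda>_. 0"] by simp

lemma linear_contraction_sum: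
  assumes "linear_contraction J J' T" "finite I"
  shows "T (\<lambda>a. \<Sum>i\<in>I. c i * x i a) = (\<lambda>b. \<Sum>i\<in>I. c i * T (x i) b)"
  using assms(2)
  by (induction I rule: finite_induct)
    (simp_all add: linear_contraction_zero[OF assms(1)] linear_contraction_add[OF assms(1)]
      linear_contraction_scale[OF assms(1)])

lemma linear_contraction_cong:
  assumes T: "linear_contraction J J' T" and "finite J'" and xy: "\<And>a. a \<in> J \<Longrightarrow> x a = y a"
    and b: "b \<in> J'"
  shows "T x b = T y b"
proof -
  have "sqn J (\<lambda>a. x a - y a) = 0" unfolding sqn_def using xy by simp
  then have "sqn J' (T (\<lambda>a. x a - y a)) = 0"
    using linear_contraction_sqn[OF T] sqn_nonneg by (metis order_antisym)
  then show ?thesis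
    using b \<open>finite J'\<close> unfolding sqn_eq_0_iff[OF \<open>finite J'\<close>] linear_contraction_diff[OF T] by simp
qed

text \<open>The pivot vector is split off from both families as in Gram-Schmidt; the part of the map
  constructed for the residual vectors is compressed to the complement of the pivot.\<close>

lemma lurking_contraction:
  assumes I: "finite I" and J: "finite J" "finite J'"
    and gram: "\<And>i j. i \<in> I \<Longrightarrow> j \<in> I \<Longrightarrow> cdot J (L i) (L j) = cdot J' (R i) (R j)"
  shows "\<exists>T. linear_contraction J J' T \<and> (\<forall>i\<in>I. \<forall>b\<in>J'. T (L i) b = R i b)"
  using I gram
proof (induction I arbitrary: L R rule: finite_induct)
  case empty
  have "linear_contraction J J' (\<lambda>_ _. 0)"
    using sqn_nonneg[of J] by (simp add: linear_contraction_def sqn_def[of J'])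
  then show ?case by blast
next
  case (insert k I)
  define d where "d = sqn J (L k)"
  have "complex_of_real (sqn J (L k)) = of_real (sqn J' (R k))"
    unfolding cdot_self[symmetric] by (rule insert.prems) simp_all
  then have d': "sqn J' (R k) = d" by (simp add: d_def)
  show ?case
  proof (cases "d = 0")
    case True
    obtain T where T: "linear_contraction J J' T" "\<And>i b. i \<in> I \<Longrightarrow> b \<in> J' \<Longrightarrow> T (L i) b = R i b"
      using insert.IH[of L R] insert.prems by blast
    \<comment> \<open>A pivot of norm zero costs nothing: the contraction obtained for the other
      indices sends it to a vector vanishing on \<open>J'\<close>, as \<open>R k\<close>
      does.\<close>
    have "sqn J' (T (L k)) = 0"
      using linear_contraction_sqn[OF T(1), of "L k"] sqn_nonneg[of J' "T (L k)"] True by (simp add: d_def)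
    then have "T (L k) b = R k b" if "b \<in> J'" for b
      using that d' True J by (simp add: sqn_eq_0_iff)
    then show ?thesis using T by blast
  next
    case False
    then have d: "d > 0" using sqn_nonneg[of J "L k"] by (simp add: d_def)
    have dL: "sqn J (L k) = d" by (simp add: d_def)
    have LL: "cdot J (L k) (L k) = of_real d" and RR: "cdot J' (R k) (R k) = of_real d"
      unfolding cdot_self dL d' by simp_all
    define c where "c i = cdot J (L i) (L k) / of_real d" for i
    have cR: "cdot J' (R i) (R k) / of_real d = c i" if "i \<in> insert k I" for i
      using insert.prems[of i k] that by (simp add: c_def)
    define L' R' where "L' i = (\<lambda>a. L i a - c i * L k a)" and "R' i = (\<lambda>b. R i b - c i * R k b)" for i
    have "cdot J (L' i) (L' j) = cdot J' (R' i) (R' j)" if ij: "i \<in> I" "j \<in> I" for i j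
    proof -
      have "cdot J (L i) (L j) = cdot J' (R i) (R j)" "cdot J (L i) (L k) = cdot J' (R i) (R k)"
        "cdot J (L k) (L j) = cdot J' (R k) (R j)"
        using ij by (auto intro: insert.prems)
      then show ?thesis unfolding L'_def R'_def by (simp only: cdot_simps LL RR)
    qed
    then obtain T where T: "linear_contraction J J' T" "\<And>i b. i \<in> I \<Longrightarrow> b \<in> J' \<Longrightarrow> T (L' i) b = R' i b"
      using insert.IH[of L' R'] by blast
    define p where "p x = cdot J x (L k) / of_real d" for x
    define y where "y x = T (\<lambda>a. x a - p x * L k a)" for x
    \<comment> \<open>On a general residual vector \<open>T\<close> may have a component along
      \<open>R k\<close>. Removing it gives the orthogonality behind the norm estimate and changes
      nothing on the data, since each \<open>R' i\<close> is already orthogonal to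
      \<open>R k\<close>.\<close>
    define q where "q x = cdot J' (y x) (R k) / of_real d" for x
    define S where "S x = (\<lambda>b. (y x b - q x * R k b) + p x * R k b)" for x
    have p_add: "p (\<lambda>a. x a + x' a) = p x + p x'" for x x'
      by (simp add: p_def cdot_simps add_divide_distrib)
    have p_scale: "p (\<lambda>a. t * x a) = t * p x" for t x by (simp add: p_def cdot_simps)
    have y_add: "y (\<lambda>a. x a + x' a) = (\<lambda>b. y x b + y x' b)" for x x'
      unfolding y_def p_add linear_contraction_add[OF T(1), symmetric] by (simp add: algebra_simps)
    have y_scale: "y (\<lambda>a. t * x a) = (\<lambda>b. t * y x b)" for t x
      unfolding y_def p_scale linear_contraction_scale[OF T(1), symmetric] by (simp add: algebra_simps)
    have q_add: "q (\<lambda>a. x a + x' a) = q x + q x'" for x x'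
      by (simp add: q_def y_add cdot_simps add_divide_distrib)
    have q_scale: "q (\<lambda>a. t * x a) = t * q x" for t x by (simp add: q_def y_scale cdot_simps)
    have "linear_contraction J J' S"
      unfolding linear_contraction_def
    proof (intro conjI allI)
      show "S (\<lambda>a. x a + x' a) = (\<lambda>b. S x b + S x' b)" for x x'
        by (simp add: S_def p_add y_add q_add algebra_simps)
      show "S (\<lambda>a. t * x a) = (\<lambda>b. t * S x b)" for t x
        by (simp add: S_def p_scale y_scale q_scale algebra_simps)
      show "sqn J' (S x) \<le> sqn J x" for x
      proof -
        have "sqn J' (S x) = sqn J' (\<lambda>b. y x b - q x * R k b) + (norm (p x))\<^sup>2 * d"
          unfolding S_def q_def using sqn_add_orthogonal[OF sqn_residual(2)[OF d' d]] d' by simp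
        also have "sqn J' (\<lambda>b. y x b - q x * R k b) \<le> sqn J' (y x)"
          unfolding q_def sqn_residual(1)[OF d' d] using d by simp
        also have "sqn J' (y x) \<le> sqn J (\<lambda>a. x a - p x * L k a)"
          unfolding y_def by (rule linear_contraction_sqn[OF T(1)])
        also have "\<dots> = sqn J x - (norm (p x))\<^sup>2 * d"
          unfolding p_def sqn_residual(1)[OF dL d] using d by (simp add: norm_divide power2_eq_square)
        finally show ?thesis by simp
      qed
    qed
    moreover have "S (L i) b = R i b" if i: "i \<in> insert k I" and b: "b \<in> J'" for i b
    proof (cases "i = k")
      case True
      have p: "p (L k) = 1" using d by (simp add: p_def LL)
      have "y (L k) = (\<lambda>_. 0)" unfolding y_def p using linear_contraction_zero[OF T(1)] by simp
      then show ?thesis using True p by (simp add: S_def q_def cdot_def)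
    next
      case False
      then have iI: "i \<in> I" using i by simp
      have p: "p (L i) = c i" by (simp add: p_def c_def)
      have yb: "y (L i) b = R' i b" if "b \<in> J'" for b
        unfolding y_def p using T(2)[OF iI that] by (simp add: L'_def)
      have "cdot J' (y (L i)) (R k) = cdot J' (R' i) (R k)" using yb by (intro cdot_cong) auto
      also have "\<dots> = 0" unfolding R'_def cR[OF i, symmetric] by (rule sqn_residual(2)[OF d' d])
      finally show ?thesis using yb[OF b] by (simp add: S_def q_def p R'_def)
    qed
    ultimately show ?thesis by blast
  qed
qed

text \<open>The solution is the Neumann series with terms \<open>z ^ k * (D ^^ k) c\<close>;
  iterates of a contraction stay bounded, so it converges geometrically in each coordinate.\<close>

lemma linear_contraction_resolvent:
  assumes D: "linear_contraction {..<N::nat} {..<N} D" and z: "norm z < 1"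
  shows "\<exists>g. \<forall>l<N. g l = c l + z * D g l"
proof -
  define h where "h k = (D ^^ k) c" for k
  have h_Suc: "h (Suc k) = D (h k)" for k by (simp add: h_def)
  \<comment> \<open>On coordinates below \<open>N\<close> the map is a finite matrix, which
    justifies exchanging it with the infinite sum.\<close>
  have D_matrix: "D s l = (\<Sum>j<N. s j * D (\<lambda>i. if i = j then 1 else 0) l)" if "l < N" for s l
  proof -
    have "(\<Sum>j<N. s j * (if i = j then 1 else 0)) = s i" if "i < N" for i
    proof -
      have "(\<Sum>j<N. s j * (if i = j then 1 else 0)) = (\<Sum>j<N. if j = i then s j else 0)"
        by (intro sum.cong refl) simp
      then show ?thesis using that by simp
    qed
    then have "D s l = D (\<lambda>i. \<Sum>j<N. s j * (if i = j then 1 else 0)) l"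
      by (intro linear_contraction_cong[OF D]) (use \<open>l < N\<close> in simp_all)
    then show ?thesis unfolding linear_contraction_sum[OF D finite_lessThan] by simp
  qed
  have sqn_h: "sqn {..<N} (h k) \<le> sqn {..<N} c" for k
  proof (induction k)
    case (Suc k)
    then show ?case unfolding h_Suc using linear_contraction_sqn[OF D, of "h k"] by linarith
  qed (simp add: h_def)
  have h_bound: "norm (h k l) \<le> sqrt (sqn {..<N} c)" if "l < N" for k l
  proof -
    have "(norm (h k l))\<^sup>2 \<le> sqn {..<N} (h k)"
      unfolding sqn_def using that by (intro member_le_sum) auto
    then show ?thesis using sqn_h[of k] by (intro real_le_rsqrt) simp
  qed
  have summ: "summable (\<lambda>k. z ^ k * h k l)" if "l < N" for l
  proof (rule summable_comparison_test')
    show "summable (\<lambda>k. norm z ^ k * sqrt (sqn {..<N} c))"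
      using z by (intro summable_mult2 summable_geometric) simp
    show "norm (z ^ k * h k l) \<le> norm z ^ k * sqrt (sqn {..<N} c)" if "k \<ge> 0" for k
      using h_bound[OF \<open>l < N\<close>] by (simp add: norm_mult norm_power mult_left_mono)
  qed
  define g where "g l = (\<Sum>k. z ^ k * h k l)" for l
  have "g l = c l + z * D g l" if l: "l < N" for l
  proof -
    have "D g l = (\<Sum>j<N. \<Sum>k. z ^ k * h k j * D (\<lambda>i. if i = j then 1 else 0) l)"
      unfolding D_matrix[OF l, of g] g_def by (intro sum.cong refl suminf_mult2 summ) simp
    also have "\<dots> = (\<Sum>k. \<Sum>j<N. z ^ k * h k j * D (\<lambda>i. if i = j then 1 else 0) l)"
      by (intro suminf_sum[symmetric] summable_mult2 summ) simp
    also have "\<dots> = (\<Sum>k. z ^ k * h (Suc k) l)"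
      unfolding h_Suc D_matrix[OF l, of "h _"] by (simp add: sum_distrib_left mult.assoc)
    finally have "z * D g l = (\<Sum>k. z ^ Suc k * h (Suc k) l)"
    proof -
      assume eq: "D g l = (\<Sum>k. z ^ k * h (Suc k) l)"
      have "summable (\<lambda>k. z ^ k * h (Suc k) l)"
      proof (rule summable_comparison_test')
        show "summable (\<lambda>k. norm z ^ k * sqrt (sqn {..<N} c))"
          using z by (intro summable_mult2 summable_geometric) simp
        show "norm (z ^ k * h (Suc k) l) \<le> norm z ^ k * sqrt (sqn {..<N} c)" if "k \<ge> 0" for k
          using h_bound[OF l] by (simp add: norm_mult norm_power mult_left_mono)
      qed
      then show ?thesis unfolding eq by (simp add: suminf_mult[symmetric] mult.assoc)
    qed
    then show ?thesis using suminf_split_head[OF summ[OF l]] by (simp add: g_def h_def[of 0])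
  qed
  then show ?thesis by blast
qed

section \<open>Nevanlinna-Pick interpolation for the disc kernel\<close>

lemma cdot_Plus:
  "\<lbrakk>finite A; finite B\<rbrakk> \<Longrightarrow> cdot (A <+> B) x y = cdot A (\<lambda>a. x (Inl a)) (\<lambda>a. y (Inl a)) + cdot B (\<lambda>b. x (Inr b)) (\<lambda>b. y (Inr b))"
  by (simp add: cdot_def sum.Plus)

lemma sqn_Plus:
  "\<lbrakk>finite A; finite B\<rbrakk> \<Longrightarrow> sqn (A <+> B) x = sqn A (\<lambda>a. x (Inl a)) + sqn B (\<lambda>b. x (Inr b))"
  by (simp add: sqn_def sum.Plus)

lemma sqn_case_sum_zero:
  "\<lbrakk>finite A; finite B\<rbrakk> \<Longrightarrow> sqn (A <+> B) (case_sum (\<lambda>_. 0) s) = sqn B s"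
  by (simp add: sqn_def sum.Plus)

lemma cdot_unit_unit:
  "\<lbrakk>p < m; q < m\<rbrakk> \<Longrightarrow> cdot {..<m::nat} (\<lambda>a. if a = p then 1 else 0) (\<lambda>a. if a = q then 1 else 0) = (if p = q then 1 else 0)"
proof -
  assume pq: "p < m" "q < m"
  have "cdot {..<m} (\<lambda>a. if a = p then 1 else 0) (\<lambda>a. if a = q then 1 else 0)
      = (\<Sum>a<m. if a = p then (if p = q then 1 else 0) else 0)"
    unfolding cdot_def by (intro sum.cong refl) auto
  then show ?thesis using pq by simp
qed

text \<open>The arguments \<open>h j\<close>, \<open>h i\<close> appear in reversed order because
  \<open>pos_semidef\<close> conjugates the coefficient of the first index, whereas
  \<open>cdot\<close> conjugates its second argument.\<close>

lemma sum_cdot: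
  "(\<Sum>i\<in>I. \<Sum>j\<in>I. cnj (a i) * cdot J (h j) (h i) * a j) = of_real (sqn J (\<lambda>b. \<Sum>i\<in>I. a i * h i b))"
proof -
  have "(\<Sum>i\<in>I. \<Sum>j\<in>I. cnj (a i) * cdot J (h j) (h i) * a j)
      = (\<Sum>i\<in>I. \<Sum>j\<in>I. \<Sum>b\<in>J. cnj (a i * h i b) * (a j * h j b))"
    by (simp add: cdot_def sum_distrib_left sum_distrib_right mult_ac)
  also have "\<dots> = (\<Sum>i\<in>I. \<Sum>b\<in>J. \<Sum>j\<in>I. cnj (a i * h i b) * (a j * h j b))"
    by (rule sum.cong[OF refl]) (rule sum.swap)
  also have "\<dots> = (\<Sum>b\<in>J. \<Sum>i\<in>I. \<Sum>j\<in>I. cnj (a i * h i b) * (a j * h j b))"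
    by (rule sum.swap)
  also have "\<dots> = (\<Sum>b\<in>J. (\<Sum>i\<in>I. cnj (a i * h i b)) * (\<Sum>j\<in>I. a j * h j b))"
    by (simp only: sum_product)
  also have "\<dots> = cdot J (\<lambda>b. \<Sum>i\<in>I. a i * h i b) (\<lambda>b. \<Sum>i\<in>I. a i * h i b)"
    unfolding cdot_def cnj_sum by (intro sum.cong refl mult.commute)
  finally show ?thesis by (simp only: cdot_self)
qed

text \<open>This is the matrix of the defect of T, the identity minus adjoint times T, on the
  vectors \<open>h i\<close>; it is positive since T is a linear contraction.\<close>

lemma pos_semidef_defect:
  assumes I: "finite I" and T: "linear_contraction J J' T"
  shows "pos_semidef I (\<lambda>i j. cdot J (h j) (h i) - cdot J' (T (h j)) (T (h i)))"
  unfolding pos_semidef_def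
proof
  fix a
  have "(\<Sum>i\<in>I. \<Sum>j\<in>I. cnj (a i) * (cdot J (h j) (h i) - cdot J' (T (h j)) (T (h i))) * a j)
      = of_real (sqn J (\<lambda>b. \<Sum>i\<in>I. a i * h i b)) - of_real (sqn J' (\<lambda>b. \<Sum>i\<in>I. a i * T (h i) b))"
    unfolding sum_cdot[symmetric] by (simp only: right_diff_distrib left_diff_distrib sum_subtractf)
  also have "\<dots> = of_real (sqn J (\<lambda>b. \<Sum>i\<in>I. a i * h i b) - sqn J' (T (\<lambda>b. \<Sum>i\<in>I. a i * h i b)))"
    unfolding linear_contraction_sum[OF T I] of_real_diff ..
  finally show "(\<Sum>i\<in>I. \<Sum>j\<in>I. cnj (a i) * (cdot J (h j) (h i) - cdot J' (T (h j)) (T (h i))) * a j) \<in> \<real>\<^sub>\<ge>\<^sub>0"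
    using linear_contraction_sqn[OF T] by (simp only: nonneg_Reals_of_real_iff diff_ge_0_iff_ge)
qed

text \<open>The rows of the interpolant are the first block of \<open>T (e, cnj z * g)\<close>, where the
  state \<open>g\<close> is the fixed point of the second block; \<open>T\<close> is the contraction obtained
  from the interpolation data by the lurking isometry argument.\<close>

theorem cnp_kernel_disc:
  assumes f: "\<And>x. x \<in> X \<Longrightarrow> norm (f x) < 1"
    and K: "\<And>x y. x \<in> X \<Longrightarrow> y \<in> X \<Longrightarrow> K x y = 1 / (1 - f x * cnj (f y))"
  shows "cnp_kernel X K"
proof -
  have kernel: "kernel_on X K"
    unfolding kernel_on_def
  proof (intro allI impI)
    fix F assume F: "finite F \<and> F \<subseteq> X"
    have "pos_semidef F (\<lambda>x y. 1 / (1 - f x * cnj (f y)))"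
      using F f by (intro pos_semidef_mult_szego pos_semidef_one) auto
    then show "pos_semidef F K"
      using F K by (subst pos_semidef_cong) (auto simp: subset_iff)
  qed
  have "\<exists>\<Phi>\<in>contractive_matrix_multipliers m n X K. \<forall>x\<in>F. \<forall>p<m. \<forall>r<n. \<Phi> x p r = W x p r"
    if F: "finite F" "F \<subseteq> X"
      and psd: "pos_semidef (F \<times> {..<m}) (\<lambda>(x, p) (y, q).
        ((if p = q then 1 else 0) - (\<Sum>r<n. W x p r * cnj (W y q r))) * K x y)"
    for m n :: nat and F W
  proof -
    define I where "I = F \<times> {..<m}"
    have I: "finite I" using F by (simp add: I_def)
    obtain N :: nat and G where G: "\<And>i j. i \<in> I \<Longrightarrow> j \<in> I \<Longrightarrow>
        (\<lambda>(x, p) (y, q). ((if p = q then 1 else 0) - (\<Sum>r<n. W x p r * cnj (W y q r))) * K x y) i j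
          = (\<Sum>l<N. G i l * cnj (G j l))"
      using pos_semidef_gram[OF I psd[folded I_def]] by blast
    define J J' where "J = {..<m} <+> {..<N}" and "J' = {..<n} <+> {..<N}"
    have J: "finite J" "finite J'" by (simp_all add: J_def J'_def)
    have J'_mem: "Inr l \<in> J' \<longleftrightarrow> l < N" "Inl r \<in> J' \<longleftrightarrow> r < n" for l r
      by (auto simp: J'_def)
    define e :: "nat \<Rightarrow> nat \<Rightarrow> complex" where "e p = (\<lambda>a. if a = p then 1 else 0)" for p
    \<comment> \<open>With \<Gamma> the factored Pick matrix, the data satisfy \<open>(if p = q then
      1 else 0) + f x * cnj (f y) * \<Gamma> = w + \<Gamma>\<close>. The two sides of this identity
      are the Gram matrices of \<open>L\<close> and of \<open>R\<close>.\<close>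
    define L where "L i = case_sum (e (snd i)) (\<lambda>l. cnj (f (fst i)) * cnj (G i l))" for i
    define R where "R i = case_sum (\<lambda>r. cnj (W (fst i) (snd i) r)) (\<lambda>l. cnj (G i l))" for i
    have "cdot J (L j) (L i) = cdot J' (R j) (R i)" if ij: "i \<in> I" "j \<in> I" for i j
    proof -
      obtain x p y q where xy: "i = (x, p)" "j = (y, q)" "x \<in> F" "p < m" "y \<in> F" "q < m"
        using ij by (auto simp: I_def)
      define \<Gamma> where "\<Gamma> = (\<Sum>l<N. G i l * cnj (G j l))"
      define w where "w = (\<Sum>r<n. W x p r * cnj (W y q r))"
      have "1 - f x * cnj (f y) \<noteq> 0"
        using xy F f by (intro one_minus_mult_cnj_nonzero) auto
      then have "(if p = q then 1 else 0) - w = (1 - f x * cnj (f y)) * \<Gamma>"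
        using G[OF ij] xy F K by (auto simp: \<Gamma>_def w_def field_simps subset_iff)
      moreover have "cdot J (L j) (L i) = (if p = q then 1 else 0) + f x * cnj (f y) * \<Gamma>"
      proof -
        have "cdot {..<m} (e q) (e p) = (if p = q then 1 else 0)"
          unfolding e_def using cdot_unit_unit[of q m p] xy by auto
        moreover have "cdot {..<N} (\<lambda>l. cnj (f y) * cnj (G j l)) (\<lambda>l. cnj (f x) * cnj (G i l)) = f x * cnj (f y) * \<Gamma>"
          by (simp add: cdot_def \<Gamma>_def sum_distrib_left mult_ac)
        ultimately show ?thesis by (simp add: J_def cdot_Plus L_def xy)
      qed
      moreover have "cdot J' (R j) (R i) = w + \<Gamma>"
        by (simp add: J'_def R_def xy cdot_def sum.Plus w_def \<Gamma>_def mult.commute)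
      ultimately show ?thesis by (simp add: algebra_simps)
    qed
    then obtain T where T: "linear_contraction J J' T" and TL: "\<And>i b. i \<in> I \<Longrightarrow> b \<in> J' \<Longrightarrow> T (L i) b = R i b"
      using lurking_contraction[OF I J, of L R] by blast
    \<comment> \<open>The state block of \<open>T\<close>: input and output are both restricted to
      the last N coordinates.\<close>
    define D where "D s = (\<lambda>l. T (case_sum (\<lambda>_. 0) s) (Inr l))" for s :: "nat \<Rightarrow> complex"
    have D: "linear_contraction {..<N} {..<N} D"
      unfolding linear_contraction_def
    proof (intro conjI allI)
      have "case_sum (\<lambda>_::nat. 0) (\<lambda>a. s a + t a) = (\<lambda>b. case_sum (\<lambda>_. 0) s b + case_sum (\<lambda>_. 0) t b)"
        for s t :: "nat \<Rightarrow> complex" by (auto split: sum.split)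
      then show "D (\<lambda>a. s a + t a) = (\<lambda>b. D s b + D t b)" for s t
        unfolding D_def by (simp add: linear_contraction_add[OF T])
      have "case_sum (\<lambda>_::nat. 0) (\<lambda>a. c * s a) = (\<lambda>b. c * case_sum (\<lambda>_. 0) s b)"
        for c and s :: "nat \<Rightarrow> complex" by (auto split: sum.split)
      then show "D (\<lambda>a. c * s a) = (\<lambda>b. c * D s b)" for c s
        unfolding D_def by (simp add: linear_contraction_scale[OF T])
      show "sqn {..<N} (D s) \<le> sqn {..<N} s" for s
      proof -
        have "sqn {..<N} (D s) \<le> sqn J' (T (case_sum (\<lambda>_. 0) s))"
          unfolding J'_def D_def by (simp add: sqn_Plus sqn_nonneg)
        also have "\<dots> \<le> sqn J (case_sum (\<lambda>_. 0) s)" by (rule linear_contraction_sqn[OF T])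
        also have "\<dots> = sqn {..<N} s" unfolding J_def by (rule sqn_case_sum_zero) simp_all
        finally show ?thesis .
      qed
    qed
    have split: "T (case_sum (e p) (\<lambda>l. z * s l)) (Inr l) = T (case_sum (e p) (\<lambda>_. 0)) (Inr l) + z * D s l" for p z s l
    proof -
      have "case_sum (e p) (\<lambda>l. z * s l) = (\<lambda>b. case_sum (e p) (\<lambda>_. 0) b + z * case_sum (\<lambda>_. 0) s b)"
        by (auto split: sum.split)
      then show ?thesis unfolding D_def by (simp add: linear_contraction_add[OF T] linear_contraction_scale[OF T])
    qed
    \<comment> \<open>The state equation is solved at every point of \<open>X\<close>, not just at
      the nodes; this extends the interpolant to the whole set.\<close>
    have "\<forall>x\<in>X. \<forall>p. \<exists>g. \<forall>l<N. g l = T (case_sum (e p) (\<lambda>l. cnj (f x) * g l)) (Inr l)"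
      unfolding split using f by (intro ballI allI linear_contraction_resolvent[OF D]) simp
    then obtain g where g: "\<And>x p l. x \<in> X \<Longrightarrow> l < N \<Longrightarrow>
        g x p l = T (case_sum (e p) (\<lambda>l. cnj (f x) * g x p l)) (Inr l)"
      by metis
    define h where "h i = case_sum (e (snd i)) (\<lambda>l. cnj (f (fst i)) * g (fst i) (snd i) l)" for i
    define \<Phi> where "\<Phi> x p r = cnj (T (h (x, p)) (Inl r))" for x p r
    have Th: "T (h i) (Inr l) = g (fst i) (snd i) l" if "fst i \<in> X" "l < N" for i l
      using g[OF that, of "snd i"] by (simp add: h_def)
    have "\<Phi> x p r = W x p r" if x: "x \<in> F" and p: "p < m" and r: "r < n" for x p r
    proof -
      let ?i = "(x, p)"
      have i: "?i \<in> I" and xX: "x \<in> X" using x p F by (auto simp: I_def)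
      \<comment> \<open>At a node the conjugated Gram factor also solves the state equation. The
        difference is a fixed point of \<open>D\<close> scaled by \<open>cnj (f x)\<close>, a strict
        contraction, hence zero below N.\<close>
      define t where "t l = g x p l - cnj (G ?i l)" for l
      have "t l = cnj (f x) * D t l" if l: "l < N" for l
      proof -
        have "cnj (G ?i l) = T (L ?i) (Inr l)" using TL[OF i, of "Inr l"] l by (simp add: J'_mem R_def)
        also have "\<dots> = T (case_sum (e p) (\<lambda>_. 0)) (Inr l) + cnj (f x) * D (\<lambda>l. cnj (G ?i l)) l"
          unfolding L_def fst_conv snd_conv by (rule split)
        finally have 1: "cnj (G ?i l) = \<dots>" .
        have "g x p l = T (case_sum (e p) (\<lambda>_. 0)) (Inr l) + cnj (f x) * D (g x p) l"
          using g[OF xX l, of p] unfolding split .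
        then show ?thesis unfolding t_def linear_contraction_diff[OF D] using 1 by (simp add: algebra_simps)
      qed
      then have "sqn {..<N} t = sqn {..<N} (\<lambda>l. cnj (f x) * D t l)" by (intro sqn_cong) simp
      also have "\<dots> = (norm (f x))\<^sup>2 * sqn {..<N} (D t)" by (simp add: sqn_scale)
      also have "\<dots> \<le> (norm (f x))\<^sup>2 * sqn {..<N} t"
        by (intro mult_left_mono linear_contraction_sqn[OF D]) simp
      finally have "(1 - (norm (f x))\<^sup>2) * sqn {..<N} t \<le> 0" by (simp add: algebra_simps)
      moreover have "(norm (f x))\<^sup>2 < 1" using f[OF xX] by (simp add: power_less_one_iff)
      ultimately have "sqn {..<N} t = 0"
        using sqn_nonneg[of "{..<N}" t] by (simp add: mult_le_0_iff)
      then have "g x p l = cnj (G ?i l)" if "l < N" for l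
        using that by (simp add: sqn_eq_0_iff t_def)
      then have "h ?i b = L ?i b" if "b \<in> J" for b
        using that by (auto simp: h_def L_def J_def)
      then have "T (h ?i) (Inl r) = T (L ?i) (Inl r)"
        using r by (intro linear_contraction_cong[OF T J(2)]) (auto simp: J'_def)
      also have "\<dots> = cnj (W x p r)" using TL[OF i, of "Inl r"] r by (simp add: J'_mem R_def)
      finally show ?thesis by (simp add: \<Phi>_def)
    qed
    moreover have "\<Phi> \<in> contractive_matrix_multipliers m n X K"
    proof (rule contractive_matrix_multipliersI[OF kernel])
      fix F' assume F': "finite F'" "F' \<subseteq> X"
      define I' where "I' = F' \<times> {..<m}"
      define E where "E i j = cdot J (h j) (h i) - cdot J' (T (h j)) (T (h i))" for i j
      have I': "finite I'" "\<And>i. i \<in> I' \<Longrightarrow> fst i \<in> X" "\<And>i. i \<in> I' \<Longrightarrow> snd i < m"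
        using F' by (auto simp: I'_def)
      \<comment> \<open>The vector \<open>h\<close> contains the state times
        \<open>cnj (f x)\<close> and \<open>T\<close> returns the state itself. Hence the identity
        matrix minus the product of \<Phi> with its adjoint is E + (1 - f cnj f) \<Gamma>, where
        \<Gamma> is the Gram matrix of the states, and division by 1 - f cnj f leaves two positive
        summands.\<close>
      have "pos_semidef I' (\<lambda>i j. E i j / (1 - f (fst i) * cnj (f (fst j)))
          + (\<Sum>l<N. cnj (g (fst i) (snd i) l) * cnj (cnj (g (fst j) (snd j) l))))"
        unfolding E_def using f I'
        by (intro pos_semidef_add pos_semidef_mult_szego pos_semidef_defect[OF _ T] pos_semidef_sum pos_semidef_rank_one) auto
      moreover have "E i j / (1 - f (fst i) * cnj (f (fst j)))
          + (\<Sum>l<N. cnj (g (fst i) (snd i) l) * cnj (cnj (g (fst j) (snd j) l)))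
        = ((if snd i = snd j then 1 else 0) - (\<Sum>r<n. \<Phi> (fst i) (snd i) r * cnj (\<Phi> (fst j) (snd j) r))) * K (fst i) (fst j)"
        if ij: "i \<in> I'" "j \<in> I'" for i j
      proof -
        define \<Gamma> where "\<Gamma> = (\<Sum>l<N. cnj (g (fst i) (snd i) l) * g (fst j) (snd j) l)"
        define w where "w = (\<Sum>r<n. \<Phi> (fst i) (snd i) r * cnj (\<Phi> (fst j) (snd j) r))"
        have nz: "1 - f (fst i) * cnj (f (fst j)) \<noteq> 0"
          using ij I' f by (intro one_minus_mult_cnj_nonzero) auto
        have "cdot {..<m} (e (snd j)) (e (snd i)) = (if snd i = snd j then 1 else 0)"
          unfolding e_def using cdot_unit_unit[of "snd j" m "snd i"] ij I' by auto
        moreover have "cdot {..<N} (\<lambda>l. cnj (f (fst j)) * g (fst j) (snd j) l) (\<lambda>l. cnj (f (fst i)) * g (fst i) (snd i) l)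
            = f (fst i) * cnj (f (fst j)) * \<Gamma>"
          by (simp add: cdot_def \<Gamma>_def sum_distrib_left mult_ac)
        ultimately have 1: "cdot J (h j) (h i) = (if snd i = snd j then 1 else 0) + f (fst i) * cnj (f (fst j)) * \<Gamma>"
          by (simp add: J_def cdot_Plus h_def)
        have "cdot {..<N} (\<lambda>l. T (h j) (Inr l)) (\<lambda>l. T (h i) (Inr l)) = \<Gamma>"
          unfolding cdot_def \<Gamma>_def using Th I' ij by (intro sum.cong refl) (simp add: mult.commute)
        then have 2: "cdot J' (T (h j)) (T (h i)) = w + \<Gamma>"
          by (simp add: J'_def cdot_Plus w_def \<Phi>_def cdot_def[of "{..<n}"] mult.commute)
        have "E i j + \<Gamma> * (1 - f (fst i) * cnj (f (fst j))) = (if snd i = snd j then 1 else 0) - w"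
          unfolding E_def 1 2 by (simp add: algebra_simps)
        then have "E i j / (1 - f (fst i) * cnj (f (fst j))) + \<Gamma>
            = ((if snd i = snd j then 1 else 0) - w) / (1 - f (fst i) * cnj (f (fst j)))"
          using nz by (simp add: field_simps)
        then show ?thesis using K[of "fst i" "fst j"] I'(2) ij by (simp add: \<Gamma>_def w_def)
      qed
      ultimately show "pos_semidef (F' \<times> {..<m}) (\<lambda>i j.
          ((if snd i = snd j then 1 else 0) - (\<Sum>r<n. \<Phi> (fst i) (snd i) r * cnj (\<Phi> (fst j) (snd j) r))) * K (fst i) (fst j))"
        unfolding I'_def[symmetric] by (subst pos_semidef_cong[symmetric]) auto
    qed
    ultimately show ?thesis by blast
  qed
  then show ?thesis using kernel unfolding cnp_kernel_def by blast
qed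

section \<open>The equivalence for a product of two disc kernels\<close>

theorem theorem4p1:
  fixes \<Omega> :: "(complex ^ 'd) set"
    and u v :: "complex ^ 'd \<Rightarrow> complex"
    and w1 w2 :: "complex ^ 'd"
    and \<phi> :: "(complex ^ 'd) \<times> (complex ^ 'd) \<Rightarrow> complex"
    and K :: "(complex ^ 'd) \<times> (complex ^ 'd) \<Rightarrow> (complex ^ 'd) \<times> (complex ^ 'd) \<Rightarrow> complex"
  assumes "\<Omega> \<noteq> {}" and "connected \<Omega>" and "open \<Omega>"
    and "u ` \<Omega> \<subseteq> ball 0 1" and "v ` \<Omega> \<subseteq> ball 0 1"
    and "holomorphic_vec_on u \<Omega>" and "holomorphic_vec_on v \<Omega>"
    and "\<not> u constant_on \<Omega>" and "\<not> v constant_on \<Omega>"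
    and "w1 \<in> \<Omega>" and "w2 \<in> \<Omega>" and "u w1 = 0" and "v w2 = 0"
    and K_def: "K = kernel_tensor (disc_kernel u) (disc_kernel v)"
    and "\<phi> ` (\<Omega> \<times> \<Omega>) \<subseteq> ball 0 1"
    and "\<not> \<phi> constant_on (\<Omega> \<times> \<Omega>)"
    and "\<phi> \<in> contractive_multipliers (\<Omega> \<times> \<Omega>) K"
    and "\<phi> (w1, w2) = 0"
  shows "cnp_kernel (\<Omega> \<times> \<Omega>) (dBR_kernel \<phi> K) \<longleftrightarrow>
    (\<exists>c. norm c = 1 \<and>
       ((\<forall>x\<in>\<Omega>. \<forall>y\<in>\<Omega>. \<phi> (x, y) = c * u x) \<or> (\<forall>x\<in>\<Omega>. \<forall>y\<in>\<Omega>. \<phi> (x, y) = c * v y)))"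
proof
  assume "cnp_kernel (\<Omega> \<times> \<Omega>) (dBR_kernel \<phi> K)"
  with assms show "\<exists>c. norm c = 1 \<and>
      ((\<forall>x\<in>\<Omega>. \<forall>y\<in>\<Omega>. \<phi> (x, y) = c * u x) \<or> (\<forall>x\<in>\<Omega>. \<forall>y\<in>\<Omega>. \<phi> (x, y) = c * v y))"
    by (intro cnp_dBR_kernel_imp_coordinate[of \<Omega> u v w1 w2 K \<phi>] holomorphic_vec_on_imp_continuous_on)
next
  assume "\<exists>c. norm c = 1 \<and>
      ((\<forall>x\<in>\<Omega>. \<forall>y\<in>\<Omega>. \<phi> (x, y) = c * u x) \<or> (\<forall>x\<in>\<Omega>. \<forall>y\<in>\<Omega>. \<phi> (x, y) = c * v y))"
  then obtain c where c: "norm c = 1"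
    and \<phi>: "(\<forall>x\<in>\<Omega>. \<forall>y\<in>\<Omega>. \<phi> (x, y) = c * u x) \<or> (\<forall>x\<in>\<Omega>. \<forall>y\<in>\<Omega>. \<phi> (x, y) = c * v y)"
    by blast
  have cc: "c * cnj c = 1" using c complex_norm_square[of c] by simp
  \<comment> \<open>As c is unimodular it disappears from \<phi> cnj \<phi>, so the factor 1 -
    \<phi> cnj \<phi> cancels exactly one of the two denominators of K.\<close>
  have cancel: "c * s * cnj (c * t) = s * cnj t" for s t
  proof -
    have "c * s * cnj (c * t) = (c * cnj c) * (s * cnj t)" by (simp add: mult_ac)
    then show ?thesis using cc by simp
  qed
  have nz: "1 - u x * cnj (u x') \<noteq> 0" "1 - v x * cnj (v x') \<noteq> 0" if "x \<in> \<Omega>" "x' \<in> \<Omega>" for x x'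
    using assms(4,5) that by (intro one_minus_mult_cnj_nonzero; force)+
  from \<phi> show "cnp_kernel (\<Omega> \<times> \<Omega>) (dBR_kernel \<phi> K)"
  proof
    assume \<phi>: "\<forall>x\<in>\<Omega>. \<forall>y\<in>\<Omega>. \<phi> (x, y) = c * u x"
    show ?thesis
    proof (rule cnp_kernel_disc[where f = "\<lambda>p. v (snd p)"])
      show "norm (v (snd p)) < 1" if "p \<in> \<Omega> \<times> \<Omega>" for p using that assms(5) by force
      show "dBR_kernel \<phi> K p q = 1 / (1 - v (snd p) * cnj (v (snd q)))" if "p \<in> \<Omega> \<times> \<Omega>" "q \<in> \<Omega> \<times> \<Omega>" for p q
      proof -
        have "\<phi> p * cnj (\<phi> q) = u (fst p) * cnj (u (fst q))"
          using that \<phi> cancel by auto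
        then show ?thesis using that nz(1)[of "fst p" "fst q"]
          unfolding dBR_kernel_def K_def kernel_tensor_disc_kernel_eq by auto
      qed
    qed
  next
    assume \<phi>: "\<forall>x\<in>\<Omega>. \<forall>y\<in>\<Omega>. \<phi> (x, y) = c * v y"
    show ?thesis
    proof (rule cnp_kernel_disc[where f = "\<lambda>p. u (fst p)"])
      show "norm (u (fst p)) < 1" if "p \<in> \<Omega> \<times> \<Omega>" for p using that assms(4) by force
      show "dBR_kernel \<phi> K p q = 1 / (1 - u (fst p) * cnj (u (fst q)))" if "p \<in> \<Omega> \<times> \<Omega>" "q \<in> \<Omega> \<times> \<Omega>" for p q
      proof -
        have "\<phi> p * cnj (\<phi> q) = v (snd p) * cnj (v (snd q))"
          using that \<phi> cancel by auto
        then show ?thesis using that nz(2)[of "snd p" "snd q"]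
          unfolding dBR_kernel_def K_def kernel_tensor_disc_kernel_eq by auto
      qed
    qed
  qed
qed

end
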